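(* Let $\alpha\in(0,1)$, $p\ge1$, let $F^*$ be a probability distribution on $\mathbb{R}^{d+1}$ (the data-generating distribution of $(\mathbf{X},Y)$), and suppose $\Gamma:=\mathbb{E}^{F^*}[\|(\mathbf{X},Y)\|^r]<\infty$ for some $r>2$. For $\eta\in(0,1)$ set $$\varepsilon_N(\eta)=c_\alpha\,\frac{(\log(2N+1))^{1/r}}{\sqrt N},$$ $$c_\alpha=\frac{\alpha\vee(1-\alpha)}{\alpha\wedge(1-\alpha)}\left(360\sqrt{d+2}+2\sqrt{2\log\Big(\frac3\eta\Big)}+\sqrt{\frac{3\Gamma}{\eta}}\,\frac{32}{r-2}\sqrt{\log\Big(\frac{24}{\eta}\Big)+2(d+2)}\right).$$ Then for any $\eta\in(0,1)$, $$\mathbb{P}^N\Big(\mathbb{E}^{F^*}[\ell_\alpha(Y-\boldsymbol\beta^\top\mathbf{X}-s)]\le\sup_{F\in\mathbb{B}_p(\widehat F_N,\varepsilon_N(\eta))}\mathbb{E}^F[\ell_\alpha(Y-\boldsymbol\beta^\top\mathbf{X}-s)]\ \ \forall\,\boldsymbol\beta\in\mathbb{R}^d,\ s\in\mathbb{R}\Big)\ge1-\eta,$$ and thus $$\mathbb{P}^N\big(J_{\rm oos}\le\widehat J_N\big)\ge1-\eta,$$ where, with $\varepsilon_N=\varepsilon_N(\eta)$ and $(\widehat{\boldsymbol\beta}_N,\widehat s_N)$ an optimal solution of the outer infimum below, $$\widehat J_N=\inf_{s\in\mathbb{R},\,\boldsymbol\beta\in\mathbb{R}^d}\ \sup_{F\in\mathbb{B}_p(\widehat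 F_N,\varepsilon_N)}\mathbb{E}^F[\ell_\alpha(Y-\boldsymbol\beta^\top\mathbf{X}-s)],\qquad J_{\rm oos}=\mathbb{E}^{F^*}[\ell_\alpha(Y-\widehat{\boldsymbol\beta}_N^\top\mathbf{X}-\widehat s_N)].$$
   Context: The check loss is $\ell_\alpha(u)=u(\alpha-\mathbf{1}_{\{u<0\}})$. $\widehat F_N$ is the empirical distribution of $N$ i.i.d. samples of $(\mathbf{X},Y)\in\mathbb{R}^d\times\mathbb{R}$ drawn from $F^*$, and $\mathbb{P}^N$ is the probability over these samples. $\|\cdot\|$ is a fixed norm on $\mathbb{R}^{d+1}$. The type-$p$ Wasserstein distance between distributions $F,G$ on $\mathbb{R}^{d+1}$ is $W_p(F,G)=\inf_\Pi(\mathbb{E}^\Pi\|\xi_1-\xi_2\|^p)^{1/p}$ for $p\in[1,\infty)$ and $W_\infty(F,G)=\inf_\Pi\operatorname{ess\,sup}^\Pi\|\xi_1-\xi_2\|$, over couplings $\Pi$ of $F$ and $G$; $\mathbb{B}_p(\widehat F_N,\varepsilon)$ is the set of probability distributions $F$ on $\mathbb{R}^{d+1}$ with $W_p(F,\widehat F_N)\le\varepsilon$. $\mathbb{E}^F$ denotes expectation when $(\mathbf{X},Y)\sim F$. $a\vee b=\max\{a,b\}$, $a\wedge b=\min\{a,b\}$. *)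

theory Defs
  imports "HOL-Probability.Probability" "HOL-Probability.Essential_Supremum"
begin

definition check_loss :: "real \<Rightarrow> real \<Rightarrow> real" where
  "check_loss \<alpha> u = u * (\<alpha> - (if u < 0 then 1 else 0))"

lemma check_loss_nonneg: "0 < \<alpha> \<Longrightarrow> \<alpha> < 1 \<Longrightarrow> 0 \<le> check_loss \<alpha> u"
  by (auto simp: check_loss_def zero_le_mult_iff)

text \<open>An arbitrary norm, not necessarily the Euclidean one of the type class.\<close>

definition is_norm :: "('a::real_vector \<Rightarrow> real) \<Rightarrow> bool" where
  "is_norm nrm \<longleftrightarrow>
     (\<forall>x. 0 \<le> nrm x) \<and>
     (\<forall>x. nrm x = 0 \<longleftrightarrow> x = 0) \<and>
     (\<forall>a x. nrm (a *\<^sub>R x) = \<bar>a\<bar> * nrm x) \<and>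
     (\<forall>x y. nrm (x + y) \<le> nrm x + nrm y)"

definition distributions :: "'a::topological_space measure set" where
  "distributions = {F. prob_space F \<and> sets F = sets borel}"

definition couplings ::
  "'a::topological_space measure \<Rightarrow> 'a measure \<Rightarrow> ('a \<times> 'a) measure set" where
  "couplings F G =
     {\<pi>. prob_space \<pi> \<and> sets \<pi> = sets (borel \<Otimes>\<^sub>M borel) \<and>
         distr \<pi> borel fst = F \<and> distr \<pi> borel snd = G}"

text \<open>The \<open>p\<close>-th root of an extended nonnegative real.\<close>

definition ennreal_root :: "real \<Rightarrow> ennreal \<Rightarrow> ennreal" where
  "ennreal_root p x = (if x = \<infinity> then \<infinity> else ennreal (enn2real x powr (1 / p)))"

text \<open>The order ranges over \<open>1 \<le> p \<le> \<infinity>\<close>; the distance is \<open>\<infinity>\<close> when no coupling has finite cost.\<close>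

definition wasserstein ::
  "('a::euclidean_space \<Rightarrow> real) \<Rightarrow> ereal \<Rightarrow> 'a measure \<Rightarrow> 'a measure \<Rightarrow> ennreal" where
  "wasserstein nrm p F G =
     (if p = \<infinity>
      then (INF \<pi>\<in>couplings F G. esssup \<pi> (\<lambda>(x, y). ennreal (nrm (x - y))))
      else (INF \<pi>\<in>couplings F G. ennreal_root (real_of_ereal p)
              (\<integral>\<^sup>+(x, y). ennreal (nrm (x - y) powr real_of_ereal p) \<partial>\<pi>)))"

definition wasserstein_ball ::
  "('a::euclidean_space \<Rightarrow> real) \<Rightarrow> ereal \<Rightarrow> 'a measure \<Rightarrow> real \<Rightarrow> 'a measure set" where
  "wasserstein_ball nrm p G \<epsilon> = {F \<in> distributions. wasserstein nrm p F G \<le> ennreal \<epsilon>}"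

text \<open>
  A sample of size \<open>N\<close> is a function on the indices \<open>i < N\<close>. Repeated sample points carry
  the corresponding multiple of \<open>1 / N\<close>.
\<close>

definition empirical :: "nat \<Rightarrow> (nat \<Rightarrow> 'a::topological_space) \<Rightarrow> 'a measure" where
  "empirical N \<omega> = distr (uniform_count_measure {..<N}) borel \<omega>"

definition sample_measure :: "nat \<Rightarrow> 'a measure \<Rightarrow> (nat \<Rightarrow> 'a) measure" where
  "sample_measure N F = (\<Pi>\<^sub>M i\<in>{..<N}. F)"

text \<open>
  A data point is a pair \<open>(x, y)\<close> of a covariate vector and a response. The loss is nonnegative
  for \<open>0 < \<alpha> < 1\<close>, so its expectation is taken in \<open>[0, \<infinity>]\<close>.
\<close>

definition risk ::
  "real \<Rightarrow> ((real^'d) \<times> real) measure \<Rightarrow> real^'d \<Rightarrow> real \<Rightarrow> ennreal" where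
  "risk \<alpha> F \<beta> s = (\<integral>\<^sup>+(x, y). ennreal (check_loss \<alpha> (y - \<beta> \<bullet> x - s)) \<partial>F)"

definition worst_case_risk ::
  "((real^'d) \<times> real \<Rightarrow> real) \<Rightarrow> ereal \<Rightarrow> real \<Rightarrow> real \<Rightarrow> ((real^'d) \<times> real) measure
     \<Rightarrow> real^'d \<Rightarrow> real \<Rightarrow> ennreal" where
  "worst_case_risk nrm p \<epsilon> \<alpha> G \<beta> s = (SUP F\<in>wasserstein_ball nrm p G \<epsilon>. risk \<alpha> F \<beta> s)"

definition dro_value ::
  "((real^'d) \<times> real \<Rightarrow> real) \<Rightarrow> ereal \<Rightarrow> real \<Rightarrow> real \<Rightarrow> ((real^'d) \<times> real) measure
     \<Rightarrow> ennreal" where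
  "dro_value nrm p \<epsilon> \<alpha> G = (INF (\<beta>, s)\<in>UNIV. worst_case_risk nrm p \<epsilon> \<alpha> G \<beta> s)"

definition dro_optimal ::
  "((real^'d) \<times> real \<Rightarrow> real) \<Rightarrow> ereal \<Rightarrow> real \<Rightarrow> real \<Rightarrow> ((real^'d) \<times> real) measure
     \<Rightarrow> real^'d \<Rightarrow> real \<Rightarrow> bool" where
  "dro_optimal nrm p \<epsilon> \<alpha> G \<beta> s \<longleftrightarrow>
     worst_case_risk nrm p \<epsilon> \<alpha> G \<beta> s = dro_value nrm p \<epsilon> \<alpha> G"

text \<open>Below, \<open>d\<close> is the number of covariates and \<open>\<Gamma>\<close> the \<open>r\<close>-th moment of the data.\<close>

definition c_const :: "nat \<Rightarrow> real \<Rightarrow> real \<Rightarrow> real \<Rightarrow> real \<Rightarrow> real" where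
  "c_const d \<alpha> r \<Gamma> \<eta> =
     max \<alpha> (1 - \<alpha>) / min \<alpha> (1 - \<alpha>) *
     (360 * sqrt (real d + 2) + 2 * sqrt (2 * ln (3 / \<eta>)) +
      sqrt (3 * \<Gamma> / \<eta>) * (32 / (r - 2)) * sqrt (ln (24 / \<eta>) + 2 * (real d + 2)))"

definition radius :: "nat \<Rightarrow> real \<Rightarrow> real \<Rightarrow> real \<Rightarrow> nat \<Rightarrow> real \<Rightarrow> real" where
  "radius d \<alpha> r \<Gamma> N \<eta> =
     c_const d \<alpha> r \<Gamma> \<eta> * (ln (2 * real N + 1) powr (1 / r)) / sqrt (real N)"

end

theory Submission
  imports Defs
begin

text \<open>
Write a data point as \<open>z = (x, y)\<close> and the residual of \<open>(\<beta>, s)\<close> as \<open>g \<bullet> z - s\<close>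
with \<open>g = (- \<beta>, 1)\<close>. Two facts meet in the middle.

On the robust side, the ball always contains the distribution that moves every sample point by
\<open>\<epsilon>\<close> in the direction that the dual norm \<open>\<gamma>\<close> of \<open>g\<close> is attained, away from zero residual.
This raises every loss by at least \<open>min \<alpha> (1 - \<alpha>) * \<epsilon> * \<gamma>\<close>, for every order \<open>p\<close>
(\<open>worst_case_risk_ge_empirical\<close>).

On the statistical side, it then suffices that the true risk exceeds the empirical risk by at most
this amount, simultaneously for all parameters. Dividing by \<open>\<gamma>\<close> normalizes the slope to dual norm
at most one and leaves a class of functions bounded by a multiple of the norm of the data point. The
sample is split at norm 2. The part inside the ball of radius 2 has bounded differences,
so its supremum is subgaussian around its mean (\<open>bounded_differences_tail\<close>); the part outside has
variance controlled by the \<open>r\<close>-th moment, and Chebyshev's inequality suffices for it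
(\<open>variance_tail\<close>).

Both means are bounded in the same way (\<open>expected_sup_check_loss_le\<close>). Symmetrization and the
contraction principle replace the check loss by its argument, a linear functional minus a threshold.
The supremum over the linear functionals is at most twice a maximum over a net of at most \<open>5 ^ n\<close> of them,
which costs a factor of order \<open>sqrt n\<close>. The threshold ranges over all reals, but only matters when
clipped at the norm of the data point; the sums over clipped thresholds are integrals of signed
counts of the points whose norm exceeds \<open>t\<close>, and the integral over \<open>t\<close> of the square roots of the
tail probabilities is where the factor \<open>1 / (r - 2)\<close> comes from.

Suprema are first taken over finitely many parameters, then over a countable dense set by continuity
of the measure, and finally over all parameters because, for each sample, the risk and the worst-case risk
are Lipschitz in the parameters. The event in question is measurable because the worst-case
risk is also Lipschitz in the sample (\<open>ball_sup_Lipschitz_in_sample\<close>): a transport plan from an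
empirical distribution can be dragged along when its sample points move.
\<close>

section \<open>Independent samples\<close>

text \<open>
A sample of size \<open>N + 1\<close> is an independent pair of a point and a sample of size \<open>N\<close>. All later
inductions on the sample size integrate the last point out by means of this identity.
\<close>

lemma distr_extend_sample:
  assumes "prob_space P"
  shows "distr (P \<Otimes>\<^sub>M sample_measure N P) (sample_measure (Suc N) P) (\<lambda>(y, x). x(N := y))
    = sample_measure (Suc N) P"
  using distr_pair_PiM_eq_PiM[of "{..<N}" "\<lambda>_. P" N] assms
  by (simp add: sample_measure_def lessThan_Suc)

lemma prob_space_sample_measure: "prob_space P \<Longrightarrow> prob_space (sample_measure N P)"
  unfolding sample_measure_def by (rule prob_space_PiM) auto

lemma measurable_extend_sample:
  "(\<lambda>(y, x). x(N := y)) \<in> P \<Otimes>\<^sub>M sample_measure N P \<rightarrow>\<^sub>M sample_measure (Suc N) P"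
  unfolding sample_measure_def lessThan_Suc by measurable

lemma measurable_sample_component:
  "i < N \<Longrightarrow> (\<lambda>x. x i) \<in> sample_measure N P \<rightarrow>\<^sub>M P"
  unfolding sample_measure_def by measurable

lemma distr_sample_component:
  "prob_space P \<Longrightarrow> i < N \<Longrightarrow> distr (sample_measure N P) P (\<lambda>x. x i) = P"
  unfolding sample_measure_def by (rule distr_PiM_component) auto

lemma integrable_sample_component:
  fixes f :: "'a \<Rightarrow> real"
  assumes "prob_space P" "i < N" "integrable P f"
  shows "integrable (sample_measure N P) (\<lambda>x. f (x i))"
proof -
  have "integrable (distr (sample_measure N P) P (\<lambda>x. x i)) f"
    using assms by (simp add: distr_sample_component)
  from integrable_distr[OF measurable_sample_component[OF assms(2)] this] show ?thesis .
qed

lemma integral_sample_component: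
  fixes f :: "'a \<Rightarrow> real"
  assumes "prob_space P" "i < N" "f \<in> borel_measurable P"
  shows "(\<integral>x. f (x i) \<partial>sample_measure N P) = integral\<^sup>L P f"
  using integral_distr[OF measurable_sample_component[OF assms(2)] assms(3)] distr_sample_component[OF assms(1,2)]
  by simp

lemma integrable_pair_fst:
  fixes f :: "'a \<Rightarrow> real"
  assumes "prob_space Q" "integrable P f"
  shows "integrable (P \<Otimes>\<^sub>M Q) (\<lambda>z. f (fst z))"
proof -
  have "integrable (distr (P \<Otimes>\<^sub>M Q) P fst) f"
    using assms by (simp add: prob_space.distr_pair_fst)
  from integrable_distr[OF measurable_fst this] show ?thesis .
qed

lemma integrable_pair_snd:
  fixes f :: "'b \<Rightarrow> real"
  assumes "prob_space P" "prob_space Q" "integrable Q f"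
  shows "integrable (P \<Otimes>\<^sub>M Q) (\<lambda>z. f (snd z))"
proof -
  interpret P: prob_space P by fact
  interpret Q: prob_space Q by fact
  interpret QP: pair_sigma_finite Q P ..
  have "integrable (Q \<Otimes>\<^sub>M P) (\<lambda>z. f (fst z))"
    using assms by (intro integrable_pair_fst)
  from QP.integrable_product_swap[OF this] show ?thesis
    by (simp add: case_prod_beta')
qed

lemma integrable_sample_Suc_iff:
  fixes f :: "_ \<Rightarrow> real"
  assumes "prob_space P" "f \<in> borel_measurable (sample_measure (Suc N) P)"
  shows "integrable (sample_measure (Suc N) P) f \<longleftrightarrow>
    integrable (P \<Otimes>\<^sub>M sample_measure N P) (\<lambda>(y, x). f (x(N := y)))"
  using integrable_distr_eq[OF measurable_extend_sample assms(2)] distr_extend_sample[OF assms(1), of N]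
  by (simp add: case_prod_beta')

lemma integral_sample_Suc:
  fixes f :: "_ \<Rightarrow> real"
  assumes "prob_space P" "f \<in> borel_measurable (sample_measure (Suc N) P)"
  shows "integral\<^sup>L (sample_measure (Suc N) P) f =
    (\<integral>(y, x). f (x(N := y)) \<partial>(P \<Otimes>\<^sub>M sample_measure N P))"
  using integral_distr[OF measurable_extend_sample assms(2)] distr_extend_sample[OF assms(1), of N]
  by (simp add: case_prod_beta')

lemma space_sample_measure: "space (sample_measure N P) = PiE {..<N} (\<lambda>_. space P)"
  by (simp add: sample_measure_def space_PiM)

lemma extend_sample_in_space:
  "x \<in> space (sample_measure N P) \<Longrightarrow> y \<in> space P \<Longrightarrow> x(N := y) \<in> space (sample_measure (Suc N) P)"
  by (auto simp: space_sample_measure PiE_iff extensional_def)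

lemma update_sample_in_space:
  "x \<in> space (sample_measure N P) \<Longrightarrow> y \<in> space P \<Longrightarrow> i < N \<Longrightarrow> x(i := y) \<in> space (sample_measure N P)"
  by (auto simp: space_sample_measure PiE_iff extensional_def)

lemma sample_measure_0_integral:
  fixes g :: "_ \<Rightarrow> real"
  shows "x \<in> space (sample_measure 0 P) \<Longrightarrow> integral\<^sup>L (sample_measure 0 P) g = g x"
  by (simp add: space_sample_measure sample_measure_def PiM_empty lebesgue_integral_count_space_finite)

lemma measurable_extend_last:
  assumes "x \<in> space (sample_measure N P)"
  shows "(\<lambda>y. x(N := y)) \<in> P \<rightarrow>\<^sub>M sample_measure (Suc N) P"
  using measurable_compose[OF measurable_Pair2'[OF assms] measurable_extend_sample] by simp

section \<open>Symmetrization and contraction\<close>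

lemma Max_attained:
  fixes f :: "'b \<Rightarrow> real"
  assumes "finite T" "T \<noteq> {}"
  obtains s where "s \<in> T" "(MAX t\<in>T. f t) = f s"
  using Max_in[of "f ` T"] assms by blast

text \<open>
An inequality between expected maxima that holds for one draw and \<^emph>\<open>every\<close> offset \<open>a\<close> passes to
sums over independent draws. The draws are exchanged one at a time, and the sum over all
other draws is absorbed into the offset. This replaces the usual handling of ghost samples
and sign vectors by a statement about a single data point.
\<close>

lemma comparison_sample:
  fixes u :: "'b \<Rightarrow> 'a \<Rightarrow> real" and v :: "'b \<Rightarrow> 'c \<Rightarrow> real"
  assumes P: "prob_space P" and Q: "prob_space Q" and T: "finite T" "T \<noteq> {}"
    and u: "\<And>t. t \<in> T \<Longrightarrow> integrable P (u t)" and v: "\<And>t. t \<in> T \<Longrightarrow> integrable Q (v t)"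
    and step: "\<And>a :: 'b \<Rightarrow> real.
      (\<integral>z. (MAX t\<in>T. a t + u t z) \<partial>P) \<le> (\<integral>z. (MAX t\<in>T. a t + v t z) \<partial>Q)"
  shows "(\<integral>x. (MAX t\<in>T. a t + (\<Sum>i<N. u t (x i))) \<partial>sample_measure N P)
    \<le> (\<integral>x. (MAX t\<in>T. a t + (\<Sum>i<N. v t (x i))) \<partial>sample_measure N Q)"
proof (induction N arbitrary: a)
  case 0
  interpret PP: prob_space "sample_measure 0 P" using P by (rule prob_space_sample_measure)
  interpret QQ: prob_space "sample_measure 0 Q" using Q by (rule prob_space_sample_measure)
  show ?case using PP.prob_space QQ.prob_space by simp
next
  case (Suc N)
  interpret P: prob_space P by fact
  interpret Q: prob_space Q by fact
  interpret PN: prob_space "sample_measure N P" using P by (rule prob_space_sample_measure)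
  interpret QN: prob_space "sample_measure N Q" using Q by (rule prob_space_sample_measure)
  interpret PPN: pair_sigma_finite P "sample_measure N P" ..
  interpret PQN: pair_sigma_finite P "sample_measure N Q" ..
  interpret QQN: pair_sigma_finite Q "sample_measure N Q" ..
  have [measurable]: "u t \<in> borel_measurable P" "v t \<in> borel_measurable Q" if "t \<in> T" for t
    using u v that by auto
  have mu: "(\<lambda>x. u t (x i)) \<in> borel_measurable (sample_measure M P)"
    and mv: "(\<lambda>x. v t (x i)) \<in> borel_measurable (sample_measure M Q)" if "t \<in> T" "i < M" for t i M
    using integrable_sample_component[OF P _ u, of i M t] integrable_sample_component[OF Q _ v, of i M t] that
    by auto
  have iu: "integrable (sample_measure N P) (\<lambda>x. \<Sum>i<N. u t (x i))"
    and iv: "integrable (sample_measure N Q) (\<lambda>x. \<Sum>i<N. v t (x i))" if "t \<in> T" for t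
    using that u v by (auto intro!: Bochner_Integration.integrable_sum integrable_sample_component P Q)
  have upd: "(\<Sum>i<N. f ((x(N := y)) i)) = (\<Sum>i<N. f (x i))" for f :: "'d \<Rightarrow> real" and x y
    by (rule sum.cong) auto
  have int: "integrable (P1 \<Otimes>\<^sub>M P2) (\<lambda>z. MAX t\<in>T. a t + (f t (fst z) + g t (snd z)))"
    if P12: "prob_space P1" "prob_space P2"
      and fg: "\<And>t. t \<in> T \<Longrightarrow> integrable P1 (f t)" "\<And>t. t \<in> T \<Longrightarrow> integrable P2 (g t)"
    for P1 :: "'p measure" and P2 :: "'q measure" and f g
  proof -
    have "prob_space (P1 \<Otimes>\<^sub>M P2)" using P12 by (intro prob_space_pair)
    then have c: "integrable (P1 \<Otimes>\<^sub>M P2) (\<lambda>_. c :: real)" for c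
      by (simp add: prob_space.finite_measure finite_measure.integrable_const)
    have "integrable (P1 \<Otimes>\<^sub>M P2) (\<lambda>z. a t + (f t (fst z) + g t (snd z)))" if "t \<in> T" for t
      using integrable_pair_fst[of P2 P1 "f t"] integrable_pair_snd[of P1 P2 "g t"] \<open>t \<in> T\<close>
        P12 fg by (intro Bochner_Integration.integrable_add c) auto
    then show ?thesis using T by (intro integrable_MAX)
  qed
  note int1 = int[of P "sample_measure N P" u "\<lambda>t x. \<Sum>i<N. u t (x i)", OF P PN.prob_space_axioms u iu]
  note int2 = int[of P "sample_measure N Q" u "\<lambda>t x. \<Sum>i<N. v t (x i)", OF P QN.prob_space_axioms u iv]
  note int3 = int[of Q "sample_measure N Q" v "\<lambda>t x. \<Sum>i<N. v t (x i)", OF Q QN.prob_space_axioms v iv]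
  have "(\<integral>x. (MAX t\<in>T. a t + (\<Sum>i<Suc N. u t (x i))) \<partial>sample_measure (Suc N) P)
    = (\<integral>z. (MAX t\<in>T. a t + (u t (fst z) + (\<Sum>i<N. u t (snd z i)))) \<partial>(P \<Otimes>\<^sub>M sample_measure N P))"
    using T by (subst integral_sample_Suc[OF P]) (auto simp: upd case_prod_beta' add_ac intro!: borel_measurable_Max borel_measurable_add borel_measurable_sum mu mv)
  also have "\<dots> = (\<integral>y. (\<integral>x. (MAX t\<in>T. (a t + u t y) + (\<Sum>i<N. u t (x i))) \<partial>sample_measure N P) \<partial>P)"
    using PPN.integral_fst'[OF int1] by (simp add: add_ac)
  also have "\<dots> \<le> (\<integral>y. (\<integral>x. (MAX t\<in>T. (a t + u t y) + (\<Sum>i<N. v t (x i))) \<partial>sample_measure N Q) \<partial>P)"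
    using PPN.integrable_fst'[OF int1] PQN.integrable_fst'[OF int2]
    by (intro integral_mono Suc.IH) (auto simp: add_ac)
  also have "\<dots> = (\<integral>x. (\<integral>y. (MAX t\<in>T. (a t + (\<Sum>i<N. v t (x i))) + u t y) \<partial>P) \<partial>sample_measure N Q)"
    using PQN.Fubini_integral[of "\<lambda>y x. MAX t\<in>T. a t + (u t y + (\<Sum>i<N. v t (x i)))"] int2
    by (simp add: case_prod_beta' add_ac)
  also have "\<dots> \<le> (\<integral>x. (\<integral>y. (MAX t\<in>T. (a t + (\<Sum>i<N. v t (x i))) + v t y) \<partial>Q) \<partial>sample_measure N Q)"
    using PQN.integrable_snd[of "\<lambda>y x. MAX t\<in>T. a t + (u t y + (\<Sum>i<N. v t (x i)))"] int2
      QQN.integrable_snd[of "\<lambda>y x. MAX t\<in>T. a t + (v t y + (\<Sum>i<N. v t (x i)))"] int3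
    by (intro integral_mono step) (auto simp: case_prod_beta' add_ac)
  also have "\<dots> = (\<integral>z. (MAX t\<in>T. a t + (v t (fst z) + (\<Sum>i<N. v t (snd z i)))) \<partial>(Q \<Otimes>\<^sub>M sample_measure N Q))"
    using QQN.integral_snd[of "\<lambda>y x. MAX t\<in>T. a t + (v t y + (\<Sum>i<N. v t (x i)))"] int3
    by (simp add: case_prod_beta' add_ac)
  also have "\<dots> = (\<integral>x. (MAX t\<in>T. a t + (\<Sum>i<Suc N. v t (x i))) \<partial>sample_measure (Suc N) Q)"
    using T by (subst integral_sample_Suc[OF Q]) (auto simp: upd case_prod_beta' add_ac intro!: borel_measurable_Max borel_measurable_add borel_measurable_sum mu mv)
  finally show ?case .
qed

definition sgn_of :: "bool \<Rightarrow> real" where "sgn_of b = (if b then 1 else -1)"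

text \<open>
The law of a data point together with an independent fair sign. Sampling from it yields the data
and the Rademacher signs at once.
\<close>

definition signed :: "'a measure \<Rightarrow> ('a \<times> bool) measure" where
  "signed P = P \<Otimes>\<^sub>M measure_pmf (pmf_of_set UNIV)"

lemma prob_space_signed: "prob_space P \<Longrightarrow> prob_space (signed P)"
  unfolding signed_def by (intro prob_space_pair measure_pmf.prob_space_axioms)

lemma measurable_signed [measurable]:
  "fst \<in> signed P \<rightarrow>\<^sub>M P" "(\<lambda>q. sgn_of (snd q)) \<in> borel_measurable (signed P)"
  unfolding signed_def by measurable

lemma integral_signed:
  fixes F :: "'a \<Rightarrow> bool \<Rightarrow> real"
  assumes P: "prob_space P" and F: "\<And>b. integrable P (\<lambda>z. F z b)"
  shows "integrable (signed P) (\<lambda>q. F (fst q) (snd q))"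
    and "(\<integral>q. F (fst q) (snd q) \<partial>signed P) = ((\<integral>z. F z True \<partial>P) + (\<integral>z. F z False \<partial>P)) / 2"
proof -
  let ?B = "measure_pmf (pmf_of_set (UNIV :: bool set))"
  interpret P: prob_space P by fact
  interpret B: prob_space ?B by (rule measure_pmf.prob_space_axioms)
  interpret PB: pair_sigma_finite P ?B ..
  have eq: "F z b = F z True * indicator {True} b + F z False * indicator {False} b" for z b
    by (cases b) auto
  have "integrable (P \<Otimes>\<^sub>M ?B) (\<lambda>q. F (fst q) c * indicator {c} (snd q))" for c
  proof (rule Bochner_Integration.integrable_bound)
    show "integrable (P \<Otimes>\<^sub>M ?B) (\<lambda>q. F (fst q) c)"
      using F by (intro integrable_pair_fst measure_pmf.prob_space_axioms)
    have "(\<lambda>q. F (fst q) c) \<in> borel_measurable (P \<Otimes>\<^sub>M ?B)"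
      using F[of c] by (intro measurable_compose[OF measurable_fst]) auto
    moreover have "(\<lambda>q. indicator {c} (snd q) :: real) \<in> borel_measurable (P \<Otimes>\<^sub>M ?B)"
      by (intro measurable_compose[OF measurable_snd]) auto
    ultimately show "(\<lambda>q. F (fst q) c * indicator {c} (snd q)) \<in> borel_measurable (P \<Otimes>\<^sub>M ?B)"
      by (rule borel_measurable_times)
  qed (auto simp: indicator_def)
  note i = this
  have *: "integrable (P \<Otimes>\<^sub>M ?B) (\<lambda>q. F (fst q) (snd q))"
    by (subst eq) (intro Bochner_Integration.integrable_add i)
  then show "integrable (signed P) (\<lambda>q. F (fst q) (snd q))"
    by (simp add: signed_def)
  have "(\<integral>q. F (fst q) (snd q) \<partial>signed P) = (\<integral>z. (\<integral>b. F z b \<partial>?B) \<partial>P)"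
    using PB.integral_fst'[OF *] by (simp add: signed_def)
  also have "(\<lambda>z. \<integral>b. F z b \<partial>?B) = (\<lambda>z. (F z True + F z False) / 2)"
    by (subst integral_pmf_of_set) (auto simp: UNIV_bool fun_eq_iff)
  finally show "(\<integral>q. F (fst q) (snd q) \<partial>signed P) = ((\<integral>z. F z True \<partial>P) + (\<integral>z. F z False \<partial>P)) / 2"
    using F by simp
qed

text \<open>
Symmetrization for one draw needs only convexity of the maximum:
\<open>a + E f - f z\<close> is the midpoint of \<open>a + 2 E f\<close> and \<open>a - 2 f z\<close>, and Jensen's inequality
moves the first expectation out of the maximum. After that, \<open>f\<close> occurs with both signs at the same
\<open>z\<close>, and only the difference of \<open>f\<close> at the two maximizers matters. The contraction principle
therefore only has to dominate these differences by those of \<open>h\<close>.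
\<close>

lemma symmetrization_contraction_step:
  fixes f h :: "'b \<Rightarrow> 'a \<Rightarrow> real"
  assumes P: "prob_space P" and T: "finite T" "T \<noteq> {}"
    and f: "\<And>t. t \<in> T \<Longrightarrow> integrable P (f t)" and h: "\<And>t. t \<in> T \<Longrightarrow> integrable P (h t)"
    and lip: "\<And>s t z. s \<in> T \<Longrightarrow> t \<in> T \<Longrightarrow> z \<in> space P \<Longrightarrow> \<bar>f s z - f t z\<bar> \<le> L * \<bar>h s z - h t z\<bar>"
  shows "(\<integral>z. (MAX t\<in>T. a t + (integral\<^sup>L P (f t) - f t z)) \<partial>P)
    \<le> (\<integral>q. (MAX t\<in>T. a t + 2 * L * (sgn_of (snd q) * h t (fst q))) \<partial>signed P)"
proof -
  interpret P: prob_space P by fact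
  have i: "integrable P (\<lambda>z. MAX t\<in>T. a t + c * g t z)" if "\<And>t. t \<in> T \<Longrightarrow> integrable P (g t)" for c g
    using that T by (intro integrable_MAX) auto
  have contract: "(MAX t\<in>T. a t + 2 * f t z) + (MAX t\<in>T. a t + (-2) * f t z)
     \<le> (MAX t\<in>T. a t + (2*L) * h t z) + (MAX t\<in>T. a t + (-(2*L)) * h t z)" if z: "z \<in> space P" for z
  proof -
    obtain s where s: "s \<in> T" "(MAX t\<in>T. a t + 2 * f t z) = a s + 2 * f s z"
      using Max_attained[OF T] .
    obtain t where t: "t \<in> T" "(MAX t\<in>T. a t + (-2) * f t z) = a t - 2 * f t z"
      using Max_attained[OF T, of "\<lambda>t. a t + (-2) * f t z"] by auto
    have ge: "a r + c * h r z \<le> (MAX t\<in>T. a t + c * h t z)" if "r \<in> T" for r c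
      using T that by (intro Max_ge) auto
    have le: "f s z - f t z \<le> L * \<bar>h s z - h t z\<bar>"
      using lip[OF s(1) t(1) z] by linarith
    show ?thesis
    proof (cases "h s z \<ge> h t z")
      case True
      then have "2 * f s z - 2 * f t z \<le> (2*L) * h s z + (-(2*L)) * h t z"
        using le by (simp add: algebra_simps)
      then show ?thesis using ge[OF s(1), of "2*L"] ge[OF t(1), of "-(2*L)"] s t by linarith
    next
      case False
      then have "2 * f s z - 2 * f t z \<le> (2*L) * h t z + (-(2*L)) * h s z"
        using le by (simp add: algebra_simps)
      then show ?thesis using ge[OF t(1), of "2*L"] ge[OF s(1), of "-(2*L)"] s t by linarith
    qed
  qed
  have "a t + (integral\<^sup>L P (f t) - f t z)
      \<le> ((\<integral>z. (MAX t\<in>T. a t + 2 * f t z) \<partial>P) + (MAX t\<in>T. a t + (-2) * f t z)) / 2" if t: "t \<in> T" for t z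
  proof -
    have "(\<integral>z. a t + 2 * f t z \<partial>P) \<le> (\<integral>z. (MAX t\<in>T. a t + 2 * f t z) \<partial>P)"
      using t T f i[of f 2] by (intro integral_mono) auto
    then have "a t + 2 * integral\<^sup>L P (f t) \<le> (\<integral>z. (MAX t\<in>T. a t + 2 * f t z) \<partial>P)"
      using f[OF t] by (simp add: P.prob_space)
    moreover have "a t + (-2) * f t z \<le> (MAX t\<in>T. a t + (-2) * f t z)"
      using T t by (intro Max_ge) auto
    ultimately show ?thesis by simp
  qed
  then have "(MAX t\<in>T. a t + (integral\<^sup>L P (f t) - f t z))
      \<le> ((\<integral>z. (MAX t\<in>T. a t + 2 * f t z) \<partial>P) + (MAX t\<in>T. a t + (-2) * f t z)) / 2" for z
    using T by (intro Max.boundedI) auto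
  then have "(\<integral>z. (MAX t\<in>T. a t + (integral\<^sup>L P (f t) - f t z)) \<partial>P)
    \<le> (\<integral>z. ((\<integral>z. (MAX t\<in>T. a t + 2 * f t z) \<partial>P) + (MAX t\<in>T. a t + (-2) * f t z)) / 2 \<partial>P)"
    using i[of f "-2"] f T by (intro integral_mono integrable_MAX) auto
  also have "\<dots> = (\<integral>z. (MAX t\<in>T. a t + 2 * f t z) + (MAX t\<in>T. a t + (-2) * f t z) \<partial>P) / 2"
    using i[of f "-2"] i[of f 2] f by (simp add: P.prob_space)
  also have "\<dots> \<le> (\<integral>z. (MAX t\<in>T. a t + (2*L) * h t z) + (MAX t\<in>T. a t + (-(2*L)) * h t z) \<partial>P) / 2"
    by (intro divide_right_mono integral_mono Bochner_Integration.integrable_add contract i f h) auto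
  also have "\<dots> = (\<integral>q. (MAX t\<in>T. a t + (2 * L * sgn_of (snd q)) * h t (fst q)) \<partial>signed P)"
    using integral_signed(2)[OF P, of "\<lambda>z b. MAX t\<in>T. a t + (2 * L * sgn_of b) * h t z"]
      i[of h "2*L"] i[of h "-(2*L)"] i[of h] h by (simp add: sgn_of_def)
  finally show ?thesis by (simp add: mult.assoc)
qed

section \<open>Concentration around the mean\<close>

text \<open>
Hoeffding's lemma for a function known only through its oscillation: the infimum serves as the left
end of the interval that it demands.
\<close>

lemma hoeffding_oscillation:
  fixes f :: "'a \<Rightarrow> real"
  assumes P: "prob_space P" and f: "f \<in> borel_measurable P" and l: "l > 0"
    and osc: "\<And>y z. y \<in> space P \<Longrightarrow> z \<in> space P \<Longrightarrow> f y \<le> f z + c"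
  shows "(\<integral>y. exp (l * (f y - integral\<^sup>L P f)) \<partial>P) \<le> exp (l\<^sup>2 * c\<^sup>2 / 8)"
proof -
  interpret P: prob_space P by fact
  obtain z where z: "z \<in> space P" using P.not_empty by blast
  define a where "a = (INF y\<in>space P. f y)"
  have bdd: "bdd_below (f ` space P)"
    using osc[OF z] by (intro bdd_belowI[of _ "f z - c"]) fastforce
  have "f y \<in> {a..a + c}" if y: "y \<in> space P" for y
  proof -
    have "a \<le> f y" unfolding a_def using bdd y by (rule cINF_lower)
    moreover have "f y - c \<le> a" unfolding a_def
      using osc[OF y] z by (intro cINF_greatest) (auto simp: algebra_simps)
    ultimately show ?thesis by simp
  qed
  then interpret I: interval_bounded_random_variable P f a "a + c"
    by unfold_locales (auto intro: f)
  have "(\<integral>\<^sup>+y. exp (l * (f y - integral\<^sup>L P f)) \<partial>P) \<le> exp (l\<^sup>2 * c\<^sup>2 / 8)"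
    using I.Hoeffdings_lemma_nn_integral[OF l] by simp
  then have "enn2real (\<integral>\<^sup>+y. exp (l * (f y - integral\<^sup>L P f)) \<partial>P) \<le> exp (l\<^sup>2 * c\<^sup>2 / 8)"
    using enn2real_leI by force
  then show ?thesis using f by (subst integral_eq_nn_integral) auto
qed

text \<open>
McDiarmid's argument. The expectation over the last point, \<open>g'\<close>, again has bounded differences and
the same mean; given the other points, \<open>g - g'\<close> has oscillation at most \<open>c\<close>, so that Hoeffding's
lemma contributes one factor per point.
\<close>

lemma mgf_bounded_differences:
  fixes g :: "(nat \<Rightarrow> 'a) \<Rightarrow> real"
  assumes P: "prob_space P" and l: "l > 0"
    and g: "g \<in> borel_measurable (sample_measure N P)"
    and bdd: "\<And>x. x \<in> space (sample_measure N P) \<Longrightarrow> \<bar>g x\<bar> \<le> B"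
    and dif: "\<And>x i y. x \<in> space (sample_measure N P) \<Longrightarrow> i < N \<Longrightarrow> y \<in> space P
      \<Longrightarrow> \<bar>g x - g (x(i := y))\<bar> \<le> c"
  shows "(\<integral>x. exp (l * (g x - integral\<^sup>L (sample_measure N P) g)) \<partial>sample_measure N P)
    \<le> exp (N * (l\<^sup>2 * c\<^sup>2 / 8))"
  using g bdd dif
proof (induction N arbitrary: g)
  case 0
  interpret S: prob_space "sample_measure 0 P" using P by (rule prob_space_sample_measure)
  obtain x where "x \<in> space (sample_measure 0 P)" using S.not_empty by blast
  then show ?case by (simp add: sample_measure_0_integral)
next
  case (Suc N)
  interpret P: prob_space P by fact
  interpret S: prob_space "sample_measure N P" using P by (rule prob_space_sample_measure)
  interpret PS: pair_sigma_finite P "sample_measure N P" ..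
  have prob_pair: "prob_space (P \<Otimes>\<^sub>M sample_measure N P)"
    by (intro prob_space_pair P S.prob_space_axioms)
  note [measurable] = Suc.prems(1)
  have gbd: "\<bar>g x\<bar> \<le> B" if "x \<in> space (sample_measure (Suc N) P)" for x
    using that by (rule Suc.prems(2))
  have gdif: "\<bar>g x - g (x(i := y))\<bar> \<le> c"
    if "x \<in> space (sample_measure (Suc N) P)" "i < Suc N" "y \<in> space P" for x i y
    using that by (rule Suc.prems(3))
  define g' where "g' x = (\<integral>y. g (x(N := y)) \<partial>P)" for x
  have gm [measurable]: "(\<lambda>(y, x). g (x(N := y))) \<in> borel_measurable (P \<Otimes>\<^sub>M sample_measure N P)"
    using measurable_compose[OF measurable_extend_sample Suc.prems(1)] by (simp add: case_prod_beta' fun_upd_def)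
  have glast: "(\<lambda>y. g (x(N := y))) \<in> borel_measurable P" if "x \<in> space (sample_measure N P)" for x
    using measurable_compose[OF measurable_extend_last[OF that] Suc.prems(1)] .
  have ilast: "integrable P (\<lambda>y. g (x(N := y)))" if "x \<in> space (sample_measure N P)" for x
    using that gbd extend_sample_in_space
    by (intro P.integrable_const_bound[of _ B] glast) fastforce+
  have bounded_int: "integrable M f" if "prob_space M" "f \<in> borel_measurable M" "\<And>x. x \<in> space M \<Longrightarrow> \<bar>f x\<bar> \<le> K"
    for M :: "'z measure" and f :: "'z \<Rightarrow> real" and K
    using that by (intro finite_measure.integrable_const_bound[of _ _ K] prob_space.finite_measure) auto
  have g'm [measurable]: "g' \<in> borel_measurable (sample_measure N P)"
    unfolding g'_def by (rule P.borel_measurable_lebesgue_integral) (use gm in \<open>measurable\<close>)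
  have g'b: "\<bar>g' x\<bar> \<le> B" if "x \<in> space (sample_measure N P)" for x
  proof -
    have "\<bar>g' x\<bar> \<le> (\<integral>y. \<bar>g (x(N := y))\<bar> \<partial>P)" unfolding g'_def by (rule integral_abs_bound)
    also have "\<dots> \<le> (\<integral>y. B \<partial>P)"
      using ilast[OF that] that gbd extend_sample_in_space by (intro integral_mono) fastforce+
    finally show ?thesis by (simp add: P.prob_space)
  qed
  have g'd: "\<bar>g' x - g' (x(i := y))\<bar> \<le> c"
    if x: "x \<in> space (sample_measure N P)" and i: "i < N" and y: "y \<in> space P" for x i y
  proof -
    note x' = update_sample_in_space[OF x y i]
    have "\<bar>g' x - g' (x(i := y))\<bar> = \<bar>\<integral>z. g (x(N := z)) - g ((x(i := y))(N := z)) \<partial>P\<bar>"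
      unfolding g'_def using ilast[OF x] ilast[OF x'] by simp
    also have "\<dots> \<le> (\<integral>z. \<bar>g (x(N := z)) - g ((x(i := y))(N := z))\<bar> \<partial>P)"
      by (rule integral_abs_bound)
    also have "\<dots> \<le> (\<integral>z. c \<partial>P)"
    proof (intro integral_mono)
      fix z assume z: "z \<in> space P"
      show "\<bar>g (x(N := z)) - g ((x(i := y))(N := z))\<bar> \<le> c"
      proof -
        have "(x(i := y))(N := z) = (x(N := z))(i := y)" using i by (auto simp: fun_upd_twist)
        moreover have "\<bar>g (x(N := z)) - g ((x(N := z))(i := y))\<bar> \<le> c"
          by (rule gdif[OF extend_sample_in_space[OF x z]]) (use i y in auto)
        ultimately show ?thesis by metis
      qed
    qed (use ilast[OF x] ilast[OF x'] in auto)
    finally show ?thesis by (simp add: P.prob_space)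
  qed
  have Eg: "integral\<^sup>L (sample_measure (Suc N) P) g = integral\<^sup>L (sample_measure N P) g'"
  proof -
    have "integrable (P \<Otimes>\<^sub>M sample_measure N P) (\<lambda>(y, x). g (x(N := y)))"
      using gbd extend_sample_in_space
      by (intro bounded_int[of _ _ B] prob_pair gm) (fastforce simp: space_pair_measure)
    from PS.integral_snd[OF this] show ?thesis
      by (subst integral_sample_Suc[OF P]) (auto simp: g'_def[abs_def])
  qed
  define m where "m = integral\<^sup>L (sample_measure N P) g'"
  have mb: "\<bar>m\<bar> \<le> B"
  proof -
    have "\<bar>m\<bar> \<le> (\<integral>x. \<bar>g' x\<bar> \<partial>sample_measure N P)" unfolding m_def by (rule integral_abs_bound)
    also have "\<dots> \<le> (\<integral>x. B \<partial>sample_measure N P)"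
      using g'b bounded_int[OF S.prob_space_axioms g'm g'b] by (intro integral_mono) auto
    finally show ?thesis by (simp add: S.prob_space)
  qed
  have int: "integrable (P \<Otimes>\<^sub>M sample_measure N P) (\<lambda>(y, x). exp (l * (g (x(N := y)) - m)))"
  proof (rule bounded_int[OF prob_pair, of _ "exp (l * (2 * B))"])
    fix z assume "z \<in> space (P \<Otimes>\<^sub>M sample_measure N P)"
    then have "\<bar>g ((snd z)(N := fst z))\<bar> \<le> B"
      by (intro gbd extend_sample_in_space) (auto simp: space_pair_measure)
    then show "\<bar>case z of (y, x) \<Rightarrow> exp (l * (g (x(N := y)) - m))\<bar> \<le> exp (l * (2 * B))"
      using mb l by (auto simp: case_prod_beta')
  qed measurable
  have "(\<integral>x. exp (l * (g x - integral\<^sup>L (sample_measure (Suc N) P) g)) \<partial>sample_measure (Suc N) P)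
    = (\<integral>(y, x). exp (l * (g (x(N := y)) - m)) \<partial>(P \<Otimes>\<^sub>M sample_measure N P))"
    by (subst integral_sample_Suc[OF P]) (auto simp: Eg m_def)
  also have "\<dots> = (\<integral>x. (\<integral>y. exp (l * (g (x(N := y)) - m)) \<partial>P) \<partial>sample_measure N P)"
    using PS.integral_snd[OF int] by simp
  also have "\<dots> \<le> (\<integral>x. exp (l\<^sup>2 * c\<^sup>2 / 8) * exp (l * (g' x - m)) \<partial>sample_measure N P)"
  proof (rule integral_mono)
    show "integrable (sample_measure N P) (\<lambda>x. \<integral>y. exp (l * (g (x(N := y)) - m)) \<partial>P)"
      using PS.integrable_snd[OF int] .
    show "integrable (sample_measure N P) (\<lambda>x. exp (l\<^sup>2 * c\<^sup>2 / 8) * exp (l * (g' x - m)))"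
    proof (intro integrable_mult_right bounded_int[OF S.prob_space_axioms, of _ "exp (l * (2 * B))"])
      fix x assume "x \<in> space (sample_measure N P)"
      then show "\<bar>exp (l * (g' x - m))\<bar> \<le> exp (l * (2 * B))"
        using mb l g'b[of x] by auto
    qed measurable
    fix x assume x: "x \<in> space (sample_measure N P)"
    have "(\<integral>y. exp (l * (g (x(N := y)) - m)) \<partial>P)
      = (\<integral>y. exp (l * (g (x(N := y)) - g' x)) * exp (l * (g' x - m)) \<partial>P)"
      by (simp add: exp_add[symmetric] algebra_simps)
    also have "\<dots> = (\<integral>y. exp (l * (g (x(N := y)) - g' x)) \<partial>P) * exp (l * (g' x - m))"
      by simp
    also have "\<dots> \<le> exp (l\<^sup>2 * c\<^sup>2 / 8) * exp (l * (g' x - m))"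
    proof (rule mult_right_mono)
      show "(\<integral>y. exp (l * (g (x(N := y)) - g' x)) \<partial>P) \<le> exp (l\<^sup>2 * c\<^sup>2 / 8)"
        unfolding g'_def
      proof (rule hoeffding_oscillation[OF P glast[OF x] l])
        fix y z assume "y \<in> space P" "z \<in> space P"
        then show "g (x(N := y)) \<le> g (x(N := z)) + c"
          using gdif[OF extend_sample_in_space[OF x \<open>y \<in> space P\<close>], of N z] by auto
      qed
    qed simp
    finally show "(\<integral>y. exp (l * (g (x(N := y)) - m)) \<partial>P) \<le> exp (l\<^sup>2 * c\<^sup>2 / 8) * exp (l * (g' x - m))" .
  qed
  also have "\<dots> = exp (l\<^sup>2 * c\<^sup>2 / 8) * (\<integral>x. exp (l * (g' x - m)) \<partial>sample_measure N P)" by simp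
  also have "\<dots> \<le> exp (l\<^sup>2 * c\<^sup>2 / 8) * exp (N * (l\<^sup>2 * c\<^sup>2 / 8))"
    unfolding m_def by (intro mult_left_mono Suc.IH g'b g'd) auto
  also have "\<dots> = exp (Suc N * (l\<^sup>2 * c\<^sup>2 / 8))"
    by (simp add: exp_add[symmetric] algebra_simps)
  finally show ?case .
qed

lemma bounded_differences_tail:
  fixes g :: "(nat \<Rightarrow> 'a) \<Rightarrow> real"
  assumes P: "prob_space P" and N: "1 \<le> N" and c: "c > 0" and d: "0 < \<delta>" "\<delta> < 1"
    and g: "g \<in> borel_measurable (sample_measure N P)"
    and bdd: "\<And>x. x \<in> space (sample_measure N P) \<Longrightarrow> \<bar>g x\<bar> \<le> B"
    and dif: "\<And>x i y. x \<in> space (sample_measure N P) \<Longrightarrow> i < N \<Longrightarrow> y \<in> space P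
      \<Longrightarrow> \<bar>g x - g (x(i := y))\<bar> \<le> c"
  shows "measure (sample_measure N P) {x \<in> space (sample_measure N P).
      integral\<^sup>L (sample_measure N P) g + c * sqrt (N * ln (1 / \<delta>) / 2) \<le> g x} \<le> \<delta>"
proof -
  let ?S = "sample_measure N P"
  interpret S: prob_space ?S using P by (rule prob_space_sample_measure)
  define m where "m = integral\<^sup>L ?S g"
  define q where "q = ln (1 / \<delta>)"
  have q: "q > 0" using d by (simp add: q_def)
  define t where "t = c * sqrt (N * q / 2)"
  have t: "t > 0" using c N q by (simp add: t_def)
  have t2: "t\<^sup>2 = c\<^sup>2 * (N * q / 2)" using N q by (simp add: t_def power_mult_distrib)
  \<comment> \<open>the minimizer of \<open>N * l\<^sup>2 * c\<^sup>2 / 8 - l * t\<close>, the exponent in Chernoff's bound\<close>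
  define l where "l = 4 * t / (N * c\<^sup>2)"
  have l: "l > 0" using t c N by (simp add: l_def)
  have lt: "l * t = 2 * q" and lc: "N * (l\<^sup>2 * c\<^sup>2 / 8) = q"
  proof -
    have "l * t = 4 * t\<^sup>2 / (N * c\<^sup>2)" by (simp add: l_def power2_eq_square)
    also have "\<dots> = 2 * q" using t2 N c by (simp add: field_simps)
    finally show "l * t = 2 * q" .
    have "N * (l\<^sup>2 * c\<^sup>2 / 8) = 2 * t\<^sup>2 / (N * c\<^sup>2)"
      using N c by (simp add: l_def power2_eq_square field_simps)
    also have "\<dots> = q" using t2 N c by (simp add: field_simps)
    finally show "N * (l\<^sup>2 * c\<^sup>2 / 8) = q" .
  qed
  have "\<bar>m\<bar> \<le> B"
  proof -
    have "\<bar>m\<bar> \<le> (\<integral>x. \<bar>g x\<bar> \<partial>?S)" unfolding m_def by (rule integral_abs_bound)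
    also have "\<dots> \<le> (\<integral>x. B \<partial>?S)"
      using bdd g by (intro integral_mono) (auto intro!: S.integrable_const_bound[of _ B])
    finally show ?thesis by (simp add: S.prob_space)
  qed
  then have "integrable ?S (\<lambda>x. exp (l * (g x - m)))"
    using bdd g l by (intro S.integrable_const_bound[of _ "exp (l * (2 * B))"]) (auto intro!: AE_I2 dest: bdd)
  then have "measure ?S {x \<in> space ?S. exp (2 * q) \<le> exp (l * (g x - m))}
    \<le> (\<integral>x. exp (l * (g x - m)) \<partial>?S) / exp (2 * q)"
    by (intro integral_Markov_inequality_measure[of _ _ "{}"]) auto
  also have "\<dots> \<le> exp q / exp (2 * q)"
    using mgf_bounded_differences[OF P l g bdd dif] lc by (intro divide_right_mono) (auto simp: m_def)
  also have "\<dots> = \<delta>"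
    using d by (simp add: exp_diff[symmetric] q_def ln_div)
  also have "{x \<in> space ?S. exp (2 * q) \<le> exp (l * (g x - m))} = {x \<in> space ?S. m + t \<le> g x}"
  proof -
    have "exp (2 * q) \<le> exp (l * (g x - m)) \<longleftrightarrow> m + t \<le> g x" for x
    proof -
      have "exp (2 * q) \<le> exp (l * (g x - m)) \<longleftrightarrow> l * t \<le> l * (g x - m)" by (simp add: lt)
      also have "\<dots> \<longleftrightarrow> t \<le> g x - m" using l by simp
      finally show ?thesis by auto
    qed
    then show ?thesis by simp
  qed
  finally show ?thesis by (simp add: m_def t_def q_def)
qed

lemma variance_le_second_moment_about:
  fixes h :: "'a \<Rightarrow> real"
  assumes P: "prob_space P" and h: "integrable P h" and h2: "integrable P (\<lambda>y. (h y)\<^sup>2)"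
    and b: "integrable P (\<lambda>y. (b y)\<^sup>2)" and le: "\<And>y. y \<in> space P \<Longrightarrow> \<bar>h y - k\<bar> \<le> b y"
  shows "(\<integral>y. (h y)\<^sup>2 \<partial>P) \<le> (integral\<^sup>L P h)\<^sup>2 + (\<integral>y. (b y)\<^sup>2 \<partial>P)"
proof -
  interpret P: prob_space P by fact
  have "(\<integral>y. (h y - k)\<^sup>2 \<partial>P) = (\<integral>y. (h y)\<^sup>2 - 2 * k * h y + k\<^sup>2 \<partial>P)"
    by (simp add: power2_diff algebra_simps)
  also have "\<dots> = (\<integral>y. (h y)\<^sup>2 \<partial>P) - 2 * k * integral\<^sup>L P h + k\<^sup>2"
    using h h2 by (simp add: P.prob_space)
  finally have eq: "(\<integral>y. (h y - k)\<^sup>2 \<partial>P) = (\<integral>y. (h y)\<^sup>2 \<partial>P) - 2 * k * integral\<^sup>L P h + k\<^sup>2" .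
  have "integrable P (\<lambda>y. (h y)\<^sup>2 - 2 * k * h y + k\<^sup>2)" using h h2 by simp
  then have "integrable P (\<lambda>y. (h y - k)\<^sup>2)" by (simp add: power2_diff algebra_simps)
  then have "(\<integral>y. (h y - k)\<^sup>2 \<partial>P) \<le> (\<integral>y. (b y)\<^sup>2 \<partial>P)"
    using b le by (intro integral_mono) (auto intro!: abs_le_square_iff[THEN iffD1] order_trans[OF _ abs_ge_self])
  moreover have "0 \<le> (integral\<^sup>L P h - k)\<^sup>2" by simp
  ultimately show ?thesis using eq by (simp add: power2_diff algebra_simps)
qed

text \<open>
The hypothesis bounds \<open>g\<close> by a sum over the sample points because that form survives averaging over
one point and lets the average exist for every choice of the other points.
\<close>

lemma square_integrable_sum_bound:
  fixes g :: "(nat \<Rightarrow> 'a) \<Rightarrow> real"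
  assumes P: "prob_space P" and b: "integrable P b" "integrable P (\<lambda>y. (b y)\<^sup>2)"
    and g: "g \<in> borel_measurable (sample_measure N P)"
    and gb: "\<And>x. x \<in> space (sample_measure N P) \<Longrightarrow> \<bar>g x\<bar> \<le> C + (\<Sum>i<N. b (x i))"
  shows "integrable (sample_measure N P) g" "integrable (sample_measure N P) (\<lambda>x. (g x)\<^sup>2)"
proof -
  let ?S = "sample_measure N P"
  interpret S: prob_space ?S using P by (rule prob_space_sample_measure)
  have "integrable ?S (\<lambda>x. \<Sum>i<N. b (x i))"
    by (intro Bochner_Integration.integrable_sum integrable_sample_component P b) auto
  then have "integrable ?S (\<lambda>x. C + (\<Sum>i<N. b (x i)))" by simp
  then show "integrable ?S g"
    by (rule Bochner_Integration.integrable_bound) (use g gb in \<open>force intro!: AE_I2\<close>)+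
  have "integrable ?S (\<lambda>x. \<Sum>i<N. (b (x i))\<^sup>2)"
    by (intro Bochner_Integration.integrable_sum
        integrable_sample_component[where f="\<lambda>y. (b y)\<^sup>2"] P b) auto
  then have i2: "integrable ?S (\<lambda>x. 2 * C\<^sup>2 + 2 * (N * (\<Sum>i<N. (b (x i))\<^sup>2)))" by simp
  have "(g x)\<^sup>2 \<le> 2 * C\<^sup>2 + 2 * (N * (\<Sum>i<N. (b (x i))\<^sup>2))" if "x \<in> space ?S" for x
  proof -
    have "(g x)\<^sup>2 \<le> (C + (\<Sum>i<N. b (x i)))\<^sup>2"
      using gb[OF that] by (intro abs_le_square_iff[THEN iffD1]) auto
    also have "\<dots> \<le> 2 * C\<^sup>2 + 2 * (\<Sum>i<N. b (x i))\<^sup>2"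
      using sum_squares_bound[of C "\<Sum>i<N. b (x i)"] by (simp add: power2_sum)
    also have "(\<Sum>i<N. b (x i))\<^sup>2 \<le> N * (\<Sum>i<N. (b (x i))\<^sup>2)"
      using sum_squared_le_sum_of_squares[of "\<lambda>i. b (x i)" "{..<N}"] by (simp add: mult.commute)
    finally show ?thesis by simp
  qed
  then show "integrable ?S (\<lambda>x. (g x)\<^sup>2)"
    by (intro Bochner_Integration.integrable_bound[OF i2]) (use g in \<open>force intro!: AE_I2\<close>)+
qed

text \<open>
The Efron--Stein inequality with a fixed point \<open>z0\<close> in place of an independent copy. Resetting one
point to \<open>z0\<close> changes \<open>g\<close> by at most \<open>b\<close> of that point, so each point adds at
most the second moment of \<open>b\<close> to the variance. In contrast to bounded differences, \<open>b\<close> may be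
unbounded, which is what heavy tails require.
\<close>

lemma variance_bounded_differences:
  fixes g :: "(nat \<Rightarrow> 'a) \<Rightarrow> real"
  assumes P: "prob_space P" and z0: "z0 \<in> space P"
    and b: "integrable P b" "integrable P (\<lambda>y. (b y)\<^sup>2)"
    and g: "g \<in> borel_measurable (sample_measure N P)"
    and gb: "\<And>x. x \<in> space (sample_measure N P) \<Longrightarrow> \<bar>g x\<bar> \<le> C + (\<Sum>i<N. b (x i))"
    and dif: "\<And>x i. x \<in> space (sample_measure N P) \<Longrightarrow> i < N \<Longrightarrow> \<bar>g x - g (x(i := z0))\<bar> \<le> b (x i)"
  shows "(\<integral>x. (g x)\<^sup>2 \<partial>sample_measure N P)
    \<le> (integral\<^sup>L (sample_measure N P) g)\<^sup>2 + N * (\<integral>y. (b y)\<^sup>2 \<partial>P)"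
  using g gb dif
proof (induction N arbitrary: g C)
  case 0
  interpret S: prob_space "sample_measure 0 P" using P by (rule prob_space_sample_measure)
  obtain x where "x \<in> space (sample_measure 0 P)" using S.not_empty by blast
  then show ?case by (simp add: sample_measure_0_integral)
next
  case (Suc N)
  interpret P: prob_space P by fact
  interpret S: prob_space "sample_measure N P" using P by (rule prob_space_sample_measure)
  interpret PS: pair_sigma_finite P "sample_measure N P" ..
  have gbd: "\<bar>g x\<bar> \<le> C + (\<Sum>i<Suc N. b (x i))" if "x \<in> space (sample_measure (Suc N) P)" for x
    using that by (rule Suc.prems(2))
  have gdif: "\<bar>g x - g (x(i := z0))\<bar> \<le> b (x i)"
    if "x \<in> space (sample_measure (Suc N) P)" "i < Suc N" for x i
    using that by (rule Suc.prems(3))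
  note gint = square_integrable_sum_bound[OF P b Suc.prems(1) gbd]
  have [measurable]: "b \<in> borel_measurable P" using b by auto
  define v where "v = (\<integral>y. (b y)\<^sup>2 \<partial>P)"
  define g' where "g' x = (\<integral>y. g (x(N := y)) \<partial>P)" for x
  have gm [measurable]: "(\<lambda>(y, x). g (x(N := y))) \<in> borel_measurable (P \<Otimes>\<^sub>M sample_measure N P)"
    using measurable_compose[OF measurable_extend_sample Suc.prems(1)] by (simp add: case_prod_beta' fun_upd_def)
  have glast: "(\<lambda>y. g (x(N := y))) \<in> borel_measurable P" if "x \<in> space (sample_measure N P)" for x
    using measurable_compose[OF measurable_extend_last[OF that] Suc.prems(1)] .
  have near: "\<bar>g (x(N := y)) - g (x(N := z0))\<bar> \<le> b y"
    if x: "x \<in> space (sample_measure N P)" and y: "y \<in> space P" for x y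
  proof -
    have "\<bar>g (x(N := y)) - g ((x(N := y))(N := z0))\<bar> \<le> b ((x(N := y)) N)"
      by (rule gdif[OF extend_sample_in_space[OF x y]]) simp
    then show ?thesis by simp
  qed
  have ilast: "integrable P (\<lambda>y. g (x(N := y)))" and ilast2: "integrable P (\<lambda>y. (g (x(N := y)))\<^sup>2)"
    if x: "x \<in> space (sample_measure N P)" for x
  proof -
    let ?k = "g (x(N := z0))"
    have n: "\<bar>g (x(N := y))\<bar> \<le> \<bar>?k\<bar> + b y" if "y \<in> space P" for y using near[OF x that] by linarith
    have "integrable P (\<lambda>y. \<bar>?k\<bar> + b y)" using b by simp
    then show "integrable P (\<lambda>y. g (x(N := y)))"
      by (rule Bochner_Integration.integrable_bound) (use glast[OF x] n in \<open>force intro!: AE_I2\<close>)+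
    have i: "integrable P (\<lambda>y. (\<bar>?k\<bar> + b y)\<^sup>2)" using b by (simp add: power2_sum)
    have "(g (x(N := y)))\<^sup>2 \<le> (\<bar>?k\<bar> + b y)\<^sup>2" if "y \<in> space P" for y
      using n[OF that] by (intro abs_le_square_iff[THEN iffD1]) auto
    then show "integrable P (\<lambda>y. (g (x(N := y)))\<^sup>2)"
      by (intro Bochner_Integration.integrable_bound[OF i]) (use glast[OF x] in \<open>force intro!: AE_I2\<close>)+
  qed
  have g'm: "g' \<in> borel_measurable (sample_measure N P)"
    unfolding g'_def by (rule P.borel_measurable_lebesgue_integral) (use gm in \<open>measurable\<close>)
  have g'b: "\<bar>g' x\<bar> \<le> (C + integral\<^sup>L P b) + (\<Sum>i<N. b (x i))" if x: "x \<in> space (sample_measure N P)" for x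
  proof -
    have "\<bar>g' x\<bar> \<le> (\<integral>y. \<bar>g (x(N := y))\<bar> \<partial>P)" unfolding g'_def by (rule integral_abs_bound)
    also have "\<dots> \<le> (\<integral>y. (C + (\<Sum>i<N. b (x i))) + b y \<partial>P)"
    proof (rule integral_mono)
      fix y assume y: "y \<in> space P"
      have "\<bar>g (x(N := y))\<bar> \<le> C + (\<Sum>i<Suc N. b ((x(N := y)) i))"
        by (rule gbd[OF extend_sample_in_space[OF x y]])
      also have "(\<Sum>i<Suc N. b ((x(N := y)) i)) = (\<Sum>i<N. b (x i)) + b y"
      proof -
        have "(\<Sum>i<N. b ((x(N := y)) i)) = (\<Sum>i<N. b (x i))" by (rule sum.cong) auto
        then show ?thesis by simp
      qed
      finally show "\<bar>g (x(N := y))\<bar> \<le> (C + (\<Sum>i<N. b (x i))) + b y"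
        by (simp add: fun_upd_def)
    qed (use ilast[OF x] b in auto)
    finally show ?thesis using b by (simp add: P.prob_space)
  qed
  have g'd: "\<bar>g' x - g' (x(i := z0))\<bar> \<le> b (x i)"
    if x: "x \<in> space (sample_measure N P)" and i: "i < N" for x i
  proof -
    note x' = update_sample_in_space[OF x z0 i]
    have "\<bar>g' x - g' (x(i := z0))\<bar> = \<bar>\<integral>z. g (x(N := z)) - g ((x(i := z0))(N := z)) \<partial>P\<bar>"
      unfolding g'_def using ilast[OF x] ilast[OF x'] by simp
    also have "\<dots> \<le> (\<integral>z. \<bar>g (x(N := z)) - g ((x(i := z0))(N := z))\<bar> \<partial>P)"
      by (rule integral_abs_bound)
    also have "\<dots> \<le> (\<integral>z. b (x i) \<partial>P)"
    proof (intro integral_mono)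
      fix z assume z: "z \<in> space P"
      have "(x(i := z0))(N := z) = (x(N := z))(i := z0)" using i by (auto simp: fun_upd_twist)
      moreover have "\<bar>g (x(N := z)) - g ((x(N := z))(i := z0))\<bar> \<le> b ((x(N := z)) i)"
        by (rule gdif[OF extend_sample_in_space[OF x z]]) (use i in auto)
      moreover have "(x(N := z)) i = x i" using i by simp
      ultimately show "\<bar>g (x(N := z)) - g ((x(i := z0))(N := z))\<bar> \<le> b (x i)" by metis
    qed (use ilast[OF x] ilast[OF x'] in auto)
    finally show ?thesis by (simp add: P.prob_space)
  qed
  note g'int = square_integrable_sum_bound[OF P b g'm g'b]
  have pint: "integrable (P \<Otimes>\<^sub>M sample_measure N P) (\<lambda>(y, x). g (x(N := y)))"
    using gint(1) integrable_sample_Suc_iff[OF P Suc.prems(1)] by (simp add: fun_upd_def)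
  have pint2: "integrable (P \<Otimes>\<^sub>M sample_measure N P) (\<lambda>(y, x). (g (x(N := y)))\<^sup>2)"
    using gint(2) integrable_sample_Suc_iff[OF P borel_measurable_integrable[OF gint(2)]] by (simp add: fun_upd_def)
  have Eg: "integral\<^sup>L (sample_measure (Suc N) P) g = integral\<^sup>L (sample_measure N P) g'"
    using PS.integral_snd[OF pint] integral_sample_Suc[OF P Suc.prems(1)] by (simp add: g'_def[abs_def] fun_upd_def)
  have "(\<integral>x. (g x)\<^sup>2 \<partial>sample_measure (Suc N) P)
    = (\<integral>x. (\<integral>y. (g (x(N := y)))\<^sup>2 \<partial>P) \<partial>sample_measure N P)"
    using PS.integral_snd[OF pint2] integral_sample_Suc[OF P borel_measurable_integrable[OF gint(2)]] by (simp add: fun_upd_def)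
  also have "\<dots> \<le> (\<integral>x. (g' x)\<^sup>2 + v \<partial>sample_measure N P)"
  proof (rule integral_mono)
    show "integrable (sample_measure N P) (\<lambda>x. \<integral>y. (g (x(N := y)))\<^sup>2 \<partial>P)"
      using PS.integrable_snd[OF pint2] .
    show "integrable (sample_measure N P) (\<lambda>x. (g' x)\<^sup>2 + v)" using g'int by simp
    fix x assume x: "x \<in> space (sample_measure N P)"
    show "(\<integral>y. (g (x(N := y)))\<^sup>2 \<partial>P) \<le> (g' x)\<^sup>2 + v"
      unfolding g'_def v_def
      by (rule variance_le_second_moment_about[OF P ilast[OF x] ilast2[OF x] b(2) near[OF x]])
  qed
  also have "\<dots> = (\<integral>x. (g' x)\<^sup>2 \<partial>sample_measure N P) + v"
    using g'int by (simp add: S.prob_space)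
  also have "\<dots> \<le> (integral\<^sup>L (sample_measure N P) g')\<^sup>2 + N * v + v"
    unfolding v_def using Suc.IH[OF g'm g'b g'd] by simp
  finally show ?case by (simp add: Eg v_def algebra_simps)
qed

text \<open>
Chebyshev's inequality with a strict event, so that it remains true when \<open>v = 0\<close> and \<open>g\<close> is almost
surely constant.
\<close>

lemma variance_tail:
  fixes g :: "(nat \<Rightarrow> 'a) \<Rightarrow> real"
  assumes P: "prob_space P" and z0: "z0 \<in> space P" and d: "0 < \<delta>"
    and b: "integrable P b" "integrable P (\<lambda>y. (b y)\<^sup>2)" and v: "(\<integral>y. (b y)\<^sup>2 \<partial>P) \<le> v"
    and g: "g \<in> borel_measurable (sample_measure N P)"
    and gb: "\<And>x. x \<in> space (sample_measure N P) \<Longrightarrow> \<bar>g x\<bar> \<le> C + (\<Sum>i<N. b (x i))"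
    and dif: "\<And>x i. x \<in> space (sample_measure N P) \<Longrightarrow> i < N \<Longrightarrow> \<bar>g x - g (x(i := z0))\<bar> \<le> b (x i)"
  shows "measure (sample_measure N P) {x \<in> space (sample_measure N P).
      integral\<^sup>L (sample_measure N P) g + sqrt (N * v / \<delta>) < g x} \<le> \<delta>"
proof -
  let ?S = "sample_measure N P"
  interpret S: prob_space ?S using P by (rule prob_space_sample_measure)
  define m where "m = integral\<^sup>L ?S g"
  note gint = square_integrable_sum_bound[OF P b g gb]
  have iv: "integrable ?S (\<lambda>x. (g x - m)\<^sup>2)"
  proof -
    have "integrable ?S (\<lambda>x. (g x)\<^sup>2 - 2 * m * g x + m\<^sup>2)" using gint by simp
    then show ?thesis by (simp add: power2_diff algebra_simps)
  qed
  have "(\<integral>x. (g x - m)\<^sup>2 \<partial>?S) = (\<integral>x. (g x)\<^sup>2 \<partial>?S) - m\<^sup>2"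
    unfolding m_def using gint by (rule S.variance_eq)
  also have "\<dots> \<le> N * (\<integral>y. (b y)\<^sup>2 \<partial>P)"
    using variance_bounded_differences[OF P z0 b g gb dif] by (simp add: m_def)
  also have "\<dots> \<le> N * v" using v by (intro mult_left_mono) auto
  finally have var: "(\<integral>x. (g x - m)\<^sup>2 \<partial>?S) \<le> N * v" .
  have var0: "0 \<le> (\<integral>x. (g x - m)\<^sup>2 \<partial>?S)" by simp
  show ?thesis
  proof (cases "N * v > 0")
    case True
    define t where "t = sqrt (N * v / \<delta>)"
    have t: "t > 0" using True d by (simp add: t_def)
    have t2: "t\<^sup>2 = N * v / \<delta>" using True d by (simp add: t_def)
    have "measure ?S {x \<in> space ?S. m + t < g x} \<le> measure ?S {x \<in> space ?S. t\<^sup>2 \<le> (g x - m)\<^sup>2}"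
      using g t by (intro S.finite_measure_mono) (auto intro!: power_mono)
    also have "\<dots> \<le> (\<integral>x. (g x - m)\<^sup>2 \<partial>?S) / t\<^sup>2"
      using t iv by (intro integral_Markov_inequality_measure[of _ _ "{}"]) auto
    also have "\<dots> \<le> N * v / t\<^sup>2" using var by (intro divide_right_mono) auto
    also have "\<dots> = \<delta>" using True d by (simp add: t2 zero_less_mult_iff)
    finally show ?thesis by (simp add: m_def t_def)
  next
    case False
    then have "(\<integral>x. (g x - m)\<^sup>2 \<partial>?S) = 0" and Nv: "N * v = 0" using var var0 by linarith+
    then have "AE x in ?S. (g x - m)\<^sup>2 = 0"
      using integral_nonneg_eq_0_iff_AE[OF iv] by simp
    then have "measure ?S {x \<in> space ?S. m < g x} = 0"
      using g by (subst S.prob_eq_0) (auto elim!: eventually_mono)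
    then show ?thesis using d Nv by (auto simp: m_def)
  qed
qed

section \<open>Rademacher averages\<close>

text \<open>
This is the inequality behind Hoeffding's lemma for a fair sign on \<open>{- x, x}\<close>.
\<close>

lemma cosh_le_exp_half_square: "(exp x + exp (- x)) / 2 \<le> exp (x\<^sup>2 / 2)" for x :: real
proof -
  have *: "(exp x + exp (- x)) / 2 \<le> exp (x\<^sup>2 / 2)" if x: "x \<ge> 0" for x :: real
  proof -
    have "-(2 * x) * (1/2) + ln (1 + (1/2) * (exp (2 * x) - 1)) \<le> (2 * x)\<^sup>2 / 8"
      using x by (intro Hoeffdings_lemma_aux) auto
    then have "exp (-x + ln ((1 + exp (2 * x)) / 2)) \<le> exp (x\<^sup>2 / 2)"
      by (simp add: field_simps power2_eq_square)
    also have "exp (-x + ln ((1 + exp (2 * x)) / 2)) = exp (-x) * ((1 + exp (2 * x)) / 2)"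
      using add_pos_pos[OF zero_less_one exp_gt_zero[of "2 * x"]] by (subst exp_add, subst exp_ln) auto
    also have "\<dots> = (exp x + exp (- x)) / 2"
      by (simp add: field_simps mult_exp_exp)
    finally show ?thesis .
  qed
  show ?thesis using *[of x] *[of "-x"] by (cases "x \<ge> 0") (auto simp: add.commute)
qed

text \<open>
The minimum over \<open>l\<close> is attained at \<open>sqrt A / sqrt B\<close>; if just one of \<open>A\<close> and \<open>B\<close> vanishes, the infimum is approached but not
attained.
\<close>

lemma le_two_sqrt_of_le_all:
  fixes y A B :: real
  assumes A: "A \<ge> 0" and B: "B \<ge> 0" and le: "\<And>l. l > 0 \<Longrightarrow> y \<le> A / l + l * B"
  shows "y \<le> 2 * sqrt (A * B)"
proof (cases "A = 0 \<or> B = 0")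
  case False
  define a b where "a = sqrt A" and "b = sqrt B"
  have ab: "a > 0" "b > 0" "A = a * a" "B = b * b" using False A B by (auto simp: a_def b_def)
  have "y \<le> a * a / (a / b) + a / b * (b * b)" using le[of "a / b"] ab by simp
  also have "\<dots> = 2 * (a * b)" using ab by (simp add: field_simps)
  finally show ?thesis by (simp add: a_def b_def real_sqrt_mult)
next
  case True
  have "y \<le> e" if e: "e > 0" for e
  proof (cases "B = 0")
    case True
    have "y \<le> A / ((A + 1) / e)" using le[of "(A + 1) / e"] e A True by simp
    also have "\<dots> = A / (A + 1) * e" by simp
    also have "\<dots> \<le> 1 * e" using e A by (intro mult_right_mono) auto
    finally show ?thesis by simp
  next
    case False
    then have "A = 0" using True by simp
    then show ?thesis using le[of "e / B"] e False B by simp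
  qed
  then have "y \<le> 0" by (rule field_le_epsilon[of y 0, simplified])
  then show ?thesis using A B True by auto
qed

lemma integral_sample_prod_le_1:
  fixes Y :: "'a \<Rightarrow> real"
  assumes Q: "prob_space Q" and Y: "integrable Q Y" "\<And>q. q \<in> space Q \<Longrightarrow> 0 \<le> Y q" and le: "integral\<^sup>L Q Y \<le> 1"
  shows "integrable (sample_measure N Q) (\<lambda>x. \<Prod>i<N. Y (x i))"
    and "(\<integral>x. (\<Prod>i<N. Y (x i)) \<partial>sample_measure N Q) \<le> 1"
proof -
  interpret Q: prob_space Q by fact
  interpret product_sigma_finite "\<lambda>_ :: nat. Q" ..
  show "integrable (sample_measure N Q) (\<lambda>x. \<Prod>i<N. Y (x i))"
    unfolding sample_measure_def using Y by (intro product_integrable_prod) auto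
  have "(\<integral>x. (\<Prod>i<N. Y (x i)) \<partial>sample_measure N Q) = (\<Prod>i<N. integral\<^sup>L Q Y)"
    unfolding sample_measure_def using Y by (intro product_integral_prod) auto
  also have "\<dots> \<le> 1"
    using le Y by (intro prod_le_1) (auto intro!: integral_nonneg_AE)
  finally show "(\<integral>x. (\<Prod>i<N. Y (x i)) \<partial>sample_measure N Q) \<le> 1" .
qed

text \<open>
Massart's finite class lemma without a bound on the data. Subtracting \<open>l\<^sup>2 / 2 * b\<close> in the exponent,
where \<open>b\<close> dominates the squares, makes the average of the exponential over the sign at most one,
since \<open>cosh x \<le> exp (x\<^sup>2 / 2)\<close>; the subtracted term comes back only in expectation. Hence
second moments of the data suffice.
\<close>

lemma rademacher_max_le:
  fixes u :: "'s \<Rightarrow> 'a \<Rightarrow> real"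
  assumes P: "prob_space P" and S: "finite S" "S \<noteq> {}"
    and u: "\<And>s. s \<in> S \<Longrightarrow> u s \<in> borel_measurable P"
    and ub: "\<And>s z. s \<in> S \<Longrightarrow> z \<in> space P \<Longrightarrow> (u s z)\<^sup>2 \<le> b z"
    and b: "integrable P b" and m: "integral\<^sup>L P b \<le> m"
  shows "(\<integral>x. (MAX s\<in>S. \<Sum>i<N. sgn_of (snd (x i)) * u s (fst (x i))) \<partial>sample_measure N (signed P))
    \<le> sqrt (2 * ln (card S) * N * m)"
proof -
  let ?Q = "signed P" let ?S = "sample_measure N (signed P)"
  interpret P: prob_space P by fact
  have Q: "prob_space ?Q" using P by (rule prob_space_signed)
  interpret S: prob_space ?S using Q by (rule prob_space_sample_measure)
  note [measurable] = u borel_measurable_integrable[OF b]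
  have cS: "real (card S) \<ge> 1" using S by (metis One_nat_def Suc_leI card_gt_0_iff of_nat_1 of_nat_mono)
  have iu: "integrable P (u s)" if s: "s \<in> S" for s
  proof (rule Bochner_Integration.integrable_bound)
    show "integrable P (\<lambda>z. 1 + b z)" using b by simp
    show "AE z in P. norm (u s z) \<le> norm (1 + b z)"
    proof (rule AE_I2)
      fix z assume "z \<in> space P"
      from ub[OF s this] have "(u s z)\<^sup>2 \<le> b z" .
      moreover have "0 \<le> (\<bar>u s z\<bar> - 1)\<^sup>2" by simp
      then have "\<bar>u s z\<bar> \<le> 1 + (u s z)\<^sup>2" by (simp add: power2_diff)
      ultimately show "norm (u s z) \<le> norm (1 + b z)" by simp
    qed
  qed (use u[OF s] in auto)
  define X where "X s x = (\<Sum>i<N. sgn_of (snd (x i)) * u s (fst (x i)))" for s and x :: "nat \<Rightarrow> 'a \<times> bool"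
  have iX: "integrable ?S (X s)" if s: "s \<in> S" for s
  proof -
    have "integrable ?Q (\<lambda>q. sgn_of (snd q) * u s (fst q))"
      using iu[OF s] by (intro integral_signed(1)[OF P, of "\<lambda>z b. sgn_of b * u s z"]) auto
    then show ?thesis unfolding X_def
      by (intro Bochner_Integration.integrable_sum
          integrable_sample_component[OF Q, where f="\<lambda>q. sgn_of (snd q) * u s (fst q)"]) auto
  qed
  have ib: "integrable ?Q (\<lambda>q. b (fst q))" and Eb: "(\<integral>q. b (fst q) \<partial>?Q) = integral\<^sup>L P b"
    using integral_signed[OF P, of "\<lambda>z _. b z"] b by auto
  define Bs where "Bs x = (\<Sum>i<N. b (fst (x i)))" for x :: "nat \<Rightarrow> 'a \<times> bool"
  have iB: "integrable ?S Bs"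
    unfolding Bs_def using ib by (intro Bochner_Integration.integrable_sum
        integrable_sample_component[OF Q, where f="\<lambda>q. b (fst q)"]) auto
  have EB: "integral\<^sup>L ?S Bs = N * integral\<^sup>L P b"
  proof -
    have "integral\<^sup>L ?S Bs = (\<Sum>i<N. \<integral>x. b (fst (x i)) \<partial>?S)"
      unfolding Bs_def using ib by (intro Bochner_Integration.integral_sum
        integrable_sample_component[OF Q, where f="\<lambda>q. b (fst q)"]) auto
    also have "\<dots> = (\<Sum>i<N. integral\<^sup>L P b)"
      using integral_sample_component[OF Q, where f="\<lambda>q. b (fst q)"] ib Eb by (intro sum.cong) auto
    finally show ?thesis by simp
  qed
  have main: "(\<integral>x. (MAX s\<in>S. X s x) \<partial>?S) \<le> ln (card S) / l + l * (N * m / 2)" if l: "l > 0" for l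
  proof -
    define Y where "Y s q = exp (l * (sgn_of (snd q) * u s (fst q)) - l\<^sup>2 / 2 * b (fst q))" for s and q :: "'a \<times> bool"
    have Y: "integrable ?Q (Y s)" "integral\<^sup>L ?Q (Y s) \<le> 1" if s: "s \<in> S" for s
    proof -
      have i: "integrable P (\<lambda>z. exp (l * (c * u s z) - l\<^sup>2 / 2 * b z))" if c: "c = 1 \<or> c = -1" for c
      proof (rule P.integrable_const_bound[of _ "exp (1/2)"])
        have "l * (c * t) - l\<^sup>2 / 2 * w \<le> 1 / 2" if "t\<^sup>2 \<le> w" for t w
        proof -
          have "l * (c * t) - l\<^sup>2 / 2 * w \<le> l * (c * t) - l\<^sup>2 / 2 * t\<^sup>2" using that by (simp add: mult_left_mono)
          also have "\<dots> \<le> 1/2"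
            using c sum_squares_ge_zero[of "l * (c * t) - 1" 0] by (auto simp: power2_eq_square algebra_simps)
          finally show ?thesis .
        qed
        then show "AE z in P. norm (exp (l * (c * u s z) - l\<^sup>2 / 2 * b z)) \<le> exp (1/2)"
          using ub[OF s] by (auto intro!: AE_I2)
      qed (use s in measurable)
      note I = integral_signed[OF P, of "\<lambda>z b'. exp (l * (sgn_of b' * u s z) - l\<^sup>2 / 2 * b z)"]
      have i': "integrable P (\<lambda>z. exp (l * (sgn_of b' * u s z) - l\<^sup>2 / 2 * b z))" for b'
        by (intro i) (auto simp: sgn_of_def)
      show "integrable ?Q (Y s)" unfolding Y_def using I(1)[OF i'] .
      have "integral\<^sup>L ?Q (Y s) = ((\<integral>z. exp (l * (1 * u s z) - l\<^sup>2 / 2 * b z) \<partial>P)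
          + (\<integral>z. exp (l * (-1 * u s z) - l\<^sup>2 / 2 * b z) \<partial>P)) / 2"
        unfolding Y_def using I(2)[OF i'] by (simp add: sgn_of_def)
      also have "\<dots> = (\<integral>z. (exp (l * (1 * u s z) - l\<^sup>2 / 2 * b z) + exp (l * (-1 * u s z) - l\<^sup>2 / 2 * b z)) / 2 \<partial>P)"
        using i[of 1] i[of "-1"] by simp
      also have "\<dots> \<le> (\<integral>z. 1 \<partial>P)"
      proof (rule integral_mono)
        show "integrable P (\<lambda>z. (exp (l * (1 * u s z) - l\<^sup>2 / 2 * b z) + exp (l * (-1 * u s z) - l\<^sup>2 / 2 * b z)) / 2)"
          using i[of 1] i[of "-1"] by simp
        fix z assume "z \<in> space P"
        then have "exp ((l * u s z)\<^sup>2 / 2) \<le> exp (l\<^sup>2 / 2 * b z)"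
          using ub[OF s, of z] by (simp add: power_mult_distrib mult_left_mono)
        then have "(exp (l * u s z) + exp (- (l * u s z))) / 2 \<le> exp (l\<^sup>2 / 2 * b z)"
          using cosh_le_exp_half_square[of "l * u s z"] by linarith
        then have "(exp (l * u s z) + exp (- (l * u s z))) / 2 / exp (l\<^sup>2 / 2 * b z) \<le> 1"
          by (simp add: divide_le_eq)
        moreover have "(exp (w - c) + exp (- w - c)) / 2 = (exp w + exp (- w)) / 2 / exp c" for w c :: real
          by (simp add: exp_diff add_divide_distrib)
        ultimately show "(exp (l * (1 * u s z) - l\<^sup>2 / 2 * b z) + exp (l * (-1 * u s z) - l\<^sup>2 / 2 * b z)) / 2 \<le> 1"
          by simp
      qed simp
      finally show "integral\<^sup>L ?Q (Y s) \<le> 1" by (simp add: P.prob_space)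
    qed
    have prodY: "(\<Prod>i<N. Y s (x i)) = exp (l * X s x - l\<^sup>2 / 2 * Bs x)" for s x
      by (simp add: Y_def X_def Bs_def exp_sum[symmetric] sum_subtractf sum_distrib_left)
    note EY = integral_sample_prod_le_1[OF Q Y(1) _ Y(2), of _ N, unfolded prodY]
    define E where "E s x = exp (l * X s x - l\<^sup>2 / 2 * Bs x)" for s x
    have iE: "integrable ?S (E s)" and EE: "integral\<^sup>L ?S (E s) \<le> 1" if "s \<in> S" for s
      using EY[OF that _ that] by (auto simp: E_def[abs_def] Y_def)
    \<comment> \<open>the logarithm of the sum of exponentials lies below its tangent at \<open>card S\<close>\<close>
    have pt: "l * (MAX s\<in>S. X s x) \<le> l\<^sup>2 / 2 * Bs x + ((\<Sum>s\<in>S. E s x) / card S - 1 + ln (card S))" for x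
    proof -
      obtain s where s: "s \<in> S" "(MAX s\<in>S. X s x) = X s x" using Max_attained[OF S] .
      let ?k = "real (card S)"
      have "l * X s x - l\<^sup>2 / 2 * Bs x - ln ?k + 1 \<le> exp (l * X s x - l\<^sup>2 / 2 * Bs x - ln ?k)"
        using exp_ge_add_one_self[of "l * X s x - l\<^sup>2 / 2 * Bs x - ln ?k"] by linarith
      also have "\<dots> = E s x / ?k" using cS by (simp add: E_def exp_diff)
      also have "\<dots> \<le> (\<Sum>s\<in>S. E s x) / ?k"
        using S s by (intro divide_right_mono member_le_sum) (auto simp: E_def)
      finally show ?thesis using s by simp
    qed
    have iM: "integrable ?S (\<lambda>x. MAX s\<in>S. X s x)" using S iX by (intro integrable_MAX)
    have "l * (\<integral>x. (MAX s\<in>S. X s x) \<partial>?S) = (\<integral>x. l * (MAX s\<in>S. X s x) \<partial>?S)" by simp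
    also have "\<dots> \<le> (\<integral>x. l\<^sup>2 / 2 * Bs x + ((\<Sum>s\<in>S. E s x) / card S - 1 + ln (card S)) \<partial>?S)"
      using iM iB iE pt by (intro integral_mono) auto
    also have "\<dots> = l\<^sup>2 / 2 * (N * integral\<^sup>L P b) + ((\<Sum>s\<in>S. integral\<^sup>L ?S (E s)) / card S - 1 + ln (card S))"
      using iB iE by (simp add: EB S.prob_space)
    also have "\<dots> \<le> l\<^sup>2 / 2 * (N * m) + ln (card S)"
    proof -
      have "(\<Sum>s\<in>S. integral\<^sup>L ?S (E s)) \<le> (\<Sum>s\<in>S. 1)" using EE by (intro sum_mono)
      then have "(\<Sum>s\<in>S. integral\<^sup>L ?S (E s)) / card S \<le> 1" using cS by (simp add: divide_le_eq)
      moreover have "l\<^sup>2 / 2 * (N * integral\<^sup>L P b) \<le> l\<^sup>2 / 2 * (N * m)"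
        using m by (intro mult_left_mono) auto
      ultimately show ?thesis by linarith
    qed
    finally show ?thesis using l by (simp add: field_simps power2_eq_square)
  qed
  have "0 \<le> integral\<^sup>L P b" using ub S
    by (intro integral_nonneg_AE AE_I2) (metis all_not_in_conv order_trans zero_le_power2)
  then have m0: "0 \<le> m" using m by linarith
  have "(\<integral>x. (MAX s\<in>S. X s x) \<partial>?S) \<le> 2 * sqrt (ln (card S) * (N * m / 2))"
    using cS m0 main by (intro le_two_sqrt_of_le_all) auto
  also have "\<dots> = sqrt (2 * ln (card S) * N * m)"
  proof -
    have "2 * sqrt (ln (card S) * (N * m / 2)) = sqrt (4 * (ln (card S) * (N * m / 2)))"
      by (subst real_sqrt_mult[of 4]) simp
    then show ?thesis by (simp add: algebra_simps)
  qed
  finally show ?thesis by (simp add: X_def)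
qed

text \<open>
The absolute value of a signed count is the maximum over the two global signs, so this is the
finite class lemma for a class of two functions.
\<close>

lemma rademacher_indicator_le:
  fixes a :: "'a \<Rightarrow> real"
  assumes P: "prob_space P" and a: "a \<in> borel_measurable P"
  shows "integrable (sample_measure N (signed P))
      (\<lambda>x. \<bar>\<Sum>i<N. sgn_of (snd (x i)) * (if t < a (fst (x i)) then 1 else 0)\<bar>)"
    and "(\<integral>x. \<bar>\<Sum>i<N. sgn_of (snd (x i)) * (if t < a (fst (x i)) then 1 else 0)\<bar> \<partial>sample_measure N (signed P))
      \<le> 2 * sqrt N * sqrt (measure P {z \<in> space P. t < a z})"
proof -
  let ?S = "sample_measure N (signed P)"
  interpret P: prob_space P by fact
  have Q: "prob_space (signed P)" using P by (rule prob_space_signed)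
  note [measurable] = a
  define k where "k z = (if t < a z then 1 else 0 :: real)" for z
  have [measurable]: "k \<in> borel_measurable P" unfolding k_def by measurable
  have ik: "integrable P k" by (rule P.integrable_const_bound[of _ 1]) (auto simp: k_def)
  have Ek: "integral\<^sup>L P k = measure P {z \<in> space P. t < a z}"
  proof -
    have "integral\<^sup>L P k = (\<integral>z. indicator {z \<in> space P. t < a z} z \<partial>P)"
      by (intro Bochner_Integration.integral_cong) (auto simp: k_def indicator_def)
    then show ?thesis by simp
  qed
  have "integrable (signed P) (\<lambda>q. sgn_of (snd q) * k (fst q))"
    using ik by (intro integral_signed(1)[OF P, of "\<lambda>z b. sgn_of b * k z"]) auto
  then have iX: "integrable ?S (\<lambda>x. \<Sum>i<N. sgn_of (snd (x i)) * k (fst (x i)))"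
    by (intro Bochner_Integration.integrable_sum
        integrable_sample_component[OF Q, where f="\<lambda>q. sgn_of (snd q) * k (fst q)"]) auto
  then show "integrable ?S (\<lambda>x. \<bar>\<Sum>i<N. sgn_of (snd (x i)) * (if t < a (fst (x i)) then 1 else 0)\<bar>)"
    by (simp add: k_def)
  have abs_eq: "\<bar>\<Sum>i<N. sgn_of (snd (x i)) * k (fst (x i))\<bar>
    = (MAX s\<in>UNIV. \<Sum>i<N. sgn_of (snd (x i)) * (sgn_of s * k (fst (x i))))" for x
  proof -
    define y where "y = (\<Sum>i<N. sgn_of (snd (x i)) * k (fst (x i)))"
    have eq: "(\<Sum>i<N. sgn_of (snd (x i)) * (sgn_of s * k (fst (x i)))) = sgn_of s * y" for s
      by (simp add: y_def sum_distrib_left algebra_simps)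
    have "\<bar>y\<bar> = (MAX s\<in>UNIV. sgn_of s * y)" by (simp add: UNIV_bool sgn_of_def abs_if max_def)
    then show ?thesis unfolding eq y_def .
  qed
  have "(\<integral>x. \<bar>\<Sum>i<N. sgn_of (snd (x i)) * k (fst (x i))\<bar> \<partial>?S)
    \<le> sqrt (2 * ln (card (UNIV :: bool set)) * N * integral\<^sup>L P k)"
    unfolding abs_eq
    by (rule rademacher_max_le[OF P, where b = k]) (insert ik, auto simp: k_def sgn_of_def)
  also have "\<dots> \<le> sqrt (4 * (N * integral\<^sup>L P k))"
  proof -
    have "ln (2::real) \<le> 2" using ln_le_minus_one[of 2] by simp
    then have "(2 * ln 2) * (N * integral\<^sup>L P k) \<le> 4 * (N * integral\<^sup>L P k)"
      by (intro mult_right_mono) (auto intro!: mult_nonneg_nonneg integral_nonneg_AE simp: k_def)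
    then show ?thesis by (simp add: algebra_simps)
  qed
  also have "\<dots> = 2 * sqrt N * sqrt (measure P {z \<in> space P. t < a z})"
    by (simp add: real_sqrt_mult Ek)
  finally show "(\<integral>x. \<bar>\<Sum>i<N. sgn_of (snd (x i)) * (if t < a (fst (x i)) then 1 else 0)\<bar> \<partial>?S)
      \<le> 2 * sqrt N * sqrt (measure P {z \<in> space P. t < a z})"
    by (simp add: k_def)
qed

text \<open>
The layer-cake formula \<open>min \<tau> a = \<integral> 1{t < \<tau>} 1{t < a} dt\<close> bounds the signed sum for every
\<open>\<tau>\<close> by one and the same integral over \<open>t\<close> of absolute signed counts of \<open>{a > t}\<close>.
\<close>

lemma rademacher_min_le:
  fixes a :: "'a \<Rightarrow> real" and \<tau> :: "'s \<Rightarrow> real"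
  assumes P: "prob_space P" and T: "finite T" "T \<noteq> {}" and \<tau>: "\<And>s. s \<in> T \<Longrightarrow> 0 \<le> \<tau> s"
    and a: "a \<in> borel_measurable P" and a0: "\<And>z. z \<in> space P \<Longrightarrow> 0 \<le> a z"
    and J: "(\<integral>\<^sup>+t. indicator {0<..} t * ennreal (sqrt (measure P {z \<in> space P. t < a z})) \<partial>lborel) \<le> ennreal J"
      "0 \<le> J"
  shows "(\<integral>x. (MAX s\<in>T. \<bar>\<Sum>i<N. sgn_of (snd (x i)) * min (\<tau> s) (a (fst (x i)))\<bar>) \<partial>sample_measure N (signed P))
    \<le> 2 * sqrt N * J"
proof -
  let ?S = "sample_measure N (signed P)"
  interpret P: prob_space P by fact
  have Q: "prob_space (signed P)" using P by (rule prob_space_signed)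
  interpret S: prob_space ?S using Q by (rule prob_space_sample_measure)
  interpret SL: pair_sigma_finite ?S "lborel :: real measure" ..
  have sm [measurable]: "(\<lambda>x. a (fst (x i))) \<in> borel_measurable ?S"
    "(\<lambda>x. sgn_of (snd (x i))) \<in> borel_measurable ?S" if "i < N" for i
    using measurable_compose[OF measurable_sample_component[OF that] measurable_compose[OF measurable_signed(1) a]]
      measurable_compose[OF measurable_sample_component[OF that] measurable_signed(2)] by simp_all
  define D where "D t x = \<bar>\<Sum>i<N. sgn_of (snd (x i)) * (if t < a (fst (x i)) then 1 else 0)\<bar>"
    for t and x :: "nat \<Rightarrow> 'a \<times> bool"
  have Dm [measurable]: "(\<lambda>(x, t). D t x) \<in> borel_measurable (?S \<Otimes>\<^sub>M lborel)"
    unfolding D_def case_prod_beta'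
  proof (intro borel_measurable_abs borel_measurable_sum)
    fix i assume "i \<in> {..<N}"
    then have i: "i < N" by simp
    note [measurable] = measurable_compose[OF measurable_fst sm(1)[OF i]] measurable_compose[OF measurable_fst sm(2)[OF i]]
    show "(\<lambda>z. sgn_of (snd (fst z i)) * (if snd z < a (fst (fst z i)) then 1 else 0)) \<in> borel_measurable (?S \<Otimes>\<^sub>M lborel)"
      by measurable
  qed
  define H where "H s x = \<bar>\<Sum>i<N. sgn_of (snd (x i)) * min (\<tau> s) (a (fst (x i)))\<bar>"
    for s and x :: "nat \<Rightarrow> 'a \<times> bool"
  define G where "G x = (MAX s\<in>T. H s x)" for x
  have Gm: "G \<in> borel_measurable ?S"
    unfolding G_def[abs_def] H_def[abs_def] using T
    by (intro borel_measurable_Max borel_measurable_abs borel_measurable_sum borel_measurable_times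
        borel_measurable_min sm borel_measurable_const) auto
  have pt: "ennreal (G x) \<le> (\<integral>\<^sup>+t. indicator {0<..} t * ennreal (D t x) \<partial>lborel)" if x: "x \<in> space ?S" for x
  proof -
    obtain s where s: "s \<in> T" "G x = H s x"
      unfolding G_def using Max_attained[OF T] .
    have mem: "fst (x i) \<in> space P" if "i < N" for i
      using measurable_space[OF measurable_compose[OF measurable_sample_component[OF that] measurable_signed(1)] x] .
    define m where "m i = min (\<tau> s) (a (fst (x i)))" for i
    have m0: "0 \<le> m i" if "i < N" for i using \<tau>[OF s(1)] a0[OF mem[OF that]] by (simp add: m_def)
    define f where "f t = (\<Sum>i<N. sgn_of (snd (x i)) * indicator {0<..<m i} t)" for t :: real
    have i1: "integrable lborel (\<lambda>t. indicator {0<..<m i} t :: real)" if "i < N" for i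
      using m0[OF that] by (intro integrable_real_indicator) auto
    have "(\<integral>t. f t \<partial>lborel) = (\<Sum>i<N. sgn_of (snd (x i)) * (\<integral>t. indicator {0<..<m i} t \<partial>lborel))"
      unfolding f_def using i1 by (subst Bochner_Integration.integral_sum) auto
    also have "\<dots> = (\<Sum>i<N. sgn_of (snd (x i)) * m i)"
      using m0 by (intro sum.cong) auto
    finally have If: "(\<integral>t. f t \<partial>lborel) = (\<Sum>i<N. sgn_of (snd (x i)) * m i)" .
    have fi: "integrable lborel f" unfolding f_def[abs_def] using i1
      by (intro Bochner_Integration.integrable_sum integrable_mult_right) auto
    have "ennreal (G x) = ennreal (norm (\<integral>t. f t \<partial>lborel))" by (simp add: s If m_def H_def)
    also have "\<dots> \<le> (\<integral>\<^sup>+t. ennreal (norm (f t)) \<partial>lborel)"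
      by (rule integral_norm_bound_ennreal[OF fi])
    also have "\<dots> \<le> (\<integral>\<^sup>+t. indicator {0<..} t * ennreal (D t x) \<partial>lborel)"
    proof (rule nn_integral_mono)
      fix t :: real
      consider "t \<le> 0" | "t \<ge> \<tau> s" | "0 < t" "t < \<tau> s" by linarith
      then show "ennreal (norm (f t)) \<le> indicator {0<..} t * ennreal (D t x)"
      proof cases
        case 3
        then have "f t = (\<Sum>i<N. sgn_of (snd (x i)) * (if t < a (fst (x i)) then 1 else 0))"
          unfolding f_def by (intro sum.cong) (auto simp: m_def)
        then show ?thesis using 3 by (simp add: D_def)
      qed (auto simp: f_def m_def)
    qed
    finally show ?thesis .
  qed
  have G0: "0 \<le> G x" for x
    unfolding G_def H_def using T by (subst Max_ge_iff) auto
  have "(\<integral>\<^sup>+x. ennreal (G x) \<partial>?S) \<le> (\<integral>\<^sup>+x. (\<integral>\<^sup>+t. indicator {0<..} t * ennreal (D t x) \<partial>lborel) \<partial>?S)"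
    by (intro nn_integral_mono pt)
  also have "\<dots> = (\<integral>\<^sup>+t. (\<integral>\<^sup>+x. indicator {0<..} t * ennreal (D t x) \<partial>?S) \<partial>lborel)"
    by (rule SL.Fubini'[symmetric]) measurable
  also have "\<dots> \<le> (\<integral>\<^sup>+t. ennreal (2 * sqrt N) * (indicator {0<..} t * ennreal (sqrt (measure P {z \<in> space P. t < a z}))) \<partial>lborel)"
  proof (rule nn_integral_mono)
    fix t :: real
    note R = rademacher_indicator_le[OF P a, of N t, folded D_def]
    have "(\<integral>\<^sup>+x. indicator {0<..} t * ennreal (D t x) \<partial>?S) = indicator {0<..} t * (\<integral>\<^sup>+x. ennreal (D t x) \<partial>?S)"
      using borel_measurable_integrable[OF R(1)] by (intro nn_integral_cmult) auto
    also have "(\<integral>\<^sup>+x. ennreal (D t x) \<partial>?S) = ennreal (\<integral>x. D t x \<partial>?S)"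
      by (rule nn_integral_eq_integral[OF R(1)]) (simp add: D_def)
    also have "\<dots> \<le> ennreal (2 * sqrt N * sqrt (measure P {z \<in> space P. t < a z}))"
      by (intro ennreal_leI R)
    also have "\<dots> = ennreal (2 * sqrt N) * ennreal (sqrt (measure P {z \<in> space P. t < a z}))"
      by (intro ennreal_mult) auto
    finally show "(\<integral>\<^sup>+x. indicator {0<..} t * ennreal (D t x) \<partial>?S)
      \<le> ennreal (2 * sqrt N) * (indicator {0<..} t * ennreal (sqrt (measure P {z \<in> space P. t < a z})))"
      by (simp add: mult_left_mono mult.left_commute)
  qed
  also have "\<dots> = ennreal (2 * sqrt N) * (\<integral>\<^sup>+t. indicator {0<..} t * ennreal (sqrt (measure P {z \<in> space P. t < a z})) \<partial>lborel)"
  proof (rule nn_integral_cmult)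
    note [measurable] = a
    have "(\<lambda>t. measure P {z \<in> space P. t < a z}) \<in> borel_measurable borel"
    proof -
      have "mono (\<lambda>t. - measure P {z \<in> space P. t < a z})"
        by (intro monoI le_imp_neg_le P.finite_measure_mono) auto
      from borel_measurable_mono[OF this] show ?thesis by simp
    qed
    then show "(\<lambda>t. indicator {0<..} t * ennreal (sqrt (measure P {z \<in> space P. t < a z}))) \<in> borel_measurable lborel"
      by measurable
  qed
  also have "\<dots> \<le> ennreal (2 * sqrt N) * ennreal J" by (intro mult_left_mono J) simp
  also have "\<dots> = ennreal (2 * sqrt N * J)" using J by (simp add: ennreal_mult)
  finally have "enn2real (\<integral>\<^sup>+x. ennreal (G x) \<partial>?S) \<le> 2 * sqrt N * J"
    using J by (intro enn2real_leI) auto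
  then show ?thesis
    using Gm G0 by (subst (asm) integral_eq_nn_integral[symmetric]) (auto simp: G_def[abs_def] H_def[abs_def])
qed

section \<open>Norms and dual norms\<close>

lemma is_normD:
  assumes "is_norm nrm"
  shows is_norm_nonneg: "0 \<le> nrm x" and is_norm_eq_0: "nrm x = 0 \<longleftrightarrow> x = 0"
    and is_norm_scaleR: "nrm (a *\<^sub>R x) = \<bar>a\<bar> * nrm x" and is_norm_triangle: "nrm (x + y) \<le> nrm x + nrm y"
  using assms by (simp_all add: is_norm_def)

lemma is_norm_minus: "is_norm nrm \<Longrightarrow> nrm (- x) = nrm x"
  using is_norm_scaleR[of nrm "-1" x] by simp

lemma is_norm_commute: "is_norm nrm \<Longrightarrow> nrm (x - y) = nrm (y - x)"
  using is_norm_minus[of nrm "x - y"] by simp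

lemma is_norm_abs_diff: "is_norm nrm \<Longrightarrow> \<bar>nrm x - nrm y\<bar> \<le> nrm (x - y)"
  using is_norm_triangle[of nrm "x - y" y] is_norm_triangle[of nrm "y - x" x] is_norm_commute[of nrm x y] by simp

lemma is_norm_le_norm:
  fixes nrm :: "'a::euclidean_space \<Rightarrow> real"
  assumes "is_norm nrm"
  obtains C where "C > 0" "\<And>x. nrm x \<le> C * norm x"
proof -
  define C where "C = 1 + (\<Sum>b\<in>Basis. nrm b)"
  have sum_le: "nrm (\<Sum>b\<in>A. f b) \<le> (\<Sum>b\<in>A. nrm (f b))" for A and f :: "'a \<Rightarrow> 'a"
    using is_norm_eq_0[OF assms, of 0] is_norm_triangle[OF assms]
    by (induction A rule: infinite_finite_induct) (auto intro: order_trans[OF _ add_left_mono])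
  have "nrm x \<le> C * norm x" for x
  proof -
    have "nrm x = nrm (\<Sum>b\<in>Basis. (x \<bullet> b) *\<^sub>R b)" by (simp add: euclidean_representation)
    also have "\<dots> \<le> (\<Sum>b\<in>Basis. \<bar>x \<bullet> b\<bar> * nrm b)"
      using sum_le[of "\<lambda>b. (x \<bullet> b) *\<^sub>R b" Basis] by (simp add: is_norm_scaleR[OF assms])
    also have "\<dots> \<le> (\<Sum>b\<in>Basis. norm x * nrm b)"
      by (intro sum_mono mult_right_mono Basis_le_norm is_norm_nonneg[OF assms])
    also have "\<dots> \<le> C * norm x" by (simp add: C_def sum_distrib_left algebra_simps)
    finally show ?thesis .
  qed
  moreover have "C > 0" unfolding C_def using is_norm_nonneg[OF assms] by (simp add: sum_nonneg add_pos_nonneg)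
  ultimately show ?thesis using that by blast
qed

lemma continuous_on_is_norm:
  fixes nrm :: "'a::euclidean_space \<Rightarrow> real"
  assumes "is_norm nrm"
  shows "continuous_on S nrm"
proof -
  obtain C where C: "C > 0" "\<And>x. nrm x \<le> C * norm x" using is_norm_le_norm[OF assms] by metis
  have "dist (nrm x) (nrm y) \<le> C * dist x y" for x y
    using is_norm_abs_diff[OF assms, of x y] C(2)[of "x - y"] by (simp add: dist_norm)
  then have "C-lipschitz_on S nrm" using C by (intro lipschitz_onI) auto
  then show ?thesis by (rule lipschitz_on_continuous_on)
qed

lemma borel_measurable_is_norm:
  fixes nrm :: "'a::euclidean_space \<Rightarrow> real"
  shows "is_norm nrm \<Longrightarrow> nrm \<in> borel_measurable borel"
  by (intro borel_measurable_continuous_onI continuous_on_is_norm)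

text \<open>
All norms on a Euclidean space are equivalent: the minimum of the norm on the unit sphere is positive
by compactness.
\<close>

lemma norm_le_is_norm:
  fixes nrm :: "'a::euclidean_space \<Rightarrow> real"
  assumes "is_norm nrm"
  obtains C where "C > 0" "\<And>x. norm x \<le> C * nrm x"
proof -
  obtain b :: 'a where b: "b \<in> Basis" using nonempty_Basis by blast
  then have "sphere (0::'a) 1 \<noteq> {}" by (auto intro!: exI[of _ b])
  then obtain x0 where x0: "x0 \<in> sphere 0 1" "\<And>x. x \<in> sphere 0 1 \<Longrightarrow> nrm x0 \<le> nrm x"
    using continuous_attains_inf[OF compact_sphere _ continuous_on_is_norm[OF assms]] by metis
  define c where "c = nrm x0"
  have c: "c > 0"
    using x0(1) is_norm_eq_0[OF assms, of x0] is_norm_nonneg[OF assms, of x0] by (auto simp: c_def less_le)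
  have "norm x \<le> (1 / c) * nrm x" for x
  proof (cases "x = 0")
    case False
    then have "c \<le> nrm ((1 / norm x) *\<^sub>R x)" unfolding c_def by (intro x0) auto
    also have "\<dots> = nrm x / norm x" by (simp add: is_norm_scaleR[OF assms])
    finally show ?thesis using False c by (simp add: field_simps)
  qed (simp add: is_norm_nonneg[OF assms] c less_imp_le)
  then show ?thesis using that[of "1 / c"] c by simp
qed

lemma compact_unit_ball_is_norm:
  fixes nrm :: "'a::euclidean_space \<Rightarrow> real"
  assumes "is_norm nrm"
  shows "compact {z. nrm z \<le> 1}"
proof -
  obtain C where C: "C > 0" "\<And>x. norm x \<le> C * nrm x" using norm_le_is_norm[OF assms] by metis
  have "norm z \<le> C" if "nrm z \<le> 1" for z
    using C(2)[of z] mult_left_mono[OF that, of C] C(1) by linarith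
  then have "bounded {z. nrm z \<le> 1}" by (auto simp: bounded_iff)
  moreover have "closed {z. nrm z \<le> 1}"
    using continuous_on_is_norm[OF assms] by (intro closed_Collect_le) auto
  ultimately show ?thesis by (simp add: compact_eq_bounded_closed)
qed

definition dual_norm :: "('a::euclidean_space \<Rightarrow> real) \<Rightarrow> 'a \<Rightarrow> real" where
  "dual_norm nrm w = (SUP z\<in>{z. nrm z \<le> 1}. w \<bullet> z)"

lemma dual_norm_attained:
  fixes nrm :: "'a::euclidean_space \<Rightarrow> real"
  assumes "is_norm nrm"
  obtains v where "nrm v \<le> 1" "w \<bullet> v = dual_norm nrm w" "\<And>z. nrm z \<le> 1 \<Longrightarrow> w \<bullet> z \<le> w \<bullet> v"
proof -
  have "0 \<in> {z. nrm z \<le> 1}" using is_norm_eq_0[OF assms, of 0] by simp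
  then obtain v where v: "nrm v \<le> 1" "\<And>z. nrm z \<le> 1 \<Longrightarrow> w \<bullet> z \<le> w \<bullet> v"
    using continuous_attains_sup[OF compact_unit_ball_is_norm[OF assms], of "\<lambda>z. w \<bullet> z"]
      continuous_on_inner[OF continuous_on_const continuous_on_id, of "{z. nrm z \<le> 1}" w]
    by auto
  then have "dual_norm nrm w = w \<bullet> v"
    unfolding dual_norm_def by (intro cSup_eq_maximum) auto
  then show ?thesis using that v by metis
qed

lemma inner_le_dual_norm:
  fixes nrm :: "'a::euclidean_space \<Rightarrow> real"
  assumes "is_norm nrm"
  shows "w \<bullet> z \<le> dual_norm nrm w * nrm z"
proof (cases "z = 0")
  case True
  then show ?thesis using is_norm_eq_0[OF assms, of 0] by simp
next
  case False
  then have n: "nrm z > 0" using is_norm_eq_0[OF assms, of z] is_norm_nonneg[OF assms, of z] by simp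
  obtain v where v: "w \<bullet> v = dual_norm nrm w" "\<And>z. nrm z \<le> 1 \<Longrightarrow> w \<bullet> z \<le> w \<bullet> v"
    using dual_norm_attained[OF assms] by metis
  have "w \<bullet> ((1 / nrm z) *\<^sub>R z) \<le> w \<bullet> v"
    using n by (intro v) (simp add: is_norm_scaleR[OF assms])
  then show ?thesis using n v by (simp add: field_simps)
qed

lemma abs_inner_le_dual_norm:
  fixes nrm :: "'a::euclidean_space \<Rightarrow> real"
  assumes "is_norm nrm"
  shows "\<bar>w \<bullet> z\<bar> \<le> dual_norm nrm w * nrm z"
  using inner_le_dual_norm[OF assms, of w z] inner_le_dual_norm[OF assms, of w "-z"] is_norm_minus[OF assms, of z]
  by simp

lemma is_norm_dual_norm:
  fixes nrm :: "'a::euclidean_space \<Rightarrow> real"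
  assumes "is_norm nrm"
  shows "is_norm (dual_norm nrm)"
  unfolding is_norm_def
proof (intro conjI allI)
  have le: "dual_norm nrm w \<le> c" if "\<And>z. nrm z \<le> 1 \<Longrightarrow> w \<bullet> z \<le> c" for w c
    using dual_norm_attained[OF assms, of w] that by metis
  have ge: "w \<bullet> z \<le> dual_norm nrm w" if "nrm z \<le> 1" for w z
    using dual_norm_attained[OF assms, of w] that by metis
  have zero: "nrm 0 = 0" using is_norm_eq_0[OF assms, of 0] by simp
  show nonneg: "0 \<le> dual_norm nrm w" for w using ge[of 0 w] zero by simp
  have scale: "dual_norm nrm (a *\<^sub>R w) \<le> \<bar>a\<bar> * dual_norm nrm w" for a w
  proof (rule le)
    fix z assume z: "nrm z \<le> 1"
    have "(a *\<^sub>R w) \<bullet> z \<le> \<bar>a\<bar> * \<bar>w \<bullet> z\<bar>" by (metis abs_ge_self abs_mult inner_scaleR_left)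
    also have "\<dots> \<le> \<bar>a\<bar> * dual_norm nrm w"
      using abs_inner_le_dual_norm[OF assms, of w z] mult_left_mono[OF z nonneg[of w]]
      by (intro mult_left_mono) auto
    finally show "(a *\<^sub>R w) \<bullet> z \<le> \<bar>a\<bar> * dual_norm nrm w" .
  qed
  show "dual_norm nrm (a *\<^sub>R w) = \<bar>a\<bar> * dual_norm nrm w" for a w
  proof (cases "a = 0")
    case True
    then show ?thesis using scale[of 0 w] nonneg[of 0] by simp
  next
    case False
    then have "\<bar>a\<bar> * dual_norm nrm w \<le> dual_norm nrm (a *\<^sub>R w)"
      using scale[of "1 / a" "a *\<^sub>R w"] by (simp add: field_simps)
    then show ?thesis using scale[of a w] by simp
  qed
  show "dual_norm nrm (w + w') \<le> dual_norm nrm w + dual_norm nrm w'" for w w'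
    by (rule le) (simp add: inner_add_left ge add_mono)
  show "dual_norm nrm w = 0 \<longleftrightarrow> w = 0" for w
  proof
    assume "dual_norm nrm w = 0"
    then show "w = 0" using inner_le_dual_norm[OF assms, of w w] inner_gt_zero_iff[of w] by fastforce
  next
    assume "w = 0"
    then show "dual_norm nrm w = 0" using le[of w 0] nonneg[of w] by simp
  qed
qed

section \<open>Nets of unit balls\<close>

text \<open>
Balls of radius 1/4 around 1/2-separated points of the unit ball are disjoint and lie in the ball of
radius 5/4; comparing Lebesgue volumes gives \<open>(5/4) ^ n / (1/4) ^ n\<close>.
\<close>

lemma packing_card_le:
  fixes nrm :: "'a::euclidean_space \<Rightarrow> real"
  assumes n: "is_norm nrm" and S: "finite S" "S \<subseteq> {w. nrm w \<le> 1}"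
    and sep: "\<And>v w. v \<in> S \<Longrightarrow> w \<in> S \<Longrightarrow> v \<noteq> w \<Longrightarrow> 1/2 < nrm (v - w)"
  shows "card S \<le> 5 ^ DIM('a)"
proof -
  define U where "U = {w :: 'a. nrm w < 1}"
  define B where "B s = (\<lambda>x. (1/4) *\<^sub>R x + s) ` U" for s
  define V where "V = (\<lambda>x. (5/4) *\<^sub>R x + 0) ` U"
  let ?m = "measure lebesgue U"
  have oU: "open U" unfolding U_def using continuous_on_is_norm[OF n] by (intro open_Collect_less) auto
  have oB: "open (B s)" for s
    unfolding B_def using open_affinity[OF oU, of "1/4" s] by (simp add: add.commute)
  have bU: "bounded U"
    using compact_imp_bounded[OF compact_unit_ball_is_norm[OF n]] by (rule bounded_subset) (auto simp: U_def)
  have lm: "A \<in> lmeasurable" if "bounded A" "open A" for A :: "'a set"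
    using that by (intro bounded_set_imp_lmeasurable) auto
  have bV: "bounded V" and oV: "open V"
    using bounded_scaling[OF bU, of "5/4"] open_scaling[OF _ oU, of "5/4"] by (auto simp: V_def)
  have "0 \<in> U" using is_norm_eq_0[OF n, of 0] by (simp add: U_def)
  then obtain e where e: "e > 0" "ball 0 e \<subseteq> U" using oU open_contains_ball by blast
  have "0 < measure lebesgue (ball (0::'a) e)" using content_ball_pos[OF e(1)] by (simp add: measure_completion)
  also have "\<dots> \<le> ?m" using e lm[OF bU oU] by (intro measure_mono_fmeasurable) auto
  finally have pos: "?m > 0" .
  have sub: "B s \<subseteq> V" if "s \<in> S" for s
  proof
    fix y assume "y \<in> B s"
    then obtain x where x: "nrm x < 1" "y = (1/4) *\<^sub>R x + s" by (auto simp: B_def U_def)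
    have "nrm y \<le> (1/4) * nrm x + nrm s"
      using is_norm_triangle[OF n, of "(1/4) *\<^sub>R x" s] is_norm_scaleR[OF n, of "1/4" x] x by simp
    then have "nrm y < 5/4" using x S that by fastforce
    then have "nrm ((4/5) *\<^sub>R y) < 1" by (simp add: is_norm_scaleR[OF n])
    then show "y \<in> V" unfolding V_def U_def by (intro image_eqI[of _ _ "(4/5) *\<^sub>R y"]) auto
  qed
  have disj: "disjoint_family_on B S"
    unfolding disjoint_family_on_def
  proof (intro ballI impI)
    fix s t assume st: "s \<in> S" "t \<in> S" "s \<noteq> t"
    show "B s \<inter> B t = {}"
    proof (rule ccontr)
      assume "B s \<inter> B t \<noteq> {}"
      then obtain y where "y \<in> B s" "y \<in> B t" by blast
      then obtain x x' where x: "nrm x < 1" "nrm x' < 1" "(1/4) *\<^sub>R x + s = (1/4) *\<^sub>R x' + t"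
        by (auto simp: B_def U_def)
      then have "s - t = (1/4) *\<^sub>R x' + (- (1/4)) *\<^sub>R x" by (simp add: algebra_simps)
      then have "nrm (s - t) \<le> (1/4) * nrm x' + (1/4) * nrm x"
        using is_norm_triangle[OF n, of "(1/4) *\<^sub>R x'" "(- (1/4)) *\<^sub>R x"]
        by (simp add: is_norm_scaleR[OF n] is_norm_minus[OF n])
      then show False using sep[OF st] x by linarith
    qed
  qed
  have mB: "measure lebesgue (B s) = (1/4) ^ DIM('a) * ?m" for s
    unfolding B_def by (subst measure_lebesgue_affine) simp
  have mV: "measure lebesgue V = (5/4) ^ DIM('a) * ?m"
    unfolding V_def by (subst measure_lebesgue_affine) simp
  have bB: "B s \<in> lmeasurable" if "s \<in> S" for s
    using oB bounded_subset[OF bV sub[OF that]] by (intro lm) auto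
  have "card S * ((1/4) ^ DIM('a) * ?m) = (\<Sum>s\<in>S. measure lebesgue (B s))" by (simp add: mB)
  also have "\<dots> = measure lebesgue (\<Union>s\<in>S. B s)"
    using bB disj S proof (intro measure_finite_Union[symmetric] disj S)
    show "B ` S \<subseteq> sets lebesgue" using bB by (auto intro: fmeasurableD)
    show "emeasure lebesgue (B s) \<noteq> \<infinity>" if "s \<in> S" for s
      using fmeasurableD2[OF bB[OF that]] by (simp only: infinity_ennreal_def not_False_eq_True)
  qed
  also have "\<dots> \<le> measure lebesgue V"
    using sub lm[OF bV oV] bB S by (intro measure_mono_fmeasurable) (auto simp: fmeasurableD)
  finally have "card S * (1/4) ^ DIM('a) \<le> (5/4 :: real) ^ DIM('a)"
    using pos by (simp add: mV)
  then have "real (card S) \<le> 5 ^ DIM('a)" by (simp add: power_divide field_simps)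
  then show ?thesis by (metis of_nat_le_iff of_nat_numeral of_nat_power)
qed

text \<open>
A separated set of maximal cardinality is a net.
\<close>

lemma half_net_of_unit_ball:
  fixes nrm :: "'a::euclidean_space \<Rightarrow> real"
  assumes n: "is_norm nrm"
  obtains S where "finite S" "S \<noteq> {}" "S \<subseteq> {w. nrm w \<le> 1}" "card S \<le> 5 ^ DIM('a)"
    "\<And>w. nrm w \<le> 1 \<Longrightarrow> \<exists>s\<in>S. nrm (w - s) \<le> 1/2"
proof -
  define Q where "Q S \<longleftrightarrow> finite S \<and> S \<subseteq> {w. nrm w \<le> 1} \<and>
    (\<forall>v\<in>S. \<forall>w\<in>S. v \<noteq> w \<longrightarrow> 1/2 < nrm (v - w))" for S :: "'a set"
  have Q0: "Q {}" by (simp add: Q_def)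
  have bound: "\<And>S. Q S \<Longrightarrow> card S \<le> 5 ^ DIM('a)"
    using packing_card_le[OF n] by (simp add: Q_def)
  then obtain S where S: "Q S" "\<And>S'. Q S' \<Longrightarrow> card S' \<le> card S"
    using ex_has_greatest_nat[of Q "{}" card "Suc (5 ^ DIM('a))"] Q0 by (auto simp: less_Suc_eq_le)
  have net: "\<exists>s\<in>S. nrm (w - s) \<le> 1/2" if w: "nrm w \<le> 1" for w
  proof (rule ccontr)
    assume "\<not> ?thesis"
    then have far: "1/2 < nrm (w - s)" if "s \<in> S" for s using that by force
    have "w \<notin> S" using far[of w] is_norm_eq_0[OF n, of 0] by auto
    moreover have "Q (insert w S)"
      using S(1) w far is_norm_commute[OF n, of w] by (auto simp: Q_def)
    ultimately show False using S(2)[of "insert w S"] S(1) by (simp add: Q_def)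
  qed
  have "S \<noteq> {}" using net[of 0] is_norm_eq_0[OF n, of 0] by auto
  then show ?thesis using that[of S] S net bound by (auto simp: Q_def)
qed

text \<open>
A linear functional is maximized at some \<open>v\<close> in the unit ball; rounding \<open>v\<close> to the net
loses at most half of the maximum, since twice the rounding error lies in the unit ball again.
\<close>

lemma half_net_doubles:
  fixes nrm :: "'a::euclidean_space \<Rightarrow> real"
  assumes n: "is_norm nrm" and S: "finite S" "S \<noteq> {}"
    and net: "\<And>w. nrm w \<le> 1 \<Longrightarrow> \<exists>s\<in>S. nrm (w - s) \<le> 1/2" and w: "nrm w \<le> 1"
  shows "w \<bullet> y \<le> 2 * (MAX s\<in>S. s \<bullet> y)"
proof -
  obtain v where v: "nrm v \<le> 1" "\<And>z. nrm z \<le> 1 \<Longrightarrow> y \<bullet> z \<le> y \<bullet> v"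
    using dual_norm_attained[OF n, of y] by metis
  obtain s where s: "s \<in> S" "nrm (v - s) \<le> 1/2" using net[OF v(1)] by blast
  have "y \<bullet> (2 *\<^sub>R (v - s)) \<le> y \<bullet> v"
    using s by (intro v) (simp add: is_norm_scaleR[OF n])
  then have "y \<bullet> v \<le> 2 * (y \<bullet> s)" by (simp add: inner_diff_right)
  moreover have "s \<bullet> y \<le> (MAX s\<in>S. s \<bullet> y)" using S s by (intro Max_ge) auto
  ultimately show ?thesis using v(2)[OF w] by (simp add: inner_commute)
qed

section \<open>The check loss\<close>

lemma check_loss_eq: "check_loss \<alpha> u = max (\<alpha> * u) ((\<alpha> - 1) * u)" if "0 < \<alpha>" "\<alpha> < 1"
proof (cases "u < 0")
  case True
  then show ?thesis using that by (simp add: check_loss_def max_def algebra_simps)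
next
  case False
  then have "(\<alpha> - 1) * u \<le> \<alpha> * u" by (simp add: algebra_simps)
  then show ?thesis using False by (simp add: check_loss_def max_def mult.commute)
qed

lemma check_loss_diff_le:
  assumes "0 < \<alpha>" "\<alpha> < 1"
  shows "\<bar>check_loss \<alpha> x - check_loss \<alpha> y\<bar> \<le> max \<alpha> (1 - \<alpha>) * \<bar>x - y\<bar>"
proof -
  have 1: "\<bar>\<alpha> * x - \<alpha> * y\<bar> \<le> max \<alpha> (1 - \<alpha>) * \<bar>x - y\<bar>"
    using assms by (simp add: right_diff_distrib[symmetric] abs_mult mult_right_mono)
  have "\<bar>(\<alpha> - 1) * x - (\<alpha> - 1) * y\<bar> = (1 - \<alpha>) * \<bar>x - y\<bar>"
    using assms by (simp add: right_diff_distrib[symmetric] abs_mult)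
  then have 2: "\<bar>(\<alpha> - 1) * x - (\<alpha> - 1) * y\<bar> \<le> max \<alpha> (1 - \<alpha>) * \<bar>x - y\<bar>"
    by (simp add: mult_right_mono)
  show ?thesis unfolding check_loss_eq[OF assms] using 1 2 by linarith
qed

lemma borel_measurable_check_loss [measurable]: "check_loss \<alpha> \<in> borel_measurable borel"
  unfolding check_loss_def[abs_def] by measurable

definition clip :: "real \<Rightarrow> real \<Rightarrow> real" where
  "clip a s = max (- a) (min s a)"

text \<open>
A threshold outside \<open>[- a, a]\<close> sees all \<open>u\<close> with \<open>\<bar>u\<bar> \<le> a\<close> on the same side, where the check loss is
linear, and the constant that depends on the threshold cancels in the difference. This is what makes
unbounded thresholds harmless.
\<close>

lemma check_loss_clip:
  assumes "0 < \<alpha>" "\<alpha> < 1" "\<bar>u\<bar> \<le> a"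
  shows "check_loss \<alpha> (u - s) - check_loss \<alpha> (- s) = check_loss \<alpha> (u - clip a s) - check_loss \<alpha> (- clip a s)"
proof -
  consider "\<bar>s\<bar> \<le> a" | "s > a" | "s < - a" by linarith
  then show ?thesis
  proof cases
    case 1
    then have "clip a s = s" by (simp add: clip_def)
    then show ?thesis by simp
  next
    case 2
    then have "clip a s = a" using assms by (simp add: clip_def)
    moreover have "check_loss \<alpha> (u - t) - check_loss \<alpha> (- t) = (\<alpha> - 1) * u" if "t \<ge> a" for t
      using that assms by (cases "u = t"; cases "t = 0") (auto simp: check_loss_def algebra_simps)
    ultimately show ?thesis using 2 by simp
  next
    case 3
    then have "clip a s = - a" using assms by (simp add: clip_def)
    moreover have *: "check_loss \<alpha> (u - t) - check_loss \<alpha> (- t) = \<alpha> * u" if "t \<le> - a" for t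
      using that assms by (auto simp: check_loss_def algebra_simps)
    ultimately show ?thesis using 3 *[of s] *[of "- a"] by simp
  qed
qed

lemma clip_eq: "0 \<le> a \<Longrightarrow> clip a s = (if 0 \<le> s then 1 else -1) * min \<bar>s\<bar> a"
  by (auto simp: clip_def)

lemma check_loss_scale: "0 < c \<Longrightarrow> check_loss \<alpha> (c * u) = c * check_loss \<alpha> u"
  by (auto simp: check_loss_def mult_less_0_iff)

text \<open>
Moving the residual away from zero by \<open>a\<close> costs at least the smaller slope times \<open>a\<close>.
\<close>

lemma check_loss_push:
  assumes "0 < \<alpha>" "\<alpha> < 1" "0 \<le> a"
  shows "0 \<le> u \<Longrightarrow> check_loss \<alpha> u + min \<alpha> (1 - \<alpha>) * a \<le> check_loss \<alpha> (u + a)"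
    and "u < 0 \<Longrightarrow> check_loss \<alpha> u + min \<alpha> (1 - \<alpha>) * a \<le> check_loss \<alpha> (u - a)"
proof -
  have 1: "min \<alpha> (1 - \<alpha>) * a \<le> \<alpha> * a" and 2: "min \<alpha> (1 - \<alpha>) * a \<le> (1 - \<alpha>) * a"
    using assms by (auto intro!: mult_right_mono)
  show "0 \<le> u \<Longrightarrow> check_loss \<alpha> u + min \<alpha> (1 - \<alpha>) * a \<le> check_loss \<alpha> (u + a)"
    using 1 assms by (simp add: check_loss_def algebra_simps)
  show "u < 0 \<Longrightarrow> check_loss \<alpha> u + min \<alpha> (1 - \<alpha>) * a \<le> check_loss \<alpha> (u - a)"
    using 2 assms by (simp add: check_loss_def algebra_simps)
qed

section \<open>Expected uniform deviation of the check loss\<close>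

lemma integrable_MAX_sum_sample:
  fixes g :: "'t \<Rightarrow> 'a \<Rightarrow> real"
  assumes "prob_space P" "finite T" "T \<noteq> {}" "\<And>t. t \<in> T \<Longrightarrow> integrable P (g t)"
  shows "integrable (sample_measure N P) (\<lambda>x. MAX t\<in>T. \<Sum>i<N. g t (x i))"
  using assms by (intro integrable_MAX Bochner_Integration.integrable_sum integrable_sample_component) auto

lemma expected_sup_le_rademacher:
  fixes f h :: "'t \<Rightarrow> 'a \<Rightarrow> real"
  assumes P: "prob_space P" and T: "finite T" "T \<noteq> {}"
    and f: "\<And>t. t \<in> T \<Longrightarrow> integrable P (f t)" and h: "\<And>t. t \<in> T \<Longrightarrow> integrable P (h t)"
    and lip: "\<And>s t z. s \<in> T \<Longrightarrow> t \<in> T \<Longrightarrow> z \<in> space P \<Longrightarrow> \<bar>f s z - f t z\<bar> \<le> L * \<bar>h s z - h t z\<bar>"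
  shows "(\<integral>x. (MAX t\<in>T. \<Sum>i<N. integral\<^sup>L P (f t) - f t (x i)) \<partial>sample_measure N P)
    \<le> (\<integral>x. (MAX t\<in>T. \<Sum>i<N. 2 * L * (sgn_of (snd (x i)) * h t (fst (x i)))) \<partial>sample_measure N (signed P))"
proof -
  interpret P: prob_space P by fact
  have "(\<integral>x. (MAX t\<in>T. 0 + (\<Sum>i<N. integral\<^sup>L P (f t) - f t (x i))) \<partial>sample_measure N P)
    \<le> (\<integral>x. (MAX t\<in>T. 0 + (\<Sum>i<N. 2 * L * (sgn_of (snd (x i)) * h t (fst (x i))))) \<partial>sample_measure N (signed P))"
  proof (rule comparison_sample[OF P prob_space_signed[OF P] T,
        where u = "\<lambda>t z. integral\<^sup>L P (f t) - f t z" and v = "\<lambda>t q. 2 * L * (sgn_of (snd q) * h t (fst q))"])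
    show "integrable P (\<lambda>z. integral\<^sup>L P (f t) - f t z)" if "t \<in> T" for t using f[OF that] by simp
    show "integrable (signed P) (\<lambda>q. 2 * L * (sgn_of (snd q) * h t (fst q)))" if "t \<in> T" for t
      using h[OF that] by (intro integral_signed(1)[OF P, of "\<lambda>z b. 2 * L * (sgn_of b * h t z)"]) auto
    show "(\<integral>z. (MAX t\<in>T. a t + (integral\<^sup>L P (f t) - f t z)) \<partial>P)
      \<le> (\<integral>q. (MAX t\<in>T. a t + 2 * L * (sgn_of (snd q) * h t (fst q))) \<partial>signed P)" for a
      by (rule symmetrization_contraction_step[OF P T f h lip])
  qed
  then show ?thesis by simp
qed

text \<open>
The indicator of \<open>A\<close> truncates the data, so that one bound serves both the data near the origin and
the data far out. By clipping, \<open>f\<close> is the difference of two check losses, one at \<open>u - c\<close>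
and one at \<open>- c\<close>, each a Lipschitz function of one real quantity; each is symmetrized and
contracted on its own. What is left are signed sums of \<open>u\<close>, linear in the slope and
reduced to a net of the dual unit ball, and signed sums of the clipped thresholds \<open>c\<close>. The second
moment \<open>m\<close> governs the former and the tail integral \<open>J\<close> the latter.
\<close>

lemma expected_sup_check_loss_le:
  fixes nrm :: "'a::euclidean_space \<Rightarrow> real" and w :: "'t \<Rightarrow> 'a" and s :: "'t \<Rightarrow> real"
    and m J :: real
  assumes n: "is_norm nrm" and P: "prob_space P" and sets: "sets P = sets borel" and A: "A \<in> sets borel"
    and \<alpha>: "0 < \<alpha>" "\<alpha> < 1" and T: "finite T" "T \<noteq> {}" and w: "\<And>t. t \<in> T \<Longrightarrow> dual_norm nrm (w t) \<le> 1"
    and i1: "integrable P (\<lambda>z. nrm z * indicator A z)"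
    and i2: "integrable P (\<lambda>z. (nrm z * indicator A z)\<^sup>2)" and m: "(\<integral>z. (nrm z * indicator A z)\<^sup>2 \<partial>P) \<le> m"
    and J: "(\<integral>\<^sup>+t. indicator {0<..} t * ennreal (sqrt (measure P {z \<in> space P. t < nrm z * indicator A z})) \<partial>lborel) \<le> ennreal J"
      "0 \<le> J"
  defines "f \<equiv> \<lambda>t z. (check_loss \<alpha> (w t \<bullet> z - s t) - check_loss \<alpha> (- s t)) * indicator A z"
  shows "(\<integral>x. (MAX t\<in>T. \<Sum>i<N. integral\<^sup>L P (f t) - f t (x i)) \<partial>sample_measure N P)
    \<le> 8 * max \<alpha> (1 - \<alpha>) * sqrt N * (sqrt (DIM('a) * m) + J)"
proof -
  let ?L = "max \<alpha> (1 - \<alpha>)" let ?Q = "signed P" let ?S = "sample_measure N (signed P)"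
  have L: "?L > 0" using \<alpha> by simp
  interpret P: prob_space P by fact
  have Q: "prob_space ?Q" using P by (rule prob_space_signed)
  interpret S: prob_space ?S using Q by (rule prob_space_sample_measure)
  define a where "a z = nrm z * indicator A z" for z
  define u where "u v z = (v \<bullet> z) * indicator A z" for v z :: 'a
  define c where "c t z = clip (a z) (s t)" for t z
  have mP: "g \<in> borel_measurable P \<longleftrightarrow> g \<in> borel_measurable borel" for g :: "'a \<Rightarrow> real"
    using measurable_cong_sets[OF sets refl, of "borel :: real measure"] by simp
  note [measurable] = borel_measurable_is_norm[OF n] A
  have am [measurable]: "a \<in> borel_measurable borel" unfolding a_def[abs_def] by measurable
  have um [measurable]: "u v \<in> borel_measurable borel" for v unfolding u_def[abs_def] by measurable
  have cm [measurable]: "c t \<in> borel_measurable borel" for t unfolding c_def[abs_def] clip_def by measurable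
  have a0: "0 \<le> a z" for z by (simp add: a_def is_norm_nonneg[OF n])
  have ua: "\<bar>u v z\<bar> \<le> a z" if "dual_norm nrm v \<le> 1" for v z
  proof -
    have "\<bar>v \<bullet> z\<bar> \<le> dual_norm nrm v * nrm z" by (rule abs_inner_le_dual_norm[OF n])
    also have "\<dots> \<le> 1 * nrm z" using that is_norm_nonneg[OF n] by (rule mult_right_mono)
    finally show ?thesis by (simp add: u_def a_def indicator_def)
  qed
  have ca: "\<bar>c t z\<bar> \<le> a z" for t z using a0[of z] by (auto simp: c_def clip_def)
  have ia: "integrable P a" using i1 by (simp add: a_def[abs_def])
  have dom: "integrable P g" if "g \<in> borel_measurable borel" "\<And>z. \<bar>g z\<bar> \<le> K * a z" for g K
  proof (rule Bochner_Integration.integrable_bound)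
    show "integrable P (\<lambda>z. K * a z)" using ia by simp
    show "AE z in P. norm (g z) \<le> norm (K * a z)" using that(2) by (intro AE_I2) (force intro: order_trans[OF _ abs_ge_self])
  qed (use that(1) mP in simp)
  have iu: "integrable P (u v)" if "dual_norm nrm v \<le> 1" for v using ua[OF that] by (intro dom[of _ 1]) auto
  have ic: "integrable P (c t)" for t using ca by (intro dom[of _ 1]) auto
  \<comment> \<open>clipping leaves \<open>f = f1 + f2\<close> with one real argument each\<close>
  define f1 where "f1 t z = check_loss \<alpha> (u (w t) z - c t z)" for t z
  define f2 where "f2 t z = - check_loss \<alpha> (- c t z)" for t z
  have l0: "check_loss \<alpha> 0 = 0" by (simp add: check_loss_def)
  have labs: "\<bar>check_loss \<alpha> x\<bar> \<le> ?L * \<bar>x\<bar>" for x using check_loss_diff_le[OF \<alpha>, of x 0] by (simp add: l0)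
  have f12: "f t z = f1 t z + f2 t z" if "t \<in> T" for t z
  proof (cases "z \<in> A")
    case True
    then show ?thesis
      using check_loss_clip[OF \<alpha> ua[OF w[OF that], of z], of "s t"] by (simp add: f_def f1_def f2_def c_def u_def)
  next
    case False
    then show ?thesis by (simp add: f_def f1_def f2_def c_def u_def a_def clip_def l0)
  qed
  have ft: "f t = (\<lambda>z. f1 t z + f2 t z)" if "t \<in> T" for t using f12[OF that] by auto
  have if1: "integrable P (f1 t)" if "t \<in> T" for t
  proof (rule dom[of _ "?L * 2"])
    show "f1 t \<in> borel_measurable borel" unfolding f1_def[abs_def] by measurable
    fix z
    have "\<bar>f1 t z\<bar> \<le> ?L * \<bar>u (w t) z - c t z\<bar>" unfolding f1_def by (rule labs)
    also have "\<dots> \<le> ?L * (2 * a z)"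
      using ua[OF w[OF that], of z] ca[of t z] L by (intro mult_left_mono) auto
    finally show "\<bar>f1 t z\<bar> \<le> ?L * 2 * a z" by simp
  qed
  have if2: "integrable P (f2 t)" for t
  proof (rule dom[of _ "?L"])
    show "f2 t \<in> borel_measurable borel" unfolding f2_def[abs_def] by measurable
    fix z
    have "\<bar>f2 t z\<bar> \<le> ?L * \<bar>c t z\<bar>" unfolding f2_def using labs[of "- c t z"] by simp
    also have "\<dots> \<le> ?L * a z" using ca[of t z] L by (intro mult_left_mono) auto
    finally show "\<bar>f2 t z\<bar> \<le> ?L * a z" .
  qed
  obtain S where S: "finite S" "S \<noteq> {}" "S \<subseteq> {w. dual_norm nrm w \<le> 1}" "card S \<le> 5 ^ DIM('a)"
    and net: "\<And>w. dual_norm nrm w \<le> 1 \<Longrightarrow> \<exists>s\<in>S. dual_norm nrm (w - s) \<le> 1/2"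
    using half_net_of_unit_ball[OF is_norm_dual_norm[OF n]] by metis
  define M where "M x = (MAX v\<in>S. \<Sum>i<N. sgn_of (snd (x i)) * u v (fst (x i)))" for x :: "nat \<Rightarrow> 'a \<times> bool"
  define G where "G x = (MAX t\<in>T. \<bar>\<Sum>i<N. sgn_of (snd (x i)) * min \<bar>s t\<bar> (a (fst (x i)))\<bar>)" for x :: "nat \<Rightarrow> 'a \<times> bool"
  have isig: "integrable ?Q (\<lambda>q. k * (sgn_of (snd q) * g (fst q)))" if "integrable P g" for g k
    using that by (intro integral_signed(1)[OF P, of "\<lambda>z b. k * (sgn_of b * g z)"]) auto
  have iM: "integrable ?S M"
    unfolding M_def using isig[of _ 1] iu S by (intro integrable_MAX_sum_sample[OF Q]) auto
  have iG: "integrable ?S G"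
  proof -
    have "integrable P (\<lambda>z. min \<bar>s t\<bar> (a z))" for t
      using a0 by (intro dom[of _ 1]) auto
    from isig[OF this, of 1]
    have "integrable ?S (\<lambda>x. \<Sum>i<N. sgn_of (snd (x i)) * min \<bar>s t\<bar> (a (fst (x i))))" for t
      by (intro Bochner_Integration.integrable_sum
          integrable_sample_component[OF Q, where f="\<lambda>q. sgn_of (snd q) * min \<bar>s t\<bar> (a (fst q))"]) auto
    then show ?thesis unfolding G_def[abs_def] using T by (intro integrable_MAX integrable_abs) auto
  qed
  have EM: "integral\<^sup>L ?S M \<le> 2 * sqrt N * sqrt (DIM('a) * m)"
  proof -
    have "0 \<le> (\<integral>z. (nrm z * indicator A z)\<^sup>2 \<partial>P)" by simp
    then have m0: "0 \<le> m" using m by linarith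
    have "integral\<^sup>L ?S M \<le> sqrt (2 * ln (card S) * N * m)"
      unfolding M_def
    proof (rule rademacher_max_le[OF P S(1,2), where b = "\<lambda>z. (a z)\<^sup>2"])
      show "integrable P (\<lambda>z. (a z)\<^sup>2)" "(\<integral>z. (a z)\<^sup>2 \<partial>P) \<le> m" using i2 m by (simp_all add: a_def)
      show "u v \<in> borel_measurable P" for v using mP um by simp
      show "(u v z)\<^sup>2 \<le> (a z)\<^sup>2" if "v \<in> S" for v z
        using ua[of v z] that S(3) a0[of z] by (intro abs_le_square_iff[THEN iffD1]) auto
    qed
    also have "\<dots> \<le> sqrt (4 * (DIM('a) * N * m))"
    proof -
      have cS: "1 \<le> card S" using S by (simp add: Suc_le_eq card_gt_0_iff)
      have "ln (real (card S)) \<le> ln (real (5 ^ DIM('a)))" using S(4) cS by (subst ln_le_cancel_iff) linarith+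
      also have "\<dots> = DIM('a) * ln 5" by (simp add: ln_realpow)
      also have "ln (5::real) \<le> 2"
      proof -
        have "(5::real) \<le> (1 + 1 + 1/2)\<^sup>2" by (simp add: power2_eq_square)
        also have "\<dots> \<le> (exp 1)\<^sup>2" using exp_lower_Taylor_quadratic[of 1] by (intro power_mono) auto
        also have "\<dots> = exp 2" by (simp add: exp_of_nat_mult[symmetric])
        finally have "(5::real) \<le> exp 2" .
        then show ?thesis by (metis exp_gt_zero ln_exp ln_mono zero_less_numeral)
      qed
      finally have "ln (real (card S)) \<le> DIM('a) * 2" by (simp add: mult_left_mono)
      then have "(2 * ln (card S)) * (N * m) \<le> (2 * (DIM('a) * 2)) * (N * m)"
        using m0 by (intro mult_right_mono) auto
      then show ?thesis by (simp add: algebra_simps)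
    qed
    also have "\<dots> = 2 * sqrt N * sqrt (DIM('a) * m)" by (simp add: real_sqrt_mult)
    finally show ?thesis .
  qed
  have EG: "integral\<^sup>L ?S G \<le> 2 * sqrt N * J"
    unfolding G_def
    by (rule rademacher_min_le[OF P T]) (use a0 mP am J in \<open>auto simp: a_def[abs_def]\<close>)
  have lin: "(\<Sum>i<N. sgn_of (snd (x i)) * u v (fst (x i))) \<le> 2 * M x" if "dual_norm nrm v \<le> 1" for v x
  proof -
    define y where "y = (\<Sum>i<N. (sgn_of (snd (x i)) * indicator A (fst (x i))) *\<^sub>R fst (x i))"
    have y: "(\<Sum>i<N. sgn_of (snd (x i)) * u v (fst (x i))) = v \<bullet> y" for v
      by (simp add: y_def inner_sum_right u_def algebra_simps)
    show ?thesis unfolding M_def y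
      by (rule half_net_doubles[OF is_norm_dual_norm[OF n] S(1,2) net that])
  qed
  have clp: "\<bar>\<Sum>i<N. sgn_of (snd (x i)) * c t (fst (x i))\<bar> \<le> G x" if t: "t \<in> T" for t x
  proof -
    have "(\<Sum>i<N. sgn_of (snd (x i)) * c t (fst (x i)))
      = (if 0 \<le> s t then 1 else -1) * (\<Sum>i<N. sgn_of (snd (x i)) * min \<bar>s t\<bar> (a (fst (x i))))"
      unfolding c_def clip_eq[OF a0] sum_distrib_left by (intro sum.cong) (auto simp: algebra_simps)
    then have "\<bar>\<Sum>i<N. sgn_of (snd (x i)) * c t (fst (x i))\<bar> = \<bar>\<Sum>i<N. sgn_of (snd (x i)) * min \<bar>s t\<bar> (a (fst (x i)))\<bar>"
      by (simp add: abs_mult)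
    also have "\<dots> \<le> G x" unfolding G_def using T t by (intro Max_ge) auto
    finally show ?thesis .
  qed
  have E1: "(\<integral>x. (MAX t\<in>T. \<Sum>i<N. integral\<^sup>L P (f1 t) - f1 t (x i)) \<partial>sample_measure N P)
    \<le> 2 * ?L * (2 * integral\<^sup>L ?S M + integral\<^sup>L ?S G)"
  proof -
    have "(\<integral>x. (MAX t\<in>T. \<Sum>i<N. integral\<^sup>L P (f1 t) - f1 t (x i)) \<partial>sample_measure N P)
      \<le> (\<integral>x. (MAX t\<in>T. \<Sum>i<N. 2 * ?L * (sgn_of (snd (x i)) * (u (w t) (fst (x i)) - c t (fst (x i))))) \<partial>?S)"
    proof (rule expected_sup_le_rademacher[OF P T if1])
      show "integrable P (\<lambda>z. u (w t) z - c t z)" if "t \<in> T" for t using iu[OF w[OF that]] ic by simp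
      show "\<bar>f1 t z - f1 t' z\<bar> \<le> ?L * \<bar>(u (w t) z - c t z) - (u (w t') z - c t' z)\<bar>" for t t' z
        unfolding f1_def by (rule check_loss_diff_le[OF \<alpha>])
    qed
    also have "\<dots> \<le> (\<integral>x. 2 * ?L * (2 * M x + G x) \<partial>?S)"
    proof (rule integral_mono)
      show "integrable ?S (\<lambda>x. 2 * ?L * (2 * M x + G x))" using iM iG by simp
      show "integrable ?S (\<lambda>x. MAX t\<in>T. \<Sum>i<N. 2 * ?L * (sgn_of (snd (x i)) * (u (w t) (fst (x i)) - c t (fst (x i)))))"
        by (rule integrable_MAX_sum_sample[OF Q T, where g = "\<lambda>t q. 2 * ?L * (sgn_of (snd q) * (u (w t) (fst q) - c t (fst q)))"])
          (intro isig Bochner_Integration.integrable_diff iu ic w)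
      fix x
      have "(\<Sum>i<N. 2 * ?L * (sgn_of (snd (x i)) * (u (w t) (fst (x i)) - c t (fst (x i))))) \<le> 2 * ?L * (2 * M x + G x)"
        if t: "t \<in> T" for t
      proof -
        have "(\<Sum>i<N. sgn_of (snd (x i)) * (u (w t) (fst (x i)) - c t (fst (x i))))
          = (\<Sum>i<N. sgn_of (snd (x i)) * u (w t) (fst (x i))) - (\<Sum>i<N. sgn_of (snd (x i)) * c t (fst (x i)))"
          by (simp add: right_diff_distrib sum_subtractf)
        also have "\<dots> \<le> 2 * M x + G x" using lin[OF w[OF t], of x] clp[OF t, of x] by linarith
        finally have "2 * ?L * (\<Sum>i<N. sgn_of (snd (x i)) * (u (w t) (fst (x i)) - c t (fst (x i))))
          \<le> 2 * ?L * (2 * M x + G x)" using L by (intro mult_left_mono) auto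
        then show ?thesis by (simp only: sum_distrib_left)
      qed
      then show "(MAX t\<in>T. \<Sum>i<N. 2 * ?L * (sgn_of (snd (x i)) * (u (w t) (fst (x i)) - c t (fst (x i)))))
        \<le> 2 * ?L * (2 * M x + G x)"
        using T by (intro Max.boundedI) auto
    qed
    also have "\<dots> = 2 * ?L * (2 * integral\<^sup>L ?S M + integral\<^sup>L ?S G)" using iM iG by simp
    finally show ?thesis .
  qed
  have E2: "(\<integral>x. (MAX t\<in>T. \<Sum>i<N. integral\<^sup>L P (f2 t) - f2 t (x i)) \<partial>sample_measure N P)
    \<le> 2 * ?L * integral\<^sup>L ?S G"
  proof -
    have "(\<integral>x. (MAX t\<in>T. \<Sum>i<N. integral\<^sup>L P (f2 t) - f2 t (x i)) \<partial>sample_measure N P)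
      \<le> (\<integral>x. (MAX t\<in>T. \<Sum>i<N. 2 * ?L * (sgn_of (snd (x i)) * c t (fst (x i)))) \<partial>?S)"
    proof (rule expected_sup_le_rademacher[OF P T if2 ic])
      show "\<bar>f2 t z - f2 t' z\<bar> \<le> ?L * \<bar>c t z - c t' z\<bar>" for t t' z
        using check_loss_diff_le[OF \<alpha>, of "- c t z" "- c t' z"] by (simp add: f2_def abs_minus_commute)
    qed
    also have "\<dots> \<le> (\<integral>x. 2 * ?L * G x \<partial>?S)"
    proof (rule integral_mono)
      show "integrable ?S (\<lambda>x. 2 * ?L * G x)" using iG by simp
      show "integrable ?S (\<lambda>x. MAX t\<in>T. \<Sum>i<N. 2 * ?L * (sgn_of (snd (x i)) * c t (fst (x i))))"
        by (rule integrable_MAX_sum_sample[OF Q T, where g = "\<lambda>t q. 2 * ?L * (sgn_of (snd q) * c t (fst q))"])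
          (intro isig ic)
      fix x
      have "(\<Sum>i<N. 2 * ?L * (sgn_of (snd (x i)) * c t (fst (x i)))) \<le> 2 * ?L * G x" if t: "t \<in> T" for t
      proof -
        have "2 * ?L * (\<Sum>i<N. sgn_of (snd (x i)) * c t (fst (x i))) \<le> 2 * ?L * G x"
          using L clp[OF t, of x] by (intro mult_left_mono) auto
        then show ?thesis by (simp only: sum_distrib_left)
      qed
      then show "(MAX t\<in>T. \<Sum>i<N. 2 * ?L * (sgn_of (snd (x i)) * c t (fst (x i)))) \<le> 2 * ?L * G x"
        using T by (intro Max.boundedI) auto
    qed
    also have "\<dots> = 2 * ?L * integral\<^sup>L ?S G" using iG by simp
    finally show ?thesis .
  qed
  define Z where "Z g x = (MAX t\<in>T. \<Sum>i<N. integral\<^sup>L P (g t) - g t (x i))" for g :: "'t \<Rightarrow> 'a \<Rightarrow> real" and x :: "nat \<Rightarrow> 'a"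
  have iZ: "integrable (sample_measure N P) (Z g)" if "\<And>t. t \<in> T \<Longrightarrow> integrable P (g t)" for g
    unfolding Z_def using that by (intro integrable_MAX_sum_sample[OF P T, where g = "\<lambda>t z. integral\<^sup>L P (g t) - g t z"]) auto
  have "Z f x \<le> Z f1 x + Z f2 x" for x
  proof -
    have "(\<Sum>i<N. integral\<^sup>L P (f t) - f t (x i)) \<le> Z f1 x + Z f2 x" if t: "t \<in> T" for t
    proof -
      have "integral\<^sup>L P (f t) = integral\<^sup>L P (f1 t) + integral\<^sup>L P (f2 t)"
        using if1[OF t] if2 by (simp add: ft[OF t])
      then have "(\<Sum>i<N. integral\<^sup>L P (f t) - f t (x i))
        = (\<Sum>i<N. integral\<^sup>L P (f1 t) - f1 t (x i)) + (\<Sum>i<N. integral\<^sup>L P (f2 t) - f2 t (x i))"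
        by (simp add: f12[OF t] sum.distrib[symmetric] algebra_simps)
      also have "\<dots> \<le> Z f1 x + Z f2 x"
        unfolding Z_def using T t by (intro add_mono Max_ge) auto
      finally show ?thesis .
    qed
    then show ?thesis unfolding Z_def[of f] using T by (intro Max.boundedI) auto
  qed
  moreover have "integrable P (f t)" if t: "t \<in> T" for t
    using if1[OF t] if2 by (simp add: ft[OF t])
  ultimately have "integral\<^sup>L (sample_measure N P) (Z f) \<le> (\<integral>x. Z f1 x + Z f2 x \<partial>sample_measure N P)"
    using iZ if1 if2 by (intro integral_mono) auto
  also have "\<dots> = integral\<^sup>L (sample_measure N P) (Z f1) + integral\<^sup>L (sample_measure N P) (Z f2)"
    using iZ if1 if2 by simp
  also have "\<dots> \<le> 2 * ?L * (2 * integral\<^sup>L ?S M + integral\<^sup>L ?S G) + 2 * ?L * integral\<^sup>L ?S G"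
    using E1 E2 by (intro add_mono) (simp_all add: Z_def[abs_def])
  also have "\<dots> = 4 * ?L * (integral\<^sup>L ?S M + integral\<^sup>L ?S G)" by (simp add: algebra_simps)
  also have "\<dots> \<le> 4 * ?L * (2 * sqrt N * sqrt (DIM('a) * m) + 2 * sqrt N * J)"
    using EM EG L by (intro mult_left_mono add_mono) auto
  also have "\<dots> = 8 * ?L * sqrt N * (sqrt (DIM('a) * m) + J)" by (simp add: algebra_simps)
  finally show ?thesis by (simp add: Z_def[abs_def])
qed

section \<open>Uniform deviation with high probability\<close>

lemma Max_diff_le:
  fixes f g :: "'t \<Rightarrow> real"
  assumes T: "finite T" "T \<noteq> {}" and le: "\<And>t. t \<in> T \<Longrightarrow> \<bar>f t - g t\<bar> \<le> c"
  shows "\<bar>(MAX t\<in>T. f t) - (MAX t\<in>T. g t)\<bar> \<le> c"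
proof -
  have *: "(MAX t\<in>T. f t) \<le> (MAX t\<in>T. g t) + c" if "\<And>t. t \<in> T \<Longrightarrow> f t \<le> g t + c" for f g :: "'t \<Rightarrow> real"
  proof -
    have "f t \<le> (MAX t\<in>T. g t) + c" if "t \<in> T" for t
    proof -
      have "g t \<le> (MAX t\<in>T. g t)" using T that by (intro Max_ge) auto
      then show ?thesis using \<open>\<And>t. t \<in> T \<Longrightarrow> f t \<le> g t + c\<close>[OF that] by linarith
    qed
    then show ?thesis using T by (intro Max.boundedI) auto
  qed
  have "f t \<le> g t + c" "g t \<le> f t + c" if "t \<in> T" for t using le[OF that] by linarith+
  then show ?thesis using *[of f g] *[of g f] by (simp add: abs_le_iff)
qed

lemma sum_update:
  fixes h :: "'a \<Rightarrow> real" and i N :: nat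
  assumes "i < N"
  shows "(\<Sum>j<N. h (x j)) - (\<Sum>j<N. h ((x(i := y)) j)) = h (x i) - h y"
proof -
  have "(\<Sum>j<N. h ((x(i := y)) j)) = h y + (\<Sum>j\<in>{..<N} - {i}. h (x j))"
    using assms by (subst sum.remove[of "{..<N}" i]) (auto intro!: sum.cong)
  moreover have "(\<Sum>j<N. h (x j)) = h (x i) + (\<Sum>j\<in>{..<N} - {i}. h (x j))"
    using assms by (subst sum.remove[of "{..<N}" i]) auto
  ultimately show ?thesis by simp
qed

text \<open>
The second bound trades the exponential decay in \<open>x = r - 2\<close> for the factor \<open>1 / (r - 2)\<close>.
\<close>

lemma two_powr_bounds:
  fixes x :: real
  assumes x: "x > 0"
  shows "2 powr (- x / 2) \<le> 1" "2 powr (- x / 2) * x \<le> 3"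
proof -
  have "2 powr (- x / 2) \<le> 2 powr (0::real)" using x by (intro powr_mono) auto
  then show "2 powr (- x / 2) \<le> (1::real)" by simp
  have "ln (2::real) \<ge> 2/3"
    using ln2_ge_two_thirds by simp
  then have "x / 3 \<le> ln 2 * (x / 2)" using x mult_right_mono[of "2/3" "ln 2" "x / 2"] by simp
  also have "\<dots> \<le> exp (ln 2 * (x / 2))" using exp_ge_add_one_self[of "ln 2 * (x / 2)"] by linarith
  also have "\<dots> = 2 powr (x / 2)" by (simp add: powr_def mult.commute)
  finally have "x \<le> 3 * 2 powr (x / 2)" by simp
  then have "2 powr (- x / 2) * x \<le> 2 powr (- x / 2) * (3 * 2 powr (x / 2))" by (intro mult_left_mono) auto
  also have "\<dots> = 3" by (simp add: powr_minus field_simps)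
  finally show "2 powr (- x / 2) * x \<le> 3" .
qed

lemma nn_integral_truncated_powr:
  fixes r :: real
  assumes r: "2 < r"
  shows "(\<integral>\<^sup>+t. indicator {0<..} t * ennreal (max t 2 powr (- r / 2)) \<partial>lborel)
    \<le> ennreal (2 powr (- (r - 2) / 2) * (1 + 2 / (r - 2)))"
proof -
  let ?e = "- r / 2"
  \<comment> \<open>the power is integrable at infinity because \<open>r / 2 > 1\<close>\<close>
  have hi: "((\<lambda>t. t powr ?e) has_integral - (2 powr (?e + 1)) / (?e + 1)) {2..}"
    using r by (intro has_integral_powr_to_inf) auto
  have "(\<integral>\<^sup>+t. indicator {0<..} t * ennreal (max t 2 powr ?e) \<partial>lborel)
    \<le> (\<integral>\<^sup>+t. ennreal (2 powr ?e) * indicator {0..2::real} t + indicator {2..} t * ennreal (t powr ?e) \<partial>lborel)"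
    by (intro nn_integral_mono) (auto simp: indicator_def max_def)
  also have "\<dots> = (\<integral>\<^sup>+t. ennreal (2 powr ?e) * indicator {0..2::real} t \<partial>lborel)
      + (\<integral>\<^sup>+t. indicator {2..} t * ennreal (t powr ?e) \<partial>lborel)"
    by (intro nn_integral_add) auto
  also have "(\<integral>\<^sup>+t. ennreal (2 powr ?e) * indicator {0..2::real} t \<partial>lborel) = ennreal (2 powr ?e * 2)"
    by (subst nn_integral_cmult_indicator) (auto simp: ennreal_mult)
  also have "(\<integral>\<^sup>+t. indicator {2..} t * ennreal (t powr ?e) \<partial>lborel) = ennreal (- (2 powr (?e + 1)) / (?e + 1))"
  proof -
    have "(\<integral>\<^sup>+t. indicator {2..} t * ennreal (t powr ?e) \<partial>lborel) = ennreal (- (2 powr (?e + 1)) / (?e + 1))"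
      using nn_integral_has_integral_lebesgue[OF _ hi]
      by (simp add: nn_integral_completion ennreal_mult'' ennreal_indicator)
    then show ?thesis .
  qed
  also have "ennreal (2 powr ?e * 2) + ennreal (- (2 powr (?e + 1)) / (?e + 1))
    = ennreal (2 powr ?e * 2 + - (2 powr (?e + 1)) / (?e + 1))"
    using r by (intro ennreal_plus[symmetric]) (auto intro!: divide_nonneg_neg)
  also have "2 powr ?e * 2 + - (2 powr (?e + 1)) / (?e + 1) = 2 powr (- (r - 2) / 2) * (1 + 2 / (r - 2))"
  proof -
    have e: "?e + 1 = - (r - 2) / 2" by (simp add: field_simps)
    have "2 powr ?e * 2 = 2 powr (?e + 1)" by (subst powr_add) simp
    then have p: "2 powr ?e * 2 = 2 powr (- (r - 2) / 2)" unfolding e .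
    have k: "- k / (- (r - 2) / 2) = k * (2 / (r - 2))" for k using r by (simp add: field_simps)
    show ?thesis unfolding p e by (simp only: k distrib_left mult_1_right)
  qed
  finally show ?thesis .
qed

text \<open>
Up to the common factor \<open>sqrt \<Gamma>\<close>, and after multiplication by \<open>r - 2\<close>, the tail part on the left is at most
\<open>43 * sqrt (3 / \<eta>) * sqrt n\<close>, whereas the one on the right is at least
\<open>32 * sqrt 2 * sqrt (3 / \<eta>) * sqrt n\<close>.
\<close>

lemma deviation_constants:
  fixes n :: nat and \<Gamma> \<eta> r :: real
  assumes n: "1 \<le> n" and r: "2 < r" and \<Gamma>: "0 \<le> \<Gamma>" and \<eta>: "0 < \<eta>" "\<eta> < 1"
  defines "\<kappa> \<equiv> 2 powr (- (r - 2) / 2)"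
  shows "16 * (sqrt n + 1) + 8 * (sqrt \<Gamma> * \<kappa> * (sqrt n + (1 + 2 / (r - 2)))) + sqrt \<Gamma> * \<kappa> * sqrt (3 / \<eta>)
    \<le> 360 * sqrt (n + 1) + sqrt (3 * \<Gamma> / \<eta>) * (32 / (r - 2)) * sqrt (ln (24 / \<eta>) + 2 * (n + 1))"
proof -
  define x where "x = r - 2"
  have x: "x > 0" using r by (simp add: x_def)
  define q where "q = sqrt (3 / \<eta>)"
  define y where "y = sqrt n"
  have k: "0 \<le> \<kappa>" "\<kappa> \<le> 1" "\<kappa> * x \<le> 3" using two_powr_bounds[OF x] by (simp_all add: \<kappa>_def x_def)
  have y: "1 \<le> y" using n by (simp add: y_def)
  have q: "8 / 5 \<le> q"
  proof -
    have "(8/5)\<^sup>2 \<le> 3 / \<eta>" using \<eta> by (simp add: power2_eq_square field_simps)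
    then show ?thesis unfolding q_def by (rule real_le_rsqrt)
  qed
  have A: "16 * (sqrt n + 1) \<le> 360 * sqrt (n + 1)"
  proof -
    have "sqrt n \<le> sqrt (n + 1)" "1 \<le> sqrt (n + 1)" by simp_all
    moreover have "16 * (a + 1) \<le> 360 * b" if "a \<le> b" "1 \<le> b" for a b :: real
      using that by (simp add: field_simps)
    ultimately show ?thesis by blast
  qed
  have B: "8 * (\<kappa> * (y + (1 + 2 / x))) + \<kappa> * q \<le> q * (32 / x) * sqrt (ln (24 / \<eta>) + 2 * (n + 1))"
  proof -
    have qy: "q * 1 \<le> q * y" using y q by (intro mult_left_mono) auto
    have "x * (8 * (\<kappa> * (y + (1 + 2 / x))) + \<kappa> * q) = 8 * (\<kappa> * x) * (y + 1) + 16 * \<kappa> + (\<kappa> * x) * q"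
      using x by (simp add: field_simps)
    also have "8 * (\<kappa> * x) * (y + 1) + 16 * \<kappa> + (\<kappa> * x) * q \<le> 8 * 3 * (y + 1) + 16 * 1 + 3 * q"
      using k y q by (intro add_mono mult_right_mono mult_left_mono) auto
    also have "\<dots> \<le> 64 * y + 3 * (q * y)"
      using qy y by (simp add: algebra_simps)
    also have "\<dots> \<le> 40 * (q * y) + 3 * (q * y)"
      using mult_right_mono[OF q, of y] y by simp
    also have "\<dots> = 43 * (q * y)" by simp
    also have "\<dots> \<le> 32 * (q * (7/5 * y))"
      using qy q by simp
    also have "\<dots> \<le> 32 * (q * sqrt (ln (24 / \<eta>) + 2 * (n + 1)))"
    proof -
      have "0 \<le> ln (24 / \<eta>)" using \<eta> by (intro ln_ge_zero) (simp add: field_simps)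
      then have "(7/5 * y)\<^sup>2 \<le> ln (24 / \<eta>) + 2 * (n + 1)" by (simp add: y_def power_mult_distrib power2_eq_square)
      then have "7/5 * y \<le> sqrt (ln (24 / \<eta>) + 2 * (n + 1))" by (rule real_le_rsqrt)
      then show ?thesis using q by (intro mult_left_mono) auto
    qed
    finally show ?thesis using x by (simp add: field_simps)
  qed
  have "sqrt \<Gamma> * (8 * (\<kappa> * (y + (1 + 2 / x))) + \<kappa> * q) \<le> sqrt \<Gamma> * (q * (32 / x) * sqrt (ln (24 / \<eta>) + 2 * (n + 1)))"
    by (intro mult_left_mono B) (simp add: \<Gamma>)
  moreover have "sqrt (3 * \<Gamma> / \<eta>) = sqrt \<Gamma> * q" by (simp add: q_def real_sqrt_mult[symmetric] mult.commute)
  ultimately show ?thesis using A unfolding y_def[symmetric] q_def[symmetric] x_def[symmetric]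
    by (simp add: algebra_simps)
qed

text \<open>
The quantities \<open>m\<close> and \<open>J\<close> of the preceding section for the data of norm at most 2 and for the rest.
Truncation at 2, rather than at 1, leaves the decay \<open>2 powr (- (r - 2) / 2)\<close> in the second case,
while the oscillation it permits in the first still fits the subgaussian term
\<open>2 * sqrt (2 * ln (3 / \<eta>))\<close> exactly.
\<close>

lemma truncated_moments:
  fixes nrm :: "'a::euclidean_space \<Rightarrow> real" and r :: real
  assumes n: "is_norm nrm" and P: "prob_space P" and sets: "sets P = sets borel" and r: "2 < r"
    and ir: "integrable P (\<lambda>z. nrm z powr r)"
  defines "\<Gamma> \<equiv> \<integral>z. nrm z powr r \<partial>P" and "A \<equiv> {z. nrm z \<le> 2}" and "\<kappa> \<equiv> 2 powr (- (r - 2) / 2)"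
  shows "integrable P nrm" "integrable P (\<lambda>z. (nrm z)\<^sup>2)"
    and "A \<in> sets borel"
    and "(\<integral>z. (nrm z * indicator A z)\<^sup>2 \<partial>P) \<le> 4"
    and "(\<integral>z. (nrm z * indicator (- A) z)\<^sup>2 \<partial>P) \<le> \<Gamma> * \<kappa>\<^sup>2"
    and "(\<integral>\<^sup>+t. indicator {0<..} t * ennreal (sqrt (measure P {z \<in> space P. t < nrm z * indicator A z})) \<partial>lborel)
      \<le> ennreal 2"
    and "(\<integral>\<^sup>+t. indicator {0<..} t * ennreal (sqrt (measure P {z \<in> space P. t < nrm z * indicator (- A) z})) \<partial>lborel)
      \<le> ennreal (sqrt \<Gamma> * \<kappa> * (1 + 2 / (r - 2)))"
proof -
  interpret P: prob_space P by fact
  have sp: "space P = UNIV" using sets_eq_imp_space_eq[OF sets] by simp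
  have nm [measurable]: "nrm \<in> borel_measurable P"
    using borel_measurable_is_norm[OF n] measurable_cong_sets[OF sets refl, of "borel :: real measure"] by simp
  have n0: "0 \<le> nrm z" for z by (rule is_norm_nonneg[OF n])
  have \<Gamma>0: "0 \<le> \<Gamma>" by (simp add: \<Gamma>_def)
  show A: "A \<in> sets borel"
    unfolding A_def using borel_measurable_is_norm[OF n] by measurable
  have [measurable]: "A \<in> sets P" using A sets by simp
  have sq_le: "(nrm z)\<^sup>2 \<le> 1 + nrm z powr r" for z
  proof (cases "nrm z \<le> 1")
    case True
    then have "(nrm z)\<^sup>2 \<le> 1" using n0[of z] by (simp add: power_le_one)
    then show ?thesis using powr_ge_zero[of "nrm z" r] by linarith
  next
    case False
    then have "nrm z powr 2 \<le> nrm z powr r" using r by (intro powr_mono) auto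
    then show ?thesis using False by (simp add: powr_numeral)
  qed
  show i2: "integrable P (\<lambda>z. (nrm z)\<^sup>2)"
  proof (rule Bochner_Integration.integrable_bound)
    show "integrable P (\<lambda>z. 1 + nrm z powr r)" using ir by simp
    show "AE z in P. norm ((nrm z)\<^sup>2) \<le> norm (1 + nrm z powr r)" using sq_le by (auto intro!: AE_I2)
  qed measurable
  show "integrable P nrm" by (rule P.square_integrable_imp_integrable[OF nm i2])
  have "(\<integral>z. (nrm z * indicator A z)\<^sup>2 \<partial>P) \<le> (\<integral>z. 4 \<partial>P)"
  proof (rule integral_mono)
    have le: "(nrm z * indicator A z)\<^sup>2 \<le> 4" for z
      using n0[of z] power_mono[of "nrm z" 2 2] by (auto simp: A_def indicator_def)
    then show "(nrm z * indicator A z)\<^sup>2 \<le> 4" for z .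
    show "integrable P (\<lambda>z. (nrm z * indicator A z)\<^sup>2)"
      by (rule P.integrable_const_bound[of _ 4]) (use le in auto)
  qed simp
  then show "(\<integral>z. (nrm z * indicator A z)\<^sup>2 \<partial>P) \<le> 4" by (simp add: P.prob_space)
  have ktwo: "\<kappa>\<^sup>2 = 2 powr (2 - r)"
    by (simp add: \<kappa>_def power2_eq_square powr_add[symmetric])
  have "(\<integral>z. (nrm z * indicator (- A) z)\<^sup>2 \<partial>P) \<le> (\<integral>z. nrm z powr r * \<kappa>\<^sup>2 \<partial>P)"
  proof (rule integral_mono)
    show le: "(nrm z * indicator (- A) z)\<^sup>2 \<le> nrm z powr r * \<kappa>\<^sup>2" for z
    proof (cases "z \<in> A")
      case False
      then have z: "2 < nrm z" by (simp add: A_def)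
      have "(nrm z)\<^sup>2 = nrm z powr r * nrm z powr (2 - r)"
        using z by (simp add: powr_add[symmetric] powr_numeral)
      also have "\<dots> \<le> nrm z powr r * 2 powr (2 - r)"
        using z r by (intro mult_left_mono powr_mono2') auto
      finally show ?thesis using False by (simp add: ktwo)
    qed simp
    show "integrable P (\<lambda>z. nrm z powr r * \<kappa>\<^sup>2)" using ir by simp
    then show "integrable P (\<lambda>z. (nrm z * indicator (- A) z)\<^sup>2)"
      by (rule Bochner_Integration.integrable_bound) (use le in \<open>auto intro!: AE_I2 simp: abs_mult\<close>)
  qed
  then show "(\<integral>z. (nrm z * indicator (- A) z)\<^sup>2 \<partial>P) \<le> \<Gamma> * \<kappa>\<^sup>2" by (simp add: \<Gamma>_def)
  have "(\<integral>\<^sup>+t. indicator {0<..} t * ennreal (sqrt (measure P {z \<in> space P. t < nrm z * indicator A z})) \<partial>lborel)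
    \<le> (\<integral>\<^sup>+t. indicator {0..2::real} t \<partial>lborel)"
  proof (rule nn_integral_mono)
    fix t :: real
    have "sqrt (measure P {z \<in> space P. t < nrm z * indicator A z}) \<le> 1" by simp
    moreover have empty: "{z \<in> space P. t < nrm z * indicator A z} = {}" if "t > 2"
      using that by (auto simp: A_def indicator_def not_less split: if_splits)
    ultimately show "indicator {0<..} t * ennreal (sqrt (measure P {z \<in> space P. t < nrm z * indicator A z}))
      \<le> indicator {0..2} t"
    proof (cases "t > 2")
      case True
      then show ?thesis
        by (simp only: empty[OF True] measure_empty real_sqrt_zero ennreal_0 mult_zero_right zero_le)
    next
      case False
      then show ?thesis by (auto simp: indicator_def)
    qed
  qed
  also have "\<dots> = ennreal 2" by simp
  finally show "(\<integral>\<^sup>+t. indicator {0<..} t * ennreal (sqrt (measure P {z \<in> space P. t < nrm z * indicator A z})) \<partial>lborel)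
      \<le> ennreal 2" .
  have tail: "sqrt (measure P {z \<in> space P. t < nrm z * indicator (- A) z}) \<le> sqrt \<Gamma> * max t 2 powr (- r / 2)"
    if t: "t > 0" for t
  proof -
    let ?M = "max t 2"
    have "measure P {z \<in> space P. t < nrm z * indicator (- A) z} \<le> measure P {z \<in> space P. ?M powr r \<le> nrm z powr r}"
    proof (rule P.finite_measure_mono)
      show "{z \<in> space P. t < nrm z * indicator (- A) z} \<subseteq> {z \<in> space P. ?M powr r \<le> nrm z powr r}"
        using t r by (auto simp: A_def indicator_def intro!: powr_mono2 split: if_splits)
      show "{z \<in> space P. ?M powr r \<le> nrm z powr r} \<in> P.events" by measurable
    qed
    also have "\<dots> \<le> \<Gamma> / ?M powr r"
      unfolding \<Gamma>_def using ir by (intro integral_Markov_inequality_measure[of _ _ "{}"]) auto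
    also have "\<dots> = \<Gamma> * (?M powr (- r / 2))\<^sup>2"
    proof -
      have "(?M powr (- r / 2))\<^sup>2 = ?M powr (- r / 2 + - r / 2)" by (simp only: power2_eq_square powr_add)
      also have "- r / 2 + - r / 2 = - r" by simp
      also have "?M powr - r = inverse (?M powr r)" by (rule powr_minus)
      finally show ?thesis by (simp only: divide_inverse)
    qed
    finally have "sqrt (measure P {z \<in> space P. t < nrm z * indicator (- A) z}) \<le> sqrt (\<Gamma> * (?M powr (- r / 2))\<^sup>2)"
      by simp
    then show ?thesis by (simp add: real_sqrt_mult)
  qed
  have "(\<integral>\<^sup>+t. indicator {0<..} t * ennreal (sqrt (measure P {z \<in> space P. t < nrm z * indicator (- A) z})) \<partial>lborel)
    \<le> (\<integral>\<^sup>+t. ennreal (sqrt \<Gamma>) * (indicator {0<..} t * ennreal (max t 2 powr (- r / 2))) \<partial>lborel)"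
  proof (rule nn_integral_mono)
    fix t :: real
    show "indicator {0<..} t * ennreal (sqrt (measure P {z \<in> space P. t < nrm z * indicator (- A) z}))
      \<le> ennreal (sqrt \<Gamma>) * (indicator {0<..} t * ennreal (max t 2 powr (- r / 2)))"
      using tail[of t] \<Gamma>0 by (auto simp: indicator_def ennreal_mult'[symmetric])
  qed
  also have "\<dots> = ennreal (sqrt \<Gamma>) * (\<integral>\<^sup>+t. indicator {0<..} t * ennreal (max t 2 powr (- r / 2)) \<partial>lborel)"
    by (rule nn_integral_cmult) measurable
  also have "\<dots> \<le> ennreal (sqrt \<Gamma>) * ennreal (\<kappa> * (1 + 2 / (r - 2)))"
    unfolding \<kappa>_def by (intro mult_left_mono nn_integral_truncated_powr r) simp
  also have "\<dots> = ennreal (sqrt \<Gamma> * \<kappa> * (1 + 2 / (r - 2)))"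
    using \<Gamma>0 r by (subst ennreal_mult'[symmetric]) (auto simp: mult.assoc)
  finally show "(\<integral>\<^sup>+t. indicator {0<..} t * ennreal (sqrt (measure P {z \<in> space P. t < nrm z * indicator (- A) z})) \<partial>lborel)
      \<le> ennreal (sqrt \<Gamma> * \<kappa> * (1 + 2 / (r - 2)))" .
qed

text \<open>
The two parts of the data are treated on separate events of probability at least \<open>1 - \<eta> / 3\<close> each:
bounded differences near the origin, the variance bound far out. A maximum of sums is at most the
sum of the two maxima.
\<close>

lemma uniform_deviation_finite:
  fixes nrm :: "'a::euclidean_space \<Rightarrow> real" and w :: "'t \<Rightarrow> 'a" and s :: "'t \<Rightarrow> real"
    and r \<alpha> \<eta> :: real
  assumes n: "is_norm nrm" and P: "prob_space P" and sets: "sets P = sets borel"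
    and \<alpha>: "0 < \<alpha>" "\<alpha> < 1" and r: "2 < r" and ir: "integrable P (\<lambda>z. nrm z powr r)"
    and N: "1 \<le> N" and \<eta>: "0 < \<eta>" "\<eta> < 1"
    and T: "finite T" "T \<noteq> {}" and w: "\<And>t. t \<in> T \<Longrightarrow> dual_norm nrm (w t) \<le> 1"
  defines "f \<equiv> \<lambda>t z. check_loss \<alpha> (w t \<bullet> z - s t) - check_loss \<alpha> (- s t)"
    and "\<Gamma> \<equiv> \<integral>z. nrm z powr r \<partial>P"
  shows "measure (sample_measure N P) {x \<in> space (sample_measure N P).
      max \<alpha> (1 - \<alpha>) * sqrt N * (360 * sqrt (DIM('a) + 1) + 2 * sqrt (2 * ln (3 / \<eta>))
        + sqrt (3 * \<Gamma> / \<eta>) * (32 / (r - 2)) * sqrt (ln (24 / \<eta>) + 2 * (DIM('a) + 1)))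
      < (MAX t\<in>T. \<Sum>i<N. integral\<^sup>L P (f t) - f t (x i))} \<le> \<eta>"
proof -
  let ?L = "max \<alpha> (1 - \<alpha>)" let ?S = "sample_measure N P" let ?d = "DIM('a)"
  define \<kappa> :: real where "\<kappa> = 2 powr (- (r - 2) / 2)"
  define A where "A = {z. nrm z \<le> 2}"
  have L: "?L > 0" using \<alpha> by simp
  interpret P: prob_space P by fact
  interpret S: prob_space ?S using P by (rule prob_space_sample_measure)
  note tm = truncated_moments[OF n P sets r ir, folded \<kappa>_def A_def \<Gamma>_def]
  have sp: "space P = UNIV" using sets_eq_imp_space_eq[OF sets] by simp
  have mP: "g \<in> borel_measurable P \<longleftrightarrow> g \<in> borel_measurable borel" for g :: "'a \<Rightarrow> real"
    using measurable_cong_sets[OF sets refl, of "borel :: real measure"] by simp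
  note [measurable] = borel_measurable_is_norm[OF n]
  have n0: "0 \<le> nrm z" for z by (rule is_norm_nonneg[OF n])
  have \<Gamma>0: "0 \<le> \<Gamma>" by (simp add: \<Gamma>_def)
  have fL: "\<bar>f t z\<bar> \<le> ?L * nrm z" if t: "t \<in> T" for t z
  proof -
    have "\<bar>f t z\<bar> \<le> ?L * \<bar>w t \<bullet> z\<bar>"
      unfolding f_def using check_loss_diff_le[OF \<alpha>, of "w t \<bullet> z - s t" "- s t"] by simp
    also have "\<bar>w t \<bullet> z\<bar> \<le> dual_norm nrm (w t) * nrm z" by (rule abs_inner_le_dual_norm[OF n])
    also have "\<dots> \<le> 1 * nrm z" using w[OF t] n0 by (rule mult_right_mono)
    finally show ?thesis using L by simp
  qed
  have fm: "f t \<in> borel_measurable borel" for t unfolding f_def by measurable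
  define g where "g D t z = f t z * indicator D z" for D t z
  have gm: "g D t \<in> borel_measurable borel" if "D \<in> sets borel" for D t
    unfolding g_def[abs_def] using fm that by measurable
  have gL: "\<bar>g D t z\<bar> \<le> ?L * (nrm z * indicator D z)" if "t \<in> T" for D t z
    using fL[OF that, of z] by (auto simp: g_def indicator_def)
  have ind: "integrable P (\<lambda>z. nrm z * indicator D z)" "integrable P (\<lambda>z. (nrm z * indicator D z)\<^sup>2)"
    if D: "D \<in> sets borel" for D
  proof -
    have [measurable]: "D \<in> sets borel" by fact
    have m1: "(\<lambda>z. nrm z * indicator D z) \<in> borel_measurable P" unfolding mP by measurable
    have m2: "(\<lambda>z. (nrm z * indicator D z)\<^sup>2) \<in> borel_measurable P" unfolding mP by measurable
    show "integrable P (\<lambda>z. nrm z * indicator D z)"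
      by (rule Bochner_Integration.integrable_bound[OF tm(1)]) (use m1 n0 in \<open>auto intro!: AE_I2 simp: indicator_def\<close>)
    show "integrable P (\<lambda>z. (nrm z * indicator D z)\<^sup>2)"
      by (rule Bochner_Integration.integrable_bound[OF tm(2)]) (use m2 n0 in \<open>auto intro!: AE_I2 simp: indicator_def\<close>)
  qed
  have ig: "integrable P (g D t)" if D: "D \<in> sets borel" and t: "t \<in> T" for D t
  proof (rule Bochner_Integration.integrable_bound)
    show "integrable P (\<lambda>z. ?L * (nrm z * indicator D z))" using ind(1)[OF D] by simp
    show "AE z in P. norm (g D t z) \<le> norm (?L * (nrm z * indicator D z))"
      using gL[OF t] by (intro AE_I2) (force intro: order_trans[OF _ abs_ge_self])
  qed (use gm[OF D] mP in simp)
  define Z where "Z D x = (MAX t\<in>T. \<Sum>i<N. integral\<^sup>L P (g D t) - g D t (x i))" for D and x :: "nat \<Rightarrow> 'a"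
  have iZ: "integrable ?S (Z D)" if D: "D \<in> sets borel" for D
    unfolding Z_def using ig[OF D]
    by (intro integrable_MAX_sum_sample[OF P T, where g = "\<lambda>t z. integral\<^sup>L P (g D t) - g D t z"]) auto
  have A: "A \<in> sets borel" "- A \<in> sets borel" using tm(3) by auto
  have Zdiff: "\<bar>Z D x - Z D (x(i := y))\<bar> \<le> c"
    if i: "i < N" and c: "\<And>t. t \<in> T \<Longrightarrow> \<bar>g D t (x i) - g D t y\<bar> \<le> c" for D x i y c
    unfolding Z_def
  proof (rule Max_diff_le[OF T])
    fix t assume t: "t \<in> T"
    have "(\<Sum>j<N. integral\<^sup>L P (g D t) - g D t (x j)) - (\<Sum>j<N. integral\<^sup>L P (g D t) - g D t ((x(i := y)) j))
      = (integral\<^sup>L P (g D t) - g D t (x i)) - (integral\<^sup>L P (g D t) - g D t y)"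
      by (rule sum_update[OF i])
    then show "\<bar>(\<Sum>j<N. integral\<^sup>L P (g D t) - g D t (x j)) - (\<Sum>j<N. integral\<^sup>L P (g D t) - g D t ((x(i := y)) j))\<bar> \<le> c"
      using c[OF t] by simp
  qed
  have Zabs: "\<bar>Z D x\<bar> \<le> c" if c: "\<And>t. t \<in> T \<Longrightarrow> \<bar>\<Sum>i<N. integral\<^sup>L P (g D t) - g D t (x i)\<bar> \<le> c" for D x c
    using Max_diff_le[OF T, of "\<lambda>t. \<Sum>i<N. integral\<^sup>L P (g D t) - g D t (x i)" "\<lambda>_. 0" c] c T by (simp add: Z_def)
  have EZ1: "integral\<^sup>L ?S (Z A) \<le> 8 * ?L * sqrt N * (sqrt (real ?d * 4) + 2)"
    unfolding Z_def g_def f_def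
    by (rule expected_sup_check_loss_le[OF n P sets A(1) \<alpha> T w ind(1)[OF A(1)] ind(2)[OF A(1)] tm(4) tm(6)]) auto
  have EZ2: "integral\<^sup>L ?S (Z (- A)) \<le> 8 * ?L * sqrt N * (sqrt (?d * (\<Gamma> * \<kappa>\<^sup>2)) + sqrt \<Gamma> * \<kappa> * (1 + 2 / (r - 2)))"
    unfolding Z_def g_def f_def
    by (rule expected_sup_check_loss_le[OF n P sets A(2) \<alpha> T w ind(1)[OF A(2)] ind(2)[OF A(2)] tm(5) tm(7)])
      (use r \<Gamma>0 in \<open>auto simp: \<kappa>_def\<close>)
  have gA: "\<bar>g A t z\<bar> \<le> 2 * ?L" if "t \<in> T" for t z
  proof -
    have "?L * (nrm z * indicator A z) \<le> ?L * 2" using L by (intro mult_left_mono) (auto simp: A_def indicator_def)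
    then show ?thesis using gL[OF that, of A z] by linarith
  qed
  have P1: "measure ?S {x \<in> space ?S. integral\<^sup>L ?S (Z A) + (4 * ?L) * sqrt (N * ln (1 / (\<eta> / 3)) / 2) \<le> Z A x} \<le> \<eta> / 3"
  proof (rule bounded_differences_tail[OF P N])
    show "Z A \<in> borel_measurable ?S" using iZ[OF A(1)] by auto
    show "\<bar>Z A x\<bar> \<le> N * (4 * ?L)" for x
    proof (rule Zabs)
      fix t assume t: "t \<in> T"
      have "\<bar>integral\<^sup>L P (g A t)\<bar> \<le> (\<integral>z. \<bar>g A t z\<bar> \<partial>P)" by (rule integral_abs_bound)
      also have "\<dots> \<le> (\<integral>z. 2 * ?L \<partial>P)" using ig[OF A(1) t] gA[OF t] by (intro integral_mono) auto
      finally have E: "\<bar>integral\<^sup>L P (g A t)\<bar> \<le> 2 * ?L" by (simp add: P.prob_space)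
      have "\<bar>\<Sum>i<N. integral\<^sup>L P (g A t) - g A t (x i)\<bar> \<le> (\<Sum>i<N. \<bar>integral\<^sup>L P (g A t) - g A t (x i)\<bar>)" by (rule sum_abs)
      also have "\<dots> \<le> (\<Sum>i<N. 4 * ?L)"
      proof (rule sum_mono)
        fix i show "\<bar>integral\<^sup>L P (g A t) - g A t (x i)\<bar> \<le> 4 * ?L" using E gA[OF t, of "x i"] by linarith
      qed
      finally show "\<bar>\<Sum>i<N. integral\<^sup>L P (g A t) - g A t (x i)\<bar> \<le> N * (4 * ?L)" by simp
    qed
    show "\<bar>Z A x - Z A (x(i := y))\<bar> \<le> 4 * ?L" if "i < N" for x i y
    proof (rule Zdiff[OF that])
      fix t assume "t \<in> T"
      then show "\<bar>g A t (x i) - g A t y\<bar> \<le> 4 * ?L" using gA[of t "x i"] gA[of t y] by linarith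
    qed
  qed (use L \<eta> in auto)
  define b where "b z = ?L * (nrm z * indicator (- A) z)" for z
  have ib: "integrable P b" "integrable P (\<lambda>z. (b z)\<^sup>2)"
    using ind[OF A(2)] by (simp_all add: b_def[abs_def] power_mult_distrib)
  have Eb: "(\<integral>z. (b z)\<^sup>2 \<partial>P) \<le> ?L\<^sup>2 * (\<Gamma> * \<kappa>\<^sup>2)"
  proof -
    have "(\<integral>z. (b z)\<^sup>2 \<partial>P) = ?L\<^sup>2 * (\<integral>z. (nrm z * indicator (- A) z)\<^sup>2 \<partial>P)"
      by (simp add: b_def power_mult_distrib mult.assoc)
    then show ?thesis using tm(5) by (simp add: mult_left_mono)
  qed
  have P2: "measure ?S {x \<in> space ?S. integral\<^sup>L ?S (Z (- A)) + sqrt (N * (?L\<^sup>2 * (\<Gamma> * \<kappa>\<^sup>2)) / (\<eta> / 3)) < Z (- A) x} \<le> \<eta> / 3"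
  proof (rule variance_tail[OF P _ _ ib Eb])
    show "0 \<in> space P" by (simp add: sp)
    show "Z (- A) \<in> borel_measurable ?S" using iZ[OF A(2)] by auto
    show "\<bar>Z (- A) x\<bar> \<le> N * integral\<^sup>L P b + (\<Sum>i<N. b (x i))" for x
    proof (rule Zabs)
      fix t assume t: "t \<in> T"
      have gb: "\<bar>g (- A) t z\<bar> \<le> b z" for z using gL[OF t, of "- A" z] by (simp add: b_def)
      have "\<bar>integral\<^sup>L P (g (- A) t)\<bar> \<le> (\<integral>z. \<bar>g (- A) t z\<bar> \<partial>P)" by (rule integral_abs_bound)
      also have "\<dots> \<le> integral\<^sup>L P b" using ig[OF A(2) t] gb ib by (intro integral_mono) auto
      finally have E: "\<bar>integral\<^sup>L P (g (- A) t)\<bar> \<le> integral\<^sup>L P b" .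
      have "\<bar>\<Sum>i<N. integral\<^sup>L P (g (- A) t) - g (- A) t (x i)\<bar> \<le> (\<Sum>i<N. \<bar>integral\<^sup>L P (g (- A) t) - g (- A) t (x i)\<bar>)"
        by (rule sum_abs)
      also have "\<dots> \<le> (\<Sum>i<N. integral\<^sup>L P b + b (x i))"
      proof (rule sum_mono)
        fix i show "\<bar>integral\<^sup>L P (g (- A) t) - g (- A) t (x i)\<bar> \<le> integral\<^sup>L P b + b (x i)"
          using E gb[of "x i"] by linarith
      qed
      finally show "\<bar>\<Sum>i<N. integral\<^sup>L P (g (- A) t) - g (- A) t (x i)\<bar> \<le> N * integral\<^sup>L P b + (\<Sum>i<N. b (x i))"
        by (simp add: sum.distrib)
    qed
    have "0 \<in> A" using is_norm_eq_0[OF n, of 0] by (simp add: A_def)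
    then have g0: "g (- A) t 0 = 0" for t by (simp add: g_def)
    show "\<bar>Z (- A) x - Z (- A) (x(i := 0))\<bar> \<le> b (x i)" if "i < N" for x i
    proof (rule Zdiff[OF that])
      fix t assume "t \<in> T"
      then show "\<bar>g (- A) t (x i) - g (- A) t 0\<bar> \<le> b (x i)" using gL[of t "- A" "x i"] g0 by (simp add: b_def)
    qed
  qed (use \<eta> in auto)
  define B where "B = ?L * sqrt N * (360 * sqrt (?d + 1) + 2 * sqrt (2 * ln (3 / \<eta>))
        + sqrt (3 * \<Gamma> / \<eta>) * (32 / (r - 2)) * sqrt (ln (24 / \<eta>) + 2 * (?d + 1)))"
  define b1 where "b1 = integral\<^sup>L ?S (Z A) + (4 * ?L) * sqrt (N * ln (1 / (\<eta> / 3)) / 2)"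
  define b2 where "b2 = integral\<^sup>L ?S (Z (- A)) + sqrt (N * (?L\<^sup>2 * (\<Gamma> * \<kappa>\<^sup>2)) / (\<eta> / 3))"
  have "b1 + b2 \<le> B"
  proof -
    have k0: "0 \<le> \<kappa>" by (simp add: \<kappa>_def)
    have ln0: "0 \<le> ln (3 / \<eta>)" using \<eta> by (intro ln_ge_zero) (simp add: field_simps)
    have e1: "(4 * ?L) * sqrt (N * ln (1 / (\<eta> / 3)) / 2) = ?L * sqrt N * (2 * sqrt (2 * ln (3 / \<eta>)))"
    proof -
      have "4 * sqrt (N * ln (3 / \<eta>) / 2) = sqrt (16 * (N * ln (3 / \<eta>) / 2))" by (subst real_sqrt_mult) simp
      also have "\<dots> = sqrt (4 * (N * (2 * ln (3 / \<eta>))))" by (simp add: algebra_simps)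
      also have "\<dots> = 2 * (sqrt N * sqrt (2 * ln (3 / \<eta>)))" by (simp only: real_sqrt_mult real_sqrt_four)
      finally show ?thesis by simp
    qed
    have e2: "sqrt (N * (?L\<^sup>2 * (\<Gamma> * \<kappa>\<^sup>2)) / (\<eta> / 3)) = ?L * sqrt N * (sqrt \<Gamma> * \<kappa> * sqrt (3 / \<eta>))"
    proof -
      have "N * (?L\<^sup>2 * (\<Gamma> * \<kappa>\<^sup>2)) / (\<eta> / 3) = ?L\<^sup>2 * (N * (\<Gamma> * (\<kappa>\<^sup>2 * (3 / \<eta>))))" by (simp add: field_simps)
      then show ?thesis using L k0 by (simp only: real_sqrt_mult) simp
    qed
    have e3: "sqrt (real ?d * 4) = 2 * sqrt ?d" by (simp add: real_sqrt_mult)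
    have e4: "sqrt (?d * (\<Gamma> * \<kappa>\<^sup>2)) = sqrt \<Gamma> * \<kappa> * sqrt ?d" using k0 by (simp add: real_sqrt_mult)
    have factor: "8 * a * c * (2 * d + 2) + a * c * u + (8 * a * c * (p * d + p * v) + a * c * (p * q))
      = a * c * ((16 * (d + 1) + 8 * (p * (d + v)) + p * q) + u)" for a c d u p v q :: real
      by (simp add: algebra_simps)
    have "b1 + b2 \<le> 8 * ?L * sqrt N * (sqrt (real ?d * 4) + 2) + ?L * sqrt N * (2 * sqrt (2 * ln (3 / \<eta>)))
      + (8 * ?L * sqrt N * (sqrt (?d * (\<Gamma> * \<kappa>\<^sup>2)) + sqrt \<Gamma> * \<kappa> * (1 + 2 / (r - 2)))
        + ?L * sqrt N * (sqrt \<Gamma> * \<kappa> * sqrt (3 / \<eta>)))"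
      unfolding b1_def b2_def e1 e2 using EZ1 EZ2 by (intro add_mono) auto
    also have "\<dots> = ?L * sqrt N * ((16 * (sqrt ?d + 1) + 8 * (sqrt \<Gamma> * \<kappa> * (sqrt ?d + (1 + 2 / (r - 2))))
      + sqrt \<Gamma> * \<kappa> * sqrt (3 / \<eta>)) + 2 * sqrt (2 * ln (3 / \<eta>)))"
      unfolding e3 e4 by (rule factor)
    also have "\<dots> \<le> ?L * sqrt N * ((360 * sqrt (?d + 1) + sqrt (3 * \<Gamma> / \<eta>) * (32 / (r - 2)) * sqrt (ln (24 / \<eta>) + 2 * (?d + 1)))
      + 2 * sqrt (2 * ln (3 / \<eta>)))"
    proof (rule mult_left_mono[OF add_right_mono])
      have "1 \<le> ?d" using DIM_positive[where 'a='a] by linarith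
      from deviation_constants[OF this r \<Gamma>0 \<eta>, folded \<kappa>_def]
      show "16 * (sqrt ?d + 1) + 8 * (sqrt \<Gamma> * \<kappa> * (sqrt ?d + (1 + 2 / (r - 2)))) + sqrt \<Gamma> * \<kappa> * sqrt (3 / \<eta>)
        \<le> 360 * sqrt (?d + 1) + sqrt (3 * \<Gamma> / \<eta>) * (32 / (r - 2)) * sqrt (ln (24 / \<eta>) + 2 * (?d + 1))" .
      show "0 \<le> ?L * sqrt N" using L by simp
    qed
    also have "\<dots> = B" unfolding B_def by (simp only: add.assoc add.commute add.left_commute)
    finally show ?thesis .
  qed
  have split: "(MAX t\<in>T. \<Sum>i<N. integral\<^sup>L P (f t) - f t (x i)) \<le> Z A x + Z (- A) x" for x
  proof -
    have "(\<Sum>i<N. integral\<^sup>L P (f t) - f t (x i)) \<le> Z A x + Z (- A) x" if t: "t \<in> T" for t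
    proof -
      have ft: "f t = (\<lambda>z. g A t z + g (- A) t z)" by (auto simp: g_def indicator_def fun_eq_iff)
      have "integral\<^sup>L P (f t) = integral\<^sup>L P (g A t) + integral\<^sup>L P (g (- A) t)"
        unfolding ft using ig[OF A(1) t] ig[OF A(2) t] by simp
      then have "(\<Sum>i<N. integral\<^sup>L P (f t) - f t (x i))
        = (\<Sum>i<N. integral\<^sup>L P (g A t) - g A t (x i)) + (\<Sum>i<N. integral\<^sup>L P (g (- A) t) - g (- A) t (x i))"
        by (simp add: ft sum.distrib[symmetric] algebra_simps)
      also have "\<dots> \<le> Z A x + Z (- A) x"
        unfolding Z_def using T t by (intro add_mono Max_ge) auto
      finally show ?thesis .
    qed
    then show ?thesis using T by (intro Max.boundedI) auto
  qed
  have ev: "{x \<in> space ?S. b1 \<le> Z A x} \<in> S.events" "{x \<in> space ?S. b2 < Z (- A) x} \<in> S.events"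
    using borel_measurable_integrable[OF iZ[OF A(1)]] borel_measurable_integrable[OF iZ[OF A(2)]] by measurable
  have "measure ?S {x \<in> space ?S. B < (MAX t\<in>T. \<Sum>i<N. integral\<^sup>L P (f t) - f t (x i))}
    \<le> measure ?S ({x \<in> space ?S. b1 \<le> Z A x} \<union> {x \<in> space ?S. b2 < Z (- A) x})"
  proof (rule S.finite_measure_mono)
    show "{x \<in> space ?S. B < (MAX t\<in>T. \<Sum>i<N. integral\<^sup>L P (f t) - f t (x i))}
      \<subseteq> {x \<in> space ?S. b1 \<le> Z A x} \<union> {x \<in> space ?S. b2 < Z (- A) x}"
    proof
      fix x assume "x \<in> {x \<in> space ?S. B < (MAX t\<in>T. \<Sum>i<N. integral\<^sup>L P (f t) - f t (x i))}"
      then have x: "x \<in> space ?S" and "B < Z A x + Z (- A) x"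
        using split[of x] by (auto intro: less_le_trans)
      then have "b1 \<le> Z A x \<or> b2 < Z (- A) x" using \<open>b1 + b2 \<le> B\<close> by linarith
      then show "x \<in> {x \<in> space ?S. b1 \<le> Z A x} \<union> {x \<in> space ?S. b2 < Z (- A) x}" using x by blast
    qed
  qed (use ev in auto)
  also have "\<dots> \<le> measure ?S {x \<in> space ?S. b1 \<le> Z A x} + measure ?S {x \<in> space ?S. b2 < Z (- A) x}"
    using ev by (intro measure_Un_le)
  also have "\<dots> \<le> \<eta> / 3 + \<eta> / 3" using P1 P2 by (intro add_mono) (auto simp: b1_def b2_def)
  also have "\<dots> \<le> \<eta>" using \<eta> by simp
  finally show ?thesis unfolding B_def .
qed

text \<open>
Exhausting the index set by finite sets gives a decreasing sequence of events of probability at least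
\<open>1 - \<eta>\<close>.
\<close>

lemma uniform_deviation_countable:
  fixes nrm :: "'a::euclidean_space \<Rightarrow> real" and w :: "'t \<Rightarrow> 'a" and s :: "'t \<Rightarrow> real"
    and r \<alpha> \<eta> :: real
  assumes n: "is_norm nrm" and P: "prob_space P" and sets: "sets P = sets borel"
    and \<alpha>: "0 < \<alpha>" "\<alpha> < 1" and r: "2 < r" and ir: "integrable P (\<lambda>z. nrm z powr r)"
    and N: "1 \<le> N" and \<eta>: "0 < \<eta>" "\<eta> < 1"
    and I: "countable I" "I \<noteq> {}" and w: "\<And>t. t \<in> I \<Longrightarrow> dual_norm nrm (w t) \<le> 1"
  defines "f \<equiv> \<lambda>t z. check_loss \<alpha> (w t \<bullet> z - s t) - check_loss \<alpha> (- s t)"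
    and "\<Gamma> \<equiv> \<integral>z. nrm z powr r \<partial>P"
  defines "B \<equiv> max \<alpha> (1 - \<alpha>) * sqrt N * (360 * sqrt (DIM('a) + 1) + 2 * sqrt (2 * ln (3 / \<eta>))
        + sqrt (3 * \<Gamma> / \<eta>) * (32 / (r - 2)) * sqrt (ln (24 / \<eta>) + 2 * (DIM('a) + 1)))"
  shows "{x \<in> space (sample_measure N P). \<forall>t\<in>I. (\<Sum>i<N. integral\<^sup>L P (f t) - f t (x i)) \<le> B}
      \<in> sets (sample_measure N P)" (is ?M)
    and "1 - \<eta> \<le> measure (sample_measure N P)
      {x \<in> space (sample_measure N P). \<forall>t\<in>I. (\<Sum>i<N. integral\<^sup>L P (f t) - f t (x i)) \<le> B}" (is ?E)
proof -
  let ?S = "sample_measure N P"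
  interpret S: prob_space ?S using P by (rule prob_space_sample_measure)
  define Y where "Y t x = (\<Sum>i<N. integral\<^sup>L P (f t) - f t (x i))" for t and x :: "nat \<Rightarrow> 'a"
  have Ym: "Y t \<in> borel_measurable ?S" for t
  proof -
    have "f t \<in> borel_measurable borel" unfolding f_def by measurable
    then have "f t \<in> borel_measurable P" using measurable_cong_sets[OF sets refl, of "borel :: real measure"] by simp
    then show ?thesis unfolding Y_def[abs_def]
      by (intro borel_measurable_sum borel_measurable_diff borel_measurable_const
          measurable_compose[OF measurable_sample_component]) auto
  qed
  define T where "T k = from_nat_into I ` {..k}" for k
  \<comment> \<open>the events for the first \<open>k + 1\<close> indices decrease to the event for all of them\<close>
  define G where "G k = {x \<in> space ?S. \<forall>t\<in>T k. Y t x \<le> B}" for k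
  have Gm: "G k \<in> sets ?S" for k
  proof -
    have "G k = space ?S \<inter> (\<Inter>t\<in>T k. {x \<in> space ?S. Y t x \<le> B})" by (auto simp: G_def)
    also have "\<dots> \<in> sets ?S" using Ym by (intro sets.Int sets.finite_INT) (auto simp: T_def)
    finally show ?thesis .
  qed
  have Tsub: "T k \<subseteq> I" for k using from_nat_into[OF I(2)] by (auto simp: T_def)
  have Gk: "1 - \<eta> \<le> measure ?S (G k)" for k
  proof -
    have fT: "finite (T k)" "T k \<noteq> {}" by (auto simp: T_def)
    have eq: "{x \<in> space ?S. B < (MAX t\<in>T k. Y t x)} = space ?S - G k"
      using fT by (auto simp: G_def Max_gr_iff not_le)
    have "measure ?S {x \<in> space ?S. B < (MAX t\<in>T k. Y t x)} \<le> \<eta>"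
      unfolding Y_def f_def B_def \<Gamma>_def
      by (rule uniform_deviation_finite[OF n P sets \<alpha> r ir N \<eta> fT]) (use w Tsub in blast)
    then show ?thesis unfolding eq using S.prob_compl[OF Gm[of k]] by simp
  qed
  have dec: "decseq G" unfolding decseq_def G_def T_def by fastforce
  have lim: "(\<Inter>k. G k) = {x \<in> space ?S. \<forall>t\<in>I. Y t x \<le> B}"
  proof
    show "(\<Inter>k. G k) \<subseteq> {x \<in> space ?S. \<forall>t\<in>I. Y t x \<le> B}"
    proof
      fix x assume x: "x \<in> (\<Inter>k. G k)"
      have "Y t x \<le> B" if "t \<in> I" for t
      proof -
        obtain k where "t = from_nat_into I k" using from_nat_into_surj[OF I(1) \<open>t \<in> I\<close>] by metis
        then have "t \<in> T k" by (auto simp: T_def)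
        moreover have "x \<in> G k" using x by blast
        ultimately show ?thesis by (simp add: G_def)
      qed
      moreover have "x \<in> space ?S" using x by (auto simp: G_def)
      ultimately show "x \<in> {x \<in> space ?S. \<forall>t\<in>I. Y t x \<le> B}" by simp
    qed
  qed (use Tsub in \<open>auto simp: G_def\<close>)
  have "(\<Inter>k. G k) \<in> sets ?S" using Gm by (intro sets.countable_INT) auto
  then show ?M unfolding lim by (simp add: Y_def)
  have "(\<lambda>k. measure ?S (G k)) \<longlonglongrightarrow> measure ?S (\<Inter>k. G k)"
    using Gm dec by (intro S.finite_Lim_measure_decseq) auto
  then have "1 - \<eta> \<le> measure ?S (\<Inter>k. G k)" by (rule LIMSEQ_le_const) (use Gk in blast)
  then show ?E unfolding lim by (simp add: Y_def)
qed

section \<open>Transport plans to an empirical distribution\<close>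

lemma nn_integral_empirical:
  fixes \<omega> :: "nat \<Rightarrow> 'a::euclidean_space"
  assumes "f \<in> borel_measurable borel"
  shows "(\<integral>\<^sup>+z. f z \<partial>empirical N \<omega>) = (\<Sum>i<N. ennreal (1 / N) * f (\<omega> i))"
proof -
  have "(\<integral>\<^sup>+z. f z \<partial>empirical N \<omega>) = (\<integral>\<^sup>+i. f (\<omega> i) \<partial>uniform_count_measure {..<N})"
    unfolding empirical_def using assms
    by (intro nn_integral_distr) (auto simp: measurable_def space_uniform_count_measure sets_uniform_count_measure)
  also have "\<dots> = (\<Sum>i<N. ennreal (1 / N) * f (\<omega> i))"
    unfolding uniform_count_measure_def by (subst nn_integral_point_measure_finite) (auto simp: ennreal_1[symmetric])
  finally show ?thesis .
qed

lemma prob_space_empirical: "1 \<le> N \<Longrightarrow> prob_space (empirical N \<omega>)"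
  unfolding empirical_def
  by (intro prob_space.prob_space_distr prob_space_uniform_count_measure)
    (auto simp: measurable_def space_uniform_count_measure sets_uniform_count_measure lessThan_empty_iff)

lemma sets_empirical [simp]: "sets (empirical N \<omega>) = sets borel"
  by (simp add: empirical_def)

text \<open>
A bound on one transport plan, in a form free of roots and essential suprema that is stable under
taking images of plans.
\<close>

definition transport_le :: "('a::euclidean_space \<Rightarrow> real) \<Rightarrow> ereal \<Rightarrow> ('a \<times> 'a) measure \<Rightarrow> real \<Rightarrow> bool" where
  "transport_le nrm p \<pi> c \<longleftrightarrow>
    (if p = \<infinity> then (AE z in \<pi>. nrm (fst z - snd z) \<le> c)
     else (\<integral>\<^sup>+z. ennreal (nrm (fst z - snd z) powr real_of_ereal p) \<partial>\<pi>) \<le> ennreal (c powr real_of_ereal p))"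

lemma couplingsD:
  assumes "\<pi> \<in> couplings F G"
  shows "prob_space \<pi>" "sets \<pi> = sets (borel \<Otimes>\<^sub>M borel)" "distr \<pi> borel fst = F" "distr \<pi> borel snd = G"
  using assms by (auto simp: couplings_def)

lemma borel_measurable_transport:
  fixes nrm :: "'a::euclidean_space \<Rightarrow> real"
  assumes n: "is_norm nrm"
  shows "(\<lambda>z. nrm (fst z - snd z)) \<in> borel_measurable (borel \<Otimes>\<^sub>M borel)"
proof -
  note [measurable] = borel_measurable_is_norm[OF n]
  show ?thesis by measurable
qed

lemma order_ge_1:
  assumes "1 \<le> (p :: ereal)" "p \<noteq> \<infinity>"
  shows "1 \<le> real_of_ereal p"
  using assms by (cases p) auto

lemma wasserstein_le_of_transport:
  fixes nrm :: "'a::euclidean_space \<Rightarrow> real"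
  assumes n: "is_norm nrm" and p: "1 \<le> p" and c: "0 \<le> c"
    and \<pi>: "\<pi> \<in> couplings F G" and le: "transport_le nrm p \<pi> c"
  shows "wasserstein nrm p F G \<le> ennreal c"
proof (cases "p = \<infinity>")
  case True
  have "(\<lambda>z. ennreal (nrm (fst z - snd z))) \<in> borel_measurable \<pi>"
    using borel_measurable_transport[OF n] measurable_cong_sets[OF couplingsD(2)[OF \<pi>] refl, of "borel :: real measure"]
    by (intro measurable_compose[OF _ measurable_ennreal]) simp
  then have "esssup \<pi> (\<lambda>z. ennreal (nrm (fst z - snd z))) \<le> ennreal c"
    using le True by (intro esssup_I) (auto simp: transport_le_def ennreal_leI elim!: eventually_mono)
  then show ?thesis unfolding wasserstein_def using True \<pi> by (auto simp: case_prod_beta' intro!: INF_lower2)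
next
  case False
  define q where "q = real_of_ereal p"
  have q: "1 \<le> q" using order_ge_1[OF p False] by (simp add: q_def)
  define I where "I = (\<integral>\<^sup>+z. ennreal (nrm (fst z - snd z) powr q) \<partial>\<pi>)"
  have I: "I \<le> ennreal (c powr q)" using le False by (simp add: transport_le_def I_def q_def)
  then have fin: "I \<noteq> \<infinity>" by (auto simp: top_unique)
  have "enn2real I \<le> c powr q" using I by (intro enn2real_leI) auto
  then have "enn2real I powr (1 / q) \<le> (c powr q) powr (1 / q)" using q by (intro powr_mono2) auto
  also have "\<dots> = c" using q c by (simp add: powr_powr)
  finally have "ennreal_root q I \<le> ennreal c" using fin by (simp add: ennreal_root_def ennreal_leI)
  then show ?thesis unfolding wasserstein_def using False \<pi>
    by (auto simp: case_prod_beta' I_def q_def intro!: INF_lower2)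
qed

text \<open>
The infimum in the Wasserstein distance need not be attained a priori, hence the strict inequality.
\<close>

lemma transport_of_wasserstein_less:
  fixes nrm :: "'a::euclidean_space \<Rightarrow> real"
  assumes n: "is_norm nrm" and p: "1 \<le> p" and c: "0 \<le> c"
    and less: "wasserstein nrm p F G < ennreal c"
  obtains \<pi> where "\<pi> \<in> couplings F G" "transport_le nrm p \<pi> c"
proof (cases "p = \<infinity>")
  case True
  then obtain \<pi> where \<pi>: "\<pi> \<in> couplings F G" "esssup \<pi> (\<lambda>z. ennreal (nrm (fst z - snd z))) < ennreal c"
    using less by (auto simp: wasserstein_def INF_less_iff case_prod_beta')
  have "AE z in \<pi>. ennreal (nrm (fst z - snd z)) \<le> esssup \<pi> (\<lambda>z. ennreal (nrm (fst z - snd z)))"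
    by (rule esssup_AE)
  then have "AE z in \<pi>. nrm (fst z - snd z) \<le> c"
  proof (rule eventually_mono)
    fix z assume "ennreal (nrm (fst z - snd z)) \<le> esssup \<pi> (\<lambda>z. ennreal (nrm (fst z - snd z)))"
    then have "ennreal (nrm (fst z - snd z)) \<le> ennreal c" using \<pi>(2) by simp
    then show "nrm (fst z - snd z) \<le> c" using c by simp
  qed
  then show ?thesis using that \<pi> True by (simp add: transport_le_def)
next
  case False
  define q where "q = real_of_ereal p"
  have q: "1 \<le> q" using order_ge_1[OF p False] by (simp add: q_def)
  obtain \<pi> where \<pi>: "\<pi> \<in> couplings F G"
    and root: "ennreal_root q (\<integral>\<^sup>+z. ennreal (nrm (fst z - snd z) powr q) \<partial>\<pi>) < ennreal c"
    using less False by (auto simp: wasserstein_def INF_less_iff case_prod_beta' q_def)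
  define I where "I = (\<integral>\<^sup>+z. ennreal (nrm (fst z - snd z) powr q) \<partial>\<pi>)"
  have fin: "I \<noteq> \<infinity>" using root by (auto simp: ennreal_root_def I_def[symmetric])
  then have "ennreal (enn2real I powr (1 / q)) < ennreal c"
    using root by (simp add: ennreal_root_def I_def[symmetric])
  then have "enn2real I powr (1 / q) \<le> c" by (metis c ennreal_le_iff less_imp_le)
  then have "(enn2real I powr (1 / q)) powr q \<le> c powr q" using q by (intro powr_mono2) auto
  then have "enn2real I \<le> c powr q" using q by (simp add: powr_powr)
  then have "ennreal (enn2real I) \<le> ennreal (c powr q)" by (rule ennreal_leI)
  then have "I \<le> ennreal (c powr q)" by (metis ennreal_enn2real fin less_top infinity_ennreal_def)
  then show ?thesis using that \<pi> False by (simp add: transport_le_def I_def q_def)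
qed

text \<open>
A crude bound for the mean displacement of a plan of cost \<open>c\<close>: by \<open>c\<close> if \<open>p = \<infinity>\<close>, and by
\<open>1 + c powr p\<close> otherwise, since \<open>t \<le> 1 + t powr p\<close>. Adding both avoids a case distinction.
\<close>

definition moment_bound :: "ereal \<Rightarrow> real \<Rightarrow> real" where
  "moment_bound p c = 1 + c + c powr real_of_ereal p"

lemma transport_first_moment:
  fixes nrm :: "'a::euclidean_space \<Rightarrow> real"
  assumes n: "is_norm nrm" and p: "1 \<le> p" and c: "0 \<le> c"
    and \<pi>: "prob_space \<pi>" "sets \<pi> = sets (borel \<Otimes>\<^sub>M borel)" and le: "transport_le nrm p \<pi> c"
  shows "(\<integral>\<^sup>+z. ennreal (nrm (fst z - snd z)) \<partial>\<pi>) \<le> ennreal (moment_bound p c)"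
proof -
  interpret \<pi>: prob_space \<pi> by fact
  have m: "(\<lambda>z. nrm (fst z - snd z)) \<in> borel_measurable \<pi>"
    using borel_measurable_transport[OF n] measurable_cong_sets[OF \<pi>(2) refl, of "borel :: real measure"] by simp
  show ?thesis
  proof (cases "p = \<infinity>")
    case True
    have "(\<integral>\<^sup>+z. ennreal (nrm (fst z - snd z)) \<partial>\<pi>) \<le> (\<integral>\<^sup>+z. ennreal c \<partial>\<pi>)"
      using le True by (intro nn_integral_mono_AE) (auto simp: transport_le_def ennreal_leI elim!: eventually_mono)
    also have "\<dots> = ennreal c" by (simp add: \<pi>.emeasure_space_1)
    also have "\<dots> \<le> ennreal (moment_bound p c)" by (intro ennreal_leI) (simp add: moment_bound_def)
    finally show ?thesis .
  next
    case False
    define q where "q = real_of_ereal p"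
    have q: "1 \<le> q" using order_ge_1[OF p False] by (simp add: q_def)
    have x: "x \<le> 1 + x powr q" if "0 \<le> x" for x :: real
    proof (cases "x \<le> 1")
      case False
      then have "x powr 1 \<le> x powr q" using q by (intro powr_mono) auto
      then show ?thesis using False by simp
    qed (simp add: add_increasing2)
    have "(\<integral>\<^sup>+z. ennreal (nrm (fst z - snd z)) \<partial>\<pi>) \<le> (\<integral>\<^sup>+z. 1 + ennreal (nrm (fst z - snd z) powr q) \<partial>\<pi>)"
    proof (rule nn_integral_mono)
      fix z
      have "ennreal (nrm (fst z - snd z)) \<le> ennreal (1 + nrm (fst z - snd z) powr q)"
        by (intro ennreal_leI x is_norm_nonneg[OF n])
      then show "ennreal (nrm (fst z - snd z)) \<le> 1 + ennreal (nrm (fst z - snd z) powr q)" by simp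
    qed
    also have "\<dots> = 1 + (\<integral>\<^sup>+z. ennreal (nrm (fst z - snd z) powr q) \<partial>\<pi>)"
      using m by (subst nn_integral_add) (auto simp: \<pi>.emeasure_space_1)
    also have "\<dots> \<le> 1 + ennreal (c powr q)"
      using le False by (intro add_left_mono) (simp add: transport_le_def q_def)
    also have "\<dots> = ennreal (1 + c powr q)" by simp
    also have "\<dots> \<le> ennreal (moment_bound p c)" using c by (intro ennreal_leI) (simp add: moment_bound_def q_def)
    finally show ?thesis .
  qed
qed

text \<open>
Shifting each sample point by at most \<open>\<epsilon>\<close> is a plan whose displacement is bounded by \<open>\<epsilon>\<close>
everywhere, which is admissible for every order \<open>p\<close>.
\<close>

lemma shifted_empirical_in_ball:
  fixes nrm :: "'a::euclidean_space \<Rightarrow> real" and \<omega> v :: "nat \<Rightarrow> 'a"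
  assumes n: "is_norm nrm" and p: "1 \<le> p" and N: "1 \<le> N" and \<epsilon>: "0 \<le> \<epsilon>"
    and v: "\<And>i. i < N \<Longrightarrow> nrm (v i) \<le> \<epsilon>"
  shows "empirical N (\<lambda>i. \<omega> i + v i) \<in> wasserstein_ball nrm p (empirical N \<omega>) \<epsilon>"
proof -
  let ?U = "uniform_count_measure {..<N}"
  interpret U: prob_space ?U
    using N by (intro prob_space_uniform_count_measure) (auto simp: lessThan_empty_iff)
  define \<pi> where "\<pi> = distr ?U (borel \<Otimes>\<^sub>M borel) (\<lambda>i. (\<omega> i + v i, \<omega> i))"
  have meas: "f \<in> ?U \<rightarrow>\<^sub>M M" if "\<And>i. f i \<in> space M" for f :: "nat \<Rightarrow> 'x" and M
    using that by (auto simp: measurable_def space_uniform_count_measure sets_uniform_count_measure)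
  have mp: "(\<lambda>i. (\<omega> i + v i, \<omega> i)) \<in> ?U \<rightarrow>\<^sub>M (borel \<Otimes>\<^sub>M borel)"
    by (rule meas) (simp add: space_pair_measure)
  have "prob_space \<pi>" unfolding \<pi>_def by (rule U.prob_space_distr[OF mp])
  moreover have "distr \<pi> borel fst = empirical N (\<lambda>i. \<omega> i + v i)" "distr \<pi> borel snd = empirical N \<omega>"
    unfolding \<pi>_def empirical_def using mp by (subst distr_distr; simp add: comp_def)+
  ultimately have c: "\<pi> \<in> couplings (empirical N (\<lambda>i. \<omega> i + v i)) (empirical N \<omega>)"
    by (simp add: couplings_def \<pi>_def)
  have AE: "AE z in \<pi>. nrm (fst z - snd z) \<le> \<epsilon>"
  proof -
    have "AE i in ?U. nrm (fst (\<omega> i + v i, \<omega> i) - snd (\<omega> i + v i, \<omega> i)) \<le> \<epsilon>"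
      by (rule AE_I2) (simp add: v space_uniform_count_measure)
    moreover have "{z \<in> space (borel \<Otimes>\<^sub>M borel). nrm (fst z - snd z) \<le> \<epsilon>} \<in> sets (borel \<Otimes>\<^sub>M borel)"
      using borel_measurable_transport[OF n] by measurable
    ultimately show ?thesis unfolding \<pi>_def using mp by (subst AE_distr_iff) auto
  qed
  have "transport_le nrm p \<pi> \<epsilon>"
  proof (cases "p = \<infinity>")
    case True
    then show ?thesis using AE by (simp add: transport_le_def)
  next
    case False
    define q where "q = real_of_ereal p"
    have q: "1 \<le> q" using order_ge_1[OF p False] by (simp add: q_def)
    interpret \<pi>: prob_space \<pi> by fact
    have "(\<integral>\<^sup>+z. ennreal (nrm (fst z - snd z) powr q) \<partial>\<pi>) \<le> (\<integral>\<^sup>+z. ennreal (\<epsilon> powr q) \<partial>\<pi>)"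
      using AE q by (intro nn_integral_mono_AE) (auto intro!: ennreal_leI powr_mono2 is_norm_nonneg[OF n] elim!: eventually_mono)
    then show ?thesis using False by (simp add: transport_le_def q_def \<pi>.emeasure_space_1)
  qed
  then have "wasserstein nrm p (empirical N (\<lambda>i. \<omega> i + v i)) (empirical N \<omega>) \<le> ennreal \<epsilon>"
    by (rule wasserstein_le_of_transport[OF n p \<epsilon> c])
  then show ?thesis
    by (simp add: wasserstein_ball_def distributions_def prob_space_empirical[OF N])
qed

text \<open>
A plan to an empirical distribution knows the sample \<^emph>\<open>value\<close> that mass is sent to, not the sample
\<^emph>\<open>index\<close>; the two differ when sample values repeat. The mass sent to a value is divided equally
among the indices that carry it.
\<close>

lemma couple_with_index:
  fixes \<omega> :: "nat \<Rightarrow> 'a::euclidean_space"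
  assumes N: "1 \<le> N" and \<pi>: "\<pi> \<in> couplings F (empirical N \<omega>)"
  obtains \<mu> :: "(nat \<times> 'a \<times> 'a) measure" where
    "prob_space \<mu>" "sets \<mu> = sets (count_space {..<N} \<Otimes>\<^sub>M (borel \<Otimes>\<^sub>M borel))"
    "\<And>h :: 'a \<times> 'a \<Rightarrow> ennreal. h \<in> borel_measurable (borel \<Otimes>\<^sub>M borel) \<Longrightarrow> (\<integral>\<^sup>+q. h (snd q) \<partial>\<mu>) = (\<integral>\<^sup>+z. h z \<partial>\<pi>)"
    "\<And>h :: nat \<Rightarrow> ennreal. (\<integral>\<^sup>+q. h (fst q) \<partial>\<mu>) = (\<Sum>i<N. ennreal (1 / N) * h i)"
    "AE q in \<mu>. snd (snd q) = \<omega> (fst q)"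
proof -
  interpret \<pi>: prob_space \<pi> using couplingsD[OF \<pi>] by simp
  let ?B = "borel \<Otimes>\<^sub>M (borel :: 'a measure)"
  note sets\<pi> = couplingsD(2)[OF \<pi>]
  have m\<pi>: "g \<in> borel_measurable \<pi> \<longleftrightarrow> g \<in> borel_measurable ?B" for g :: "'a \<times> 'a \<Rightarrow> ennreal"
    using measurable_cong_sets[OF sets\<pi> refl, of "borel :: ennreal measure"] by simp
  define m where "m y = real (card {j\<in>{..<N}. \<omega> j = y})" for y
  \<comment> \<open>the share of index \<open>i\<close> in the mass at \<open>y = \<omega> i\<close> is one over the multiplicity \<open>m y\<close> of that value\<close>
  define k where "k q = (if snd (snd q) = \<omega> (fst q) then ennreal (1 / m (\<omega> (fst q))) else 0)" for q :: "nat \<times> 'a \<times> 'a"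
  have mpos: "0 < m (\<omega> i)" if "i < N" for i using that by (auto simp: m_def card_gt_0_iff)
  let ?C = "count_space {..<N} \<Otimes>\<^sub>M \<pi>"
  have [measurable]: "(\<lambda>z. if snd z = y then a else 0 :: ennreal) \<in> borel_measurable ?B" for y :: 'a and a
    by measurable
  have km: "k \<in> borel_measurable ?C"
    by (rule measurable_pair_measure_countable1) (auto simp: k_def m\<pi>)
  define \<mu> where "\<mu> = density ?C k"
  have sets\<mu>: "sets \<mu> = sets (count_space {..<N} \<Otimes>\<^sub>M ?B)"
    unfolding \<mu>_def using sets_pair_measure_cong[OF refl sets\<pi>, of "count_space {..<N}"] by simp
  have int: "(\<integral>\<^sup>+q. f q \<partial>\<mu>) = (\<Sum>i<N. \<integral>\<^sup>+z. k (i, z) * f (i, z) \<partial>\<pi>)"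
    if f: "f \<in> borel_measurable ?C" for f
  proof -
    have "(\<integral>\<^sup>+q. f q \<partial>\<mu>) = (\<integral>\<^sup>+q. k q * f q \<partial>?C)"
      unfolding \<mu>_def using km f by (rule nn_integral_density)
    also have "\<dots> = (\<integral>\<^sup>+i. \<integral>\<^sup>+z. k (i, z) * f (i, z) \<partial>\<pi> \<partial>count_space {..<N})"
      using km f by (subst \<pi>.nn_integral_fst[symmetric]) auto
    also have "\<dots> = (\<Sum>i<N. \<integral>\<^sup>+z. k (i, z) * f (i, z) \<partial>\<pi>)"
      by (rule nn_integral_count_space_finite) simp
    finally show ?thesis .
  qed
  have ksum: "(\<Sum>i<N. k (i, z)) = 1" if z: "snd z \<in> \<omega> ` {..<N}" for z :: "'a \<times> 'a"
  proof -
    define y where "y = snd z"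
    have my: "0 < m y" using z mpos by (auto simp: y_def)
    have "(\<Sum>i<N. k (i, z)) = (\<Sum>i\<in>{..<N}. if \<omega> i = y then ennreal (1 / m y) else 0)"
      by (intro sum.cong) (auto simp: k_def y_def)
    also have "\<dots> = (\<Sum>i\<in>{i\<in>{..<N}. \<omega> i = y}. ennreal (1 / m y))" by (rule sum.inter_filter[symmetric]) simp
    also have "\<dots> = ennreal (m y) * ennreal (1 / m y)" by (simp add: m_def ennreal_of_nat_eq_real_of_nat)
    also have "\<dots> = 1" using my by (simp add: ennreal_mult[symmetric])
    finally show ?thesis .
  qed
  have emp: "(\<integral>\<^sup>+z. h (snd z) \<partial>\<pi>) = (\<Sum>i<N. ennreal (1 / N) * h (\<omega> i))" if h: "h \<in> borel_measurable borel" for h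
  proof -
    have "(\<integral>\<^sup>+z. h (snd z) \<partial>\<pi>) = (\<integral>\<^sup>+y. h y \<partial>distr \<pi> borel snd)"
      using h measurable_cong_sets[OF sets\<pi> refl, of "borel :: 'a measure"] by (intro nn_integral_distr[symmetric]) auto
    then show ?thesis using h couplingsD(4)[OF \<pi>] by (simp add: nn_integral_empirical)
  qed
  have fin_borel: "\<omega> ` {..<N} \<in> sets borel" by (intro borel_closed finite_imp_closed) simp
  have supp: "AE z in \<pi>. snd z \<in> \<omega> ` {..<N}"
  proof -
    have "(\<integral>\<^sup>+z. indicator (- \<omega> ` {..<N}) (snd z) \<partial>\<pi>) = (\<Sum>i<N. ennreal (1 / N) * indicator (- \<omega> ` {..<N}) (\<omega> i))"
      using fin_borel by (intro emp) auto
    also have "\<dots> = 0" by (intro sum.neutral) auto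
    finally have "AE z in \<pi>. indicator (- \<omega> ` {..<N}) (snd z) = (0 :: ennreal)"
    proof (subst (asm) nn_integral_0_iff_AE)
      show "(\<lambda>z. indicator (- \<omega> ` {..<N}) (snd z) :: ennreal) \<in> borel_measurable \<pi>"
        unfolding m\<pi> using fin_borel by (intro measurable_compose[OF measurable_snd]) auto
    qed
    then show ?thesis by (auto simp: indicator_def split: if_splits elim!: eventually_mono)
  qed
  have i: "(\<integral>\<^sup>+q. h (snd q) \<partial>\<mu>) = (\<integral>\<^sup>+z. h z \<partial>\<pi>)" if h: "h \<in> borel_measurable ?B" for h
  proof -
    have h': "h \<in> borel_measurable \<pi>" using h m\<pi> by simp
    have "(\<integral>\<^sup>+q. h (snd q) \<partial>\<mu>) = (\<Sum>i<N. \<integral>\<^sup>+z. k (i, z) * h z \<partial>\<pi>)"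
      using h' by (subst int) (auto intro: measurable_compose[OF measurable_snd])
    also have "\<dots> = (\<integral>\<^sup>+z. (\<Sum>i<N. k (i, z) * h z) \<partial>\<pi>)"
    proof (rule nn_integral_sum[symmetric])
      fix i
      have "(\<lambda>z. k (i, z)) \<in> borel_measurable \<pi>" unfolding m\<pi> by (simp add: k_def)
      then show "(\<lambda>z. k (i, z) * h z) \<in> borel_measurable \<pi>" using h' by (rule borel_measurable_times_ennreal)
    qed
    also have "\<dots> = (\<integral>\<^sup>+z. h z \<partial>\<pi>)"
      using supp by (intro nn_integral_cong_AE) (auto simp: sum_distrib_right[symmetric] ksum elim!: eventually_mono)
    finally show ?thesis .
  qed
  have ii: "(\<integral>\<^sup>+q. h (fst q) \<partial>\<mu>) = (\<Sum>i<N. ennreal (1 / N) * h i)" for h :: "nat \<Rightarrow> ennreal"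
  proof -
    have "(\<integral>\<^sup>+q. h (fst q) \<partial>\<mu>) = (\<Sum>i<N. \<integral>\<^sup>+z. k (i, z) * h i \<partial>\<pi>)"
      by (subst int) (auto intro: measurable_compose[OF measurable_fst])
    also have "\<dots> = (\<Sum>i<N. ennreal (1 / N) * h i)"
    proof (rule sum.cong)
      fix i assume "i \<in> {..<N}"
      then have i: "i < N" by simp
      define a where "a = ennreal (1 / m (\<omega> i)) * h i"
      have "(\<integral>\<^sup>+z. k (i, z) * h i \<partial>\<pi>) = (\<integral>\<^sup>+z. (if snd z = \<omega> i then a else 0) \<partial>\<pi>)"
        by (intro nn_integral_cong) (auto simp: k_def a_def)
      also have "\<dots> = (\<Sum>j<N. ennreal (1 / N) * (if \<omega> j = \<omega> i then a else 0))"
        by (rule emp) measurable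
      also have "\<dots> = ennreal (1 / N) * (\<Sum>j\<in>{..<N}. if \<omega> j = \<omega> i then a else 0)"
        by (simp add: sum_distrib_left)
      also have "(\<Sum>j\<in>{..<N}. if \<omega> j = \<omega> i then a else 0) = (\<Sum>j\<in>{j\<in>{..<N}. \<omega> j = \<omega> i}. a)"
        by (rule sum.inter_filter[symmetric]) simp
      also have "\<dots> = ennreal (m (\<omega> i)) * a" by (simp add: m_def ennreal_of_nat_eq_real_of_nat)
      also have "\<dots> = (ennreal (m (\<omega> i)) * ennreal (1 / m (\<omega> i))) * h i" by (simp add: a_def mult.assoc)
      also have "ennreal (m (\<omega> i)) * ennreal (1 / m (\<omega> i)) = 1" using mpos[OF i] by (simp add: ennreal_mult[symmetric])
      finally show "(\<integral>\<^sup>+z. k (i, z) * h i \<partial>\<pi>) = ennreal (1 / N) * h i" by simp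
    qed simp
    finally show ?thesis .
  qed
  have iii: "AE q in \<mu>. snd (snd q) = \<omega> (fst q)"
    unfolding \<mu>_def using km by (subst AE_density) (auto simp: k_def intro!: AE_I2)
  have "emeasure \<mu> (space \<mu>) = (\<integral>\<^sup>+q. 1 \<partial>\<mu>)" by simp
  also have "\<dots> = 1" using i[of "\<lambda>_. 1"] \<pi>.emeasure_space_1 by simp
  finally have "prob_space \<mu>" by (rule prob_spaceI)
  then show ?thesis using that sets\<mu> i ii iii by blast
qed

lemma couple_with_index_near:
  fixes nrm :: "'a::euclidean_space \<Rightarrow> real" and \<omega> :: "nat \<Rightarrow> 'a"
  assumes n: "is_norm nrm" and p: "1 \<le> p" and N: "1 \<le> N" and \<epsilon>: "0 \<le> \<epsilon>" and c: "\<epsilon> < c"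
    and F: "F \<in> wasserstein_ball nrm p (empirical N \<omega>) \<epsilon>"
  obtains \<pi> \<mu> where "\<pi> \<in> couplings F (empirical N \<omega>)" "transport_le nrm p \<pi> c"
    "prob_space \<mu>" "sets \<mu> = sets (count_space {..<N} \<Otimes>\<^sub>M (borel \<Otimes>\<^sub>M borel))"
    "\<And>h :: 'a \<times> 'a \<Rightarrow> ennreal. h \<in> borel_measurable (borel \<Otimes>\<^sub>M borel) \<Longrightarrow> (\<integral>\<^sup>+q. h (snd q) \<partial>\<mu>) = (\<integral>\<^sup>+z. h z \<partial>\<pi>)"
    "\<And>h :: nat \<Rightarrow> ennreal. (\<integral>\<^sup>+q. h (fst q) \<partial>\<mu>) = (\<Sum>i<N. ennreal (1 / N) * h i)"
    "AE q in \<mu>. snd (snd q) = \<omega> (fst q)"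
proof -
  have "wasserstein nrm p F (empirical N \<omega>) \<le> ennreal \<epsilon>" using F by (simp add: wasserstein_ball_def)
  also have "\<dots> < ennreal c" using \<epsilon> c by (simp add: ennreal_less_iff)
  finally obtain \<pi> where \<pi>: "\<pi> \<in> couplings F (empirical N \<omega>)" "transport_le nrm p \<pi> c"
    using transport_of_wasserstein_less[OF n p, of c F "empirical N \<omega>"] \<epsilon> c by (metis less_imp_le order_trans)
  show ?thesis by (rule couple_with_index[OF N \<pi>(1)]) (rule that[OF \<pi>])
qed

lemma divide_by_sample_size_le: "1 \<le> N \<Longrightarrow> 0 \<le> a \<Longrightarrow> a / real N \<le> a"
  using divide_left_mono[of 1 "real N" a] by simp

text \<open>
The bound depends on the distribution only through the sample, so it is uniform over the ball.
\<close>

lemma first_moment_in_ball: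
  fixes nrm :: "'a::euclidean_space \<Rightarrow> real" and \<omega> :: "nat \<Rightarrow> 'a"
  assumes n: "is_norm nrm" and p: "1 \<le> p" and N: "1 \<le> N" and \<epsilon>: "0 \<le> \<epsilon>"
    and F: "F \<in> wasserstein_ball nrm p (empirical N \<omega>) \<epsilon>"
  shows "(\<integral>\<^sup>+x. ennreal (nrm x) \<partial>F) \<le> ennreal (moment_bound p (\<epsilon> + 1) + (\<Sum>i<N. nrm (\<omega> i)))"
proof -
  have "wasserstein nrm p F (empirical N \<omega>) \<le> ennreal \<epsilon>" using F by (simp add: wasserstein_ball_def)
  also have "\<dots> < ennreal (\<epsilon> + 1)" using \<epsilon> by (simp add: ennreal_less_iff)
  finally obtain \<pi> where \<pi>: "\<pi> \<in> couplings F (empirical N \<omega>)" "transport_le nrm p \<pi> (\<epsilon> + 1)"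
    using transport_of_wasserstein_less[OF n p, of "\<epsilon> + 1" F "empirical N \<omega>"] \<epsilon> by (metis add_nonneg_nonneg zero_le_one)
  note D = couplingsD[OF \<pi>(1)]
  have fs: "fst \<in> \<pi> \<rightarrow>\<^sub>M borel" "snd \<in> \<pi> \<rightarrow>\<^sub>M borel"
    using measurable_cong_sets[OF D(2) refl, of "borel :: 'a measure"] by auto
  note nm = borel_measurable_is_norm[OF n]
  have m: "(\<lambda>z. nrm (fst z - snd z)) \<in> borel_measurable \<pi>"
    using borel_measurable_transport[OF n] measurable_cong_sets[OF D(2) refl, of "borel :: real measure"] by simp
  have "(\<integral>\<^sup>+x. ennreal (nrm x) \<partial>F) = (\<integral>\<^sup>+z. ennreal (nrm (fst z)) \<partial>\<pi>)"
    unfolding D(3)[symmetric] using fs nm by (intro nn_integral_distr) auto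
  also have "\<dots> \<le> (\<integral>\<^sup>+z. ennreal (nrm (fst z - snd z)) + ennreal (nrm (snd z)) \<partial>\<pi>)"
  proof (rule nn_integral_mono)
    fix z
    have "nrm (fst z) \<le> nrm (fst z - snd z) + nrm (snd z)"
      using is_norm_triangle[OF n, of "fst z - snd z" "snd z"] by simp
    then show "ennreal (nrm (fst z)) \<le> ennreal (nrm (fst z - snd z)) + ennreal (nrm (snd z))"
      by (simp add: ennreal_plus[symmetric] is_norm_nonneg[OF n] ennreal_leI del: ennreal_plus)
  qed
  also have "\<dots> = (\<integral>\<^sup>+z. ennreal (nrm (fst z - snd z)) \<partial>\<pi>) + (\<integral>\<^sup>+z. ennreal (nrm (snd z)) \<partial>\<pi>)"
    using m measurable_compose[OF fs(2) nm] by (intro nn_integral_add) auto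
  also have "(\<integral>\<^sup>+z. ennreal (nrm (snd z)) \<partial>\<pi>) = (\<integral>\<^sup>+y. ennreal (nrm y) \<partial>empirical N \<omega>)"
    unfolding D(4)[symmetric] using fs nm by (intro nn_integral_distr[symmetric]) auto
  also have "\<dots> = (\<Sum>i<N. ennreal (1 / N) * ennreal (nrm (\<omega> i)))" using nm by (intro nn_integral_empirical) auto
  also have "\<dots> \<le> (\<Sum>i<N. ennreal (nrm (\<omega> i)))"
    using divide_by_sample_size_le[OF N is_norm_nonneg[OF n]]
    by (intro sum_mono) (simp add: ennreal_mult[symmetric] is_norm_nonneg[OF n] ennreal_leI)
  also have "\<dots> = ennreal (\<Sum>i<N. nrm (\<omega> i))" by (simp add: sum_ennreal is_norm_nonneg[OF n])
  also have "(\<integral>\<^sup>+z. ennreal (nrm (fst z - snd z)) \<partial>\<pi>) \<le> ennreal (moment_bound p (\<epsilon> + 1))"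
    using \<epsilon> by (intro transport_first_moment[OF n p _ D(1,2) \<pi>(2)]) simp
  finally show ?thesis
    using \<epsilon> by (simp add: ennreal_plus[symmetric] sum_nonneg is_norm_nonneg[OF n] moment_bound_def del: ennreal_plus)
qed

text \<open>
When the sample point with index \<open>i\<close> moves from \<open>\<omega> i\<close> to \<open>\<omega>' i\<close>, all mass that a plan sends to
\<open>i\<close> is translated along; the displacements, and with them the cost, stay the same, and the
expectation of the Lipschitz function \<open>h\<close> changes by at most \<open>K\<close> times the movement. Since optimal plans
need not exist, one starts from a plan of cost slightly above \<open>\<epsilon>\<close> and shrinks its displacements
by the factor \<open>t\<close> to return to the ball; the effect of the shrinking vanishes in the limit.
\<close>

lemma ball_sup_Lipschitz_in_sample:
  fixes nrm :: "'a::euclidean_space \<Rightarrow> real" and \<omega> \<omega>' :: "nat \<Rightarrow> 'a" and h :: "'a \<Rightarrow> real"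
  assumes n: "is_norm nrm" and p: "1 \<le> p" and N: "1 \<le> N" and \<epsilon>: "0 < \<epsilon>"
    and h: "h \<in> borel_measurable borel" "\<And>z. 0 \<le> h z" and K: "0 \<le> K"
    and lip: "\<And>y z. h y \<le> h z + K * nrm (y - z)"
  defines "W \<equiv> (\<lambda>\<omega>. SUP F\<in>wasserstein_ball nrm p (empirical N \<omega>) \<epsilon>. \<integral>\<^sup>+z. ennreal (h z) \<partial>F)"
  shows "W \<omega> \<le> W \<omega>' + ennreal (K * (\<Sum>i<N. nrm (\<omega> i - \<omega>' i)))"
proof -
  have bound: "(\<integral>\<^sup>+z. ennreal (h z) \<partial>F) \<le> W \<omega>' + ennreal (K * (\<Sum>i<N. nrm (\<omega> i - \<omega>' i)))"
    if F: "F \<in> wasserstein_ball nrm p (empirical N \<omega>) \<epsilon>" for F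
  proof -
  let ?M = "moment_bound p (\<epsilon> + 1)"
  have M0: "0 < ?M" using \<epsilon> by (simp add: moment_bound_def add_pos_nonneg)
  note nm = borel_measurable_is_norm[OF n]
  note n0 = is_norm_nonneg[OF n]
  define S where "S = (\<Sum>i<N. nrm (\<omega> i - \<omega>' i))"
  have S0: "0 \<le> S" unfolding S_def by (intro sum_nonneg n0)
  have step: "(\<integral>\<^sup>+z. ennreal (h z) \<partial>F) \<le> W \<omega>' + ennreal (K * S) + ennreal (K * \<delta> / \<epsilon> * ?M)"
    if \<delta>: "0 < \<delta>" "\<delta> \<le> 1" for \<delta>
  proof -
    define c where "c = \<epsilon> + \<delta>"
    have c: "\<epsilon> < c" "c \<le> \<epsilon> + 1" "0 < c" using \<delta> \<epsilon> by (auto simp: c_def)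
    define t where "t = \<epsilon> / c"
    have t: "0 \<le> t" "t \<le> 1" "t * c = \<epsilon>" "1 - t \<le> \<delta> / \<epsilon>"
    proof -
      have "1 - t = \<delta> / c" using c by (simp add: t_def c_def field_simps)
      also have "\<dots> \<le> \<delta> / \<epsilon>" using \<delta> \<epsilon> c by (intro divide_left_mono) auto
      finally show "1 - t \<le> \<delta> / \<epsilon>" .
    qed (use c \<epsilon> in \<open>auto simp: t_def\<close>)
    obtain \<pi> \<mu> where \<pi>: "\<pi> \<in> couplings F (empirical N \<omega>)" "transport_le nrm p \<pi> c"
      and \<mu>: "prob_space \<mu>" "sets \<mu> = sets (count_space {..<N} \<Otimes>\<^sub>M (borel \<Otimes>\<^sub>M borel))"
      and \<mu>1: "\<And>h :: 'a \<times> 'a \<Rightarrow> ennreal. h \<in> borel_measurable (borel \<Otimes>\<^sub>M borel) \<Longrightarrow> (\<integral>\<^sup>+q. h (snd q) \<partial>\<mu>) = (\<integral>\<^sup>+z. h z \<partial>\<pi>)"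
      and \<mu>2: "\<And>h :: nat \<Rightarrow> ennreal. (\<integral>\<^sup>+q. h (fst q) \<partial>\<mu>) = (\<Sum>i<N. ennreal (1 / N) * h i)"
      and \<mu>3: "AE q in \<mu>. snd (snd q) = \<omega> (fst q)"
      by (rule couple_with_index_near[OF n p N less_imp_le[OF \<epsilon>] c(1) F]) (rule that)
    interpret \<mu>: prob_space \<mu> by (rule \<mu>(1))
    note D = couplingsD[OF \<pi>(1)]
    have m\<mu>: "g \<in> \<mu> \<rightarrow>\<^sub>M (L :: 'l measure) \<longleftrightarrow> g \<in> count_space {..<N} \<Otimes>\<^sub>M (borel \<Otimes>\<^sub>M borel) \<rightarrow>\<^sub>M L"
      for g :: "nat \<times> 'a \<times> 'a \<Rightarrow> 'l" and L
      using measurable_cong_sets[OF \<mu>(2) refl, of L] by simp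
    define X where "X q = fst (snd q) - snd (snd q)" for q :: "nat \<times> 'a \<times> 'a"
    have meas_fst: "(\<lambda>q. g (fst q)) \<in> borel_measurable \<mu>" for g :: "nat \<Rightarrow> 'x::topological_space"
      unfolding m\<mu> by (rule measurable_compose[OF measurable_fst]) simp
    have meas_snd: "(\<lambda>q. g (snd q)) \<in> \<mu> \<rightarrow>\<^sub>M L" if "g \<in> borel \<Otimes>\<^sub>M borel \<rightarrow>\<^sub>M L"
      for g :: "'a \<times> 'a \<Rightarrow> 'x" and L
      unfolding m\<mu> by (rule measurable_compose[OF measurable_snd that])
    have Xm: "X \<in> borel_measurable \<mu>" unfolding X_def[abs_def] by (rule meas_snd[of "\<lambda>z. fst z - snd z"]) measurable
    \<comment> \<open>the displacement \<open>X\<close> is shrunk by \<open>t\<close> and attached to the new sample point\<close>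
    define x' where "x' q = \<omega>' (fst q) + t *\<^sub>R X q" for q
    have x'm: "x' \<in> borel_measurable \<mu>"
      unfolding x'_def[abs_def] using Xm meas_fst[of \<omega>'] by measurable
    define \<pi>' where "\<pi>' = distr \<mu> (borel \<Otimes>\<^sub>M borel) (\<lambda>q. (x' q, \<omega>' (fst q)))"
    have pm: "(\<lambda>q. (x' q, \<omega>' (fst q))) \<in> \<mu> \<rightarrow>\<^sub>M (borel \<Otimes>\<^sub>M borel)"
      using x'm meas_fst[of \<omega>'] by measurable
    define F' where "F' = distr \<mu> borel x'"
    have snd': "distr \<mu> borel (\<lambda>q. \<omega>' (fst q)) = empirical N \<omega>'"
    proof (rule measure_eqI)
      fix A assume "A \<in> sets (distr \<mu> borel (\<lambda>q. \<omega>' (fst q)))"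
      then have A: "A \<in> sets borel" by simp
      have "emeasure (distr \<mu> borel (\<lambda>q. \<omega>' (fst q))) A = (\<integral>\<^sup>+y. indicator A y \<partial>distr \<mu> borel (\<lambda>q. \<omega>' (fst q)))"
        using A by simp
      also have "\<dots> = (\<integral>\<^sup>+q. indicator A (\<omega>' (fst q)) \<partial>\<mu>)"
        using A meas_fst[of \<omega>'] by (intro nn_integral_distr) auto
      also have "\<dots> = (\<integral>\<^sup>+y. indicator A y \<partial>empirical N \<omega>')"
        unfolding nn_integral_empirical[OF borel_measurable_indicator[OF A]] by (rule \<mu>2)
      also have "\<dots> = emeasure (empirical N \<omega>') A" using A by simp
      finally show "emeasure (distr \<mu> borel (\<lambda>q. \<omega>' (fst q))) A = emeasure (empirical N \<omega>') A" .
    qed simp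
    have \<pi>': "\<pi>' \<in> couplings F' (empirical N \<omega>')"
    proof -
      have "prob_space \<pi>'" unfolding \<pi>'_def by (rule \<mu>.prob_space_distr[OF pm])
      moreover have "distr \<pi>' borel fst = F'" unfolding \<pi>'_def F'_def using pm by (subst distr_distr) (auto simp: comp_def)
      moreover have "distr \<pi>' borel snd = empirical N \<omega>'"
        unfolding \<pi>'_def snd'[symmetric] using pm by (subst distr_distr) (auto simp: comp_def)
      ultimately show ?thesis by (simp add: couplings_def \<pi>'_def)
    qed
    have cost: "nrm (x' q - \<omega>' (fst q)) = t * nrm (X q)" for q
      using t by (simp add: x'_def is_norm_scaleR[OF n])
    have "transport_le nrm p \<pi>' \<epsilon>"
    proof (cases "p = \<infinity>")
      case True
      have ms: "{z \<in> space (borel \<Otimes>\<^sub>M borel). nrm (fst z - snd z) \<le> a} \<in> sets (borel \<Otimes>\<^sub>M borel)" for a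
        using borel_measurable_transport[OF n] by measurable
      have close: "AE z in \<pi>. nrm (fst z - snd z) \<le> c" using \<pi>(2) True by (simp add: transport_le_def)
      have bad: "{z. \<not> nrm (fst z - snd z) \<le> c} \<in> sets (borel \<Otimes>\<^sub>M borel)"
      proof -
        have "{z. \<not> nrm (fst z - snd z) \<le> c} = {z \<in> space (borel \<Otimes>\<^sub>M borel). \<not> nrm (fst z - snd z) \<le> c}"
          by (simp add: space_pair_measure)
        also have "\<dots> \<in> sets (borel \<Otimes>\<^sub>M borel)" using borel_measurable_transport[OF n] by measurable
        finally show ?thesis .
      qed
      have "(\<integral>\<^sup>+q. indicator {z. \<not> nrm (fst z - snd z) \<le> c} (snd q) \<partial>\<mu>)
        = (\<integral>\<^sup>+z. indicator {z. \<not> nrm (fst z - snd z) \<le> c} z \<partial>\<pi>)"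
        using bad by (intro \<mu>1) auto
      also have "\<dots> = 0"
      proof -
        have "(\<integral>\<^sup>+z. indicator {z. \<not> nrm (fst z - snd z) \<le> c} z \<partial>\<pi>) = (\<integral>\<^sup>+z. 0 \<partial>\<pi>)"
          using close by (intro nn_integral_cong_AE) (auto elim!: eventually_mono)
        then show ?thesis by simp
      qed
      finally have "AE q in \<mu>. indicator {z. \<not> nrm (fst z - snd z) \<le> c} (snd q) = (0 :: ennreal)"
        by (subst (asm) nn_integral_0_iff_AE) (use bad in \<open>auto intro!: meas_snd\<close>)
      then have "AE q in \<mu>. nrm (X q) \<le> c"
        by (auto simp: indicator_def X_def split: if_splits elim!: eventually_mono)
      then have "AE q in \<mu>. nrm (x' q - \<omega>' (fst q)) \<le> \<epsilon>"
        unfolding cost by (rule eventually_mono) (metis mult_left_mono t(1,3))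
      then show ?thesis unfolding transport_le_def \<pi>'_def using True ms pm by (subst AE_distr_iff) auto
    next
      case False
      define q where "q = real_of_ereal p"
      have q: "1 \<le> q" using order_ge_1[OF p False] by (simp add: q_def)
      have m: "(\<lambda>z. ennreal (nrm (fst z - snd z) powr q)) \<in> borel_measurable (borel \<Otimes>\<^sub>M borel)"
        using borel_measurable_transport[OF n] by measurable
      have "(\<integral>\<^sup>+z. ennreal (nrm (fst z - snd z) powr q) \<partial>\<pi>') = (\<integral>\<^sup>+u. ennreal ((t * nrm (X u)) powr q) \<partial>\<mu>)"
        unfolding \<pi>'_def using m pm by (subst nn_integral_distr) (auto simp: cost)
      also have "\<dots> = (\<integral>\<^sup>+u. ennreal (t powr q) * ennreal (nrm (fst (snd u) - snd (snd u)) powr q) \<partial>\<mu>)"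
        using t n0 by (simp add: powr_mult ennreal_mult X_def)
      also have "\<dots> = (\<integral>\<^sup>+z. ennreal (t powr q) * ennreal (nrm (fst z - snd z) powr q) \<partial>\<pi>)"
        using m by (intro \<mu>1[of "\<lambda>z. ennreal (t powr q) * ennreal (nrm (fst z - snd z) powr q)"]) auto
      also have "\<dots> = ennreal (t powr q) * (\<integral>\<^sup>+z. ennreal (nrm (fst z - snd z) powr q) \<partial>\<pi>)"
        using m measurable_cong_sets[OF D(2) refl, of "borel :: ennreal measure"] by (intro nn_integral_cmult) simp
      also have "\<dots> \<le> ennreal (t powr q) * ennreal (c powr q)"
        using \<pi>(2) False by (intro mult_left_mono) (auto simp: transport_le_def q_def)
      also have "\<dots> = ennreal (\<epsilon> powr q)"
        using t c by (simp add: ennreal_mult[symmetric] powr_mult[symmetric])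
      finally show ?thesis using False by (simp add: transport_le_def q_def)
    qed
    then have "wasserstein nrm p F' (empirical N \<omega>') \<le> ennreal \<epsilon>"
      using \<epsilon> by (intro wasserstein_le_of_transport[OF n p _ \<pi>']) auto
    then have F': "F' \<in> wasserstein_ball nrm p (empirical N \<omega>') \<epsilon>"
      using \<mu>.prob_space_distr[OF x'm] by (simp add: wasserstein_ball_def distributions_def F'_def)
    have hm: "(\<lambda>z. ennreal (h z)) \<in> borel_measurable borel" using h by measurable
    have fs: "fst \<in> \<pi> \<rightarrow>\<^sub>M borel" using measurable_cong_sets[OF D(2) refl, of "borel :: 'a measure"] by auto
    have "(\<integral>\<^sup>+z. ennreal (h z) \<partial>F) = (\<integral>\<^sup>+z. ennreal (h (fst z)) \<partial>\<pi>)"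
      unfolding D(3)[symmetric] using fs hm by (intro nn_integral_distr) auto
    also have "\<dots> = (\<integral>\<^sup>+q. ennreal (h (fst (snd q))) \<partial>\<mu>)"
      using hm by (intro \<mu>1[symmetric] measurable_compose[OF measurable_fst])
    also have "\<dots> \<le> (\<integral>\<^sup>+q. (ennreal (h (x' q)) + ennreal (K * nrm (\<omega> (fst q) - \<omega>' (fst q)))) + ennreal (K * \<delta> / \<epsilon>) * ennreal (nrm (X q)) \<partial>\<mu>)"
    proof (rule nn_integral_mono_AE)
      show "AE q in \<mu>. ennreal (h (fst (snd q))) \<le> (ennreal (h (x' q)) + ennreal (K * nrm (\<omega> (fst q) - \<omega>' (fst q)))) + ennreal (K * \<delta> / \<epsilon>) * ennreal (nrm (X q))"
        using \<mu>3
      proof (rule eventually_mono)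
        fix q :: "nat \<times> 'a \<times> 'a"
        assume q: "snd (snd q) = \<omega> (fst q)"
        have "fst (snd q) - x' q = (\<omega> (fst q) - \<omega>' (fst q)) + (1 - t) *\<^sub>R X q"
          by (simp add: x'_def X_def q algebra_simps)
        then have "nrm (fst (snd q) - x' q) \<le> nrm (\<omega> (fst q) - \<omega>' (fst q)) + (1 - t) * nrm (X q)"
          using is_norm_triangle[OF n, of "\<omega> (fst q) - \<omega>' (fst q)" "(1 - t) *\<^sub>R X q"] t by (simp add: is_norm_scaleR[OF n])
        also have "\<dots> \<le> nrm (\<omega> (fst q) - \<omega>' (fst q)) + \<delta> / \<epsilon> * nrm (X q)"
          using t n0 by (intro add_left_mono mult_right_mono) auto
        finally have "K * nrm (fst (snd q) - x' q) \<le> K * (nrm (\<omega> (fst q) - \<omega>' (fst q)) + \<delta> / \<epsilon> * nrm (X q))"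
          using K by (rule mult_left_mono)
        then have "h (fst (snd q)) \<le> h (x' q) + K * nrm (\<omega> (fst q) - \<omega>' (fst q)) + (K * \<delta> / \<epsilon>) * nrm (X q)"
          using lip[of "fst (snd q)" "x' q"] by (simp add: algebra_simps)
        then have "ennreal (h (fst (snd q))) \<le> ennreal (h (x' q) + K * nrm (\<omega> (fst q) - \<omega>' (fst q)) + (K * \<delta> / \<epsilon>) * nrm (X q))"
          by (rule ennreal_leI)
        also have "\<dots> = (ennreal (h (x' q)) + ennreal (K * nrm (\<omega> (fst q) - \<omega>' (fst q)))) + ennreal (K * \<delta> / \<epsilon>) * ennreal (nrm (X q))"
          using h(2) K n0 \<delta> \<epsilon> by (simp add: ennreal_mult[symmetric])
        finally show "ennreal (h (fst (snd q))) \<le> (ennreal (h (x' q)) + ennreal (K * nrm (\<omega> (fst q) - \<omega>' (fst q)))) + ennreal (K * \<delta> / \<epsilon>) * ennreal (nrm (X q))" .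
      qed
    qed
    also have "\<dots> = (\<integral>\<^sup>+q. ennreal (h (x' q)) \<partial>\<mu>) + (\<integral>\<^sup>+q. ennreal (K * nrm (\<omega> (fst q) - \<omega>' (fst q))) \<partial>\<mu>)
      + ennreal (K * \<delta> / \<epsilon>) * (\<integral>\<^sup>+q. ennreal (nrm (X q)) \<partial>\<mu>)"
    proof -
      note 1 = measurable_compose[OF x'm hm]
      note 2 = meas_fst[of "\<lambda>i. ennreal (K * nrm (\<omega> i - \<omega>' i))"]
      note 3 = measurable_compose[OF measurable_compose[OF Xm nm] measurable_ennreal]
      show ?thesis using 1 2 3 by (simp add: nn_integral_add nn_integral_cmult)
    qed
    also have "(\<integral>\<^sup>+q. ennreal (h (x' q)) \<partial>\<mu>) = (\<integral>\<^sup>+z. ennreal (h z) \<partial>F')"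
      unfolding F'_def using x'm hm by (intro nn_integral_distr[symmetric]) auto
    also have "\<dots> \<le> W \<omega>'" unfolding W_def by (rule SUP_upper[OF F'])
    also have "(\<integral>\<^sup>+q. ennreal (K * nrm (\<omega> (fst q) - \<omega>' (fst q))) \<partial>\<mu>) = (\<Sum>i<N. ennreal (1 / N) * ennreal (K * nrm (\<omega> i - \<omega>' i)))"
      by (rule \<mu>2)
    also have "\<dots> \<le> (\<Sum>i<N. ennreal (K * nrm (\<omega> i - \<omega>' i)))"
      using divide_by_sample_size_le[OF N mult_nonneg_nonneg[OF K n0]] K n0
      by (intro sum_mono) (simp add: ennreal_mult[symmetric] ennreal_leI)
    also have "\<dots> = ennreal (K * S)" using K n0 by (simp add: sum_ennreal S_def sum_distrib_left)
    also have "(\<integral>\<^sup>+q. ennreal (nrm (X q)) \<partial>\<mu>) = (\<integral>\<^sup>+z. ennreal (nrm (fst z - snd z)) \<partial>\<pi>)"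
      unfolding X_def using borel_measurable_transport[OF n]
      by (intro \<mu>1[of "\<lambda>z. ennreal (nrm (fst z - snd z))"]) measurable
    also have "\<dots> \<le> ennreal (moment_bound p c)"
      using c by (intro transport_first_moment[OF n p _ D(1,2) \<pi>(2)]) auto
    also have "\<dots> \<le> ennreal ?M"
    proof -
      have "0 \<le> real_of_ereal p" using p by (cases p) auto
      then have "c powr real_of_ereal p \<le> (\<epsilon> + 1) powr real_of_ereal p" using c by (intro powr_mono2) auto
      then show ?thesis using c by (intro ennreal_leI) (simp add: moment_bound_def)
    qed
    finally show ?thesis
      using K \<delta> \<epsilon> M0 by (simp add: ennreal_mult[symmetric] add_mono mult_left_mono)
  qed
  show "(\<integral>\<^sup>+z. ennreal (h z) \<partial>F) \<le> W \<omega>' + ennreal (K * (\<Sum>i<N. nrm (\<omega> i - \<omega>' i)))"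
  proof (rule ennreal_le_epsilon)
    fix e :: real assume e: "0 < e"
    \<comment> \<open>\<open>K + 1\<close> in place of \<open>K\<close> covers \<open>K = 0\<close>\<close>
    define \<delta> where "\<delta> = min 1 (e * \<epsilon> / ((K + 1) * ?M))"
    have \<delta>: "0 < \<delta>" "\<delta> \<le> 1" using e \<epsilon> K M0 by (auto simp: \<delta>_def)
    have "K * \<delta> / \<epsilon> * ?M \<le> e"
    proof -
      have "K * \<delta> / \<epsilon> * ?M \<le> (K + 1) * (e * \<epsilon> / ((K + 1) * ?M)) / \<epsilon> * ?M"
        using K M0 \<epsilon> \<delta> by (intro mult_right_mono divide_right_mono mult_mono) (auto simp: \<delta>_def)
      also have "\<dots> = e"
      proof -
        have "k * (e * \<epsilon> / (k * m)) / \<epsilon> * m = e" if "0 < k" "0 < m" for k m using that \<epsilon> by simp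
        then show ?thesis using K M0 by simp
      qed
      finally show ?thesis .
    qed
    then have "ennreal (K * \<delta> / \<epsilon> * ?M) \<le> ennreal e" by (rule ennreal_leI)
    then show "(\<integral>\<^sup>+z. ennreal (h z) \<partial>F) \<le> W \<omega>' + ennreal (K * (\<Sum>i<N. nrm (\<omega> i - \<omega>' i))) + ennreal e"
      using step[OF \<delta>] by (auto simp: S_def intro: order_trans add_left_mono)
  qed
  qed
  show ?thesis
    using SUP_least[of "wasserstein_ball nrm p (empirical N \<omega>) \<epsilon>", OF bound] by (simp add: W_def)
qed

section \<open>Worst-case risk as a function of the sample and the parameters\<close>

text \<open>
A Lipschitz function is the infimum of the cones over its values on a countable dense set (McShane's
formula), which exhibits it as a countable infimum of measurable functions.
\<close>

lemma borel_measurable_sample_Lipschitz: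
  fixes nrm :: "'a::euclidean_space \<Rightarrow> real" and g :: "(nat \<Rightarrow> 'a) \<Rightarrow> ennreal"
  assumes n: "is_norm nrm" and sets: "sets P = sets borel" and K: "0 \<le> K"
    and lip: "\<And>\<omega> \<omega>'. g \<omega> \<le> g \<omega>' + ennreal (K * (\<Sum>i<N. nrm (\<omega> i - \<omega>' i)))"
  shows "g \<in> borel_measurable (sample_measure N P)"
proof -
  obtain C where C: "C > 0" "\<And>x. nrm x \<le> C * norm x" using is_norm_le_norm[OF n] by metis
  obtain D :: "'a set" where D: "countable D" "\<And>X. open X \<Longrightarrow> X \<noteq> {} \<Longrightarrow> \<exists>d\<in>D. d \<in> X"
    using countable_dense_setE by blast
  define Q where "Q = PiE {..<N} (\<lambda>_. D)"
  have cQ: "countable Q" unfolding Q_def using D(1) by (intro countable_PiE) auto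
  have eq: "g \<omega> = (INF q\<in>Q. g q + ennreal (K * (\<Sum>i<N. nrm (\<omega> i - q i))))" for \<omega>
  proof (rule antisym)
    show "g \<omega> \<le> (INF q\<in>Q. g q + ennreal (K * (\<Sum>i<N. nrm (\<omega> i - q i))))"
      by (intro INF_greatest lip)
    show "(INF q\<in>Q. g q + ennreal (K * (\<Sum>i<N. nrm (\<omega> i - q i)))) \<le> g \<omega>"
    proof (rule ennreal_le_epsilon)
      fix e :: real assume e: "0 < e"
      define \<delta> where "\<delta> = e / (2 * (K + 1) * (real N + 1) * C)"
      have \<delta>: "0 < \<delta>" using e K C by (simp add: \<delta>_def)
      have "\<exists>d\<in>D. d \<in> ball (\<omega> i) \<delta>" for i using \<delta> by (intro D(2)) auto
      then obtain d where d: "\<And>i. d i \<in> D" "\<And>i. dist (\<omega> i) (d i) < \<delta>" unfolding mem_ball by metis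
      define q where "q = restrict d {..<N}"
      have q: "q \<in> Q" using d(1) by (auto simp: q_def Q_def)
      have small: "K * (\<Sum>i<N. nrm (\<omega> i - q i)) \<le> e / 2"
      proof -
        have "(\<Sum>i<N. nrm (\<omega> i - q i)) \<le> (\<Sum>i<N. C * \<delta>)"
        proof (rule sum_mono)
          fix i assume "i \<in> {..<N}"
          then have "nrm (\<omega> i - q i) \<le> C * norm (\<omega> i - d i)" using C(2) by (simp add: q_def)
          also have "\<dots> \<le> C * \<delta>" using d(2)[of i] C(1) by (intro mult_left_mono) (auto simp: dist_norm)
          finally show "nrm (\<omega> i - q i) \<le> C * \<delta>" .
        qed
        then have "(\<Sum>i<N. nrm (\<omega> i - q i)) \<le> N * (C * \<delta>)" by simp
        also have "\<dots> \<le> (real N + 1) * (C * \<delta>)" using C \<delta> by (intro mult_right_mono) auto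
        finally have "K * (\<Sum>i<N. nrm (\<omega> i - q i)) \<le> (K + 1) * ((real N + 1) * (C * \<delta>))"
          using K by (intro mult_mono) (auto intro!: sum_nonneg is_norm_nonneg[OF n])
        also have "\<dots> = e / 2"
        proof -
          have cancel: "k * (m * (c * (e / (2 * k * m * c)))) = e / 2" if "0 < k" "0 < m" "0 < c" for k m c
            using that by simp
          show ?thesis unfolding \<delta>_def by (rule cancel) (use K C(1) in auto)
        qed
        finally show ?thesis .
      qed
      have sym: "(\<Sum>i<N. nrm (q i - \<omega> i)) = (\<Sum>i<N. nrm (\<omega> i - q i))"
        by (intro sum.cong refl is_norm_commute[OF n])
      have "(INF q\<in>Q. g q + ennreal (K * (\<Sum>i<N. nrm (\<omega> i - q i)))) \<le> g q + ennreal (K * (\<Sum>i<N. nrm (\<omega> i - q i)))"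
        by (rule INF_lower[OF q])
      also have "\<dots> \<le> (g \<omega> + ennreal (e / 2)) + ennreal (e / 2)"
      proof (rule add_mono)
        show small': "ennreal (K * (\<Sum>i<N. nrm (\<omega> i - q i))) \<le> ennreal (e / 2)" by (rule ennreal_leI[OF small])
        show "g q \<le> g \<omega> + ennreal (e / 2)"
          using order_trans[OF lip[of q \<omega>, unfolded sym] add_left_mono[OF small']] .
      qed
      also have "\<dots> = g \<omega> + ennreal e" using e by (simp add: add.assoc ennreal_plus[symmetric] del: ennreal_plus)
      finally show "(INF q\<in>Q. g q + ennreal (K * (\<Sum>i<N. nrm (\<omega> i - q i)))) \<le> g \<omega> + ennreal e" .
    qed
  qed
  have m: "(\<lambda>\<omega>. nrm (\<omega> i - q i)) \<in> borel_measurable (sample_measure N P)" if "i \<in> {..<N}" for i and q :: "nat \<Rightarrow> 'a"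
  proof -
    have "(\<lambda>z. nrm (z - q i)) \<in> borel_measurable P"
      using borel_measurable_is_norm[OF n] measurable_cong_sets[OF sets refl, of "borel :: real measure"] by simp
    then show ?thesis using that by (intro measurable_compose[OF measurable_sample_component]) auto
  qed
  have "(\<lambda>\<omega>. INF q\<in>Q. g q + ennreal (K * (\<Sum>i<N. nrm (\<omega> i - q i)))) \<in> borel_measurable (sample_measure N P)"
    by (intro borel_measurable_INF[OF cQ] borel_measurable_add borel_measurable_const
        measurable_compose[OF _ measurable_ennreal] borel_measurable_times borel_measurable_sum m)
  then show ?thesis by (subst ext[OF eq])
qed

text \<open>
The values may be infinite, so closeness is expressed by one-sided additive bounds instead of a
modulus of continuity.
\<close>

lemma ennreal_le_from_dense:
  fixes X Y :: "'b::metric_space \<Rightarrow> ennreal"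
  assumes C: "0 \<le> C" and X: "\<And>a b. X a \<le> X b + ennreal (C * dist a b)"
    and Y: "\<And>a b. Y a \<le> Y b + ennreal (C * dist a b)"
    and D: "\<And>U. open U \<Longrightarrow> U \<noteq> {} \<Longrightarrow> \<exists>d\<in>D. d \<in> U" and le: "\<And>d. d \<in> D \<Longrightarrow> X d \<le> Y d"
  shows "X a \<le> Y a"
proof (rule ennreal_le_epsilon)
  fix e :: real assume e: "0 < e"
  define \<delta> where "\<delta> = e / (2 * (C + 1))"
  have \<delta>: "0 < \<delta>" using e C by (simp add: \<delta>_def)
  then obtain d where d: "d \<in> D" "dist a d < \<delta>" using D[of "ball a \<delta>"] by auto
  have "C * dist a d \<le> (C + 1) * \<delta>" using d C by (intro mult_mono) auto
  also have "\<dots> = e / 2" using C by (simp add: \<delta>_def field_simps)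
  finally have small: "ennreal (C * dist a d) \<le> ennreal (e / 2)" by (rule ennreal_leI)
  have "X a \<le> X d + ennreal (C * dist a d)" by (rule X)
  also have "\<dots> \<le> (Y a + ennreal (C * dist a d)) + ennreal (C * dist a d)"
    using le[OF d(1)] Y[of d a] by (intro add_right_mono) (simp add: dist_commute order_trans)
  also have "\<dots> \<le> (Y a + ennreal (e / 2)) + ennreal (e / 2)" using small by (intro add_mono) auto
  also have "\<dots> = Y a + ennreal e" using e by (simp add: add.assoc ennreal_plus[symmetric] del: ennreal_plus)
  finally show "X a \<le> Y a + ennreal e" .
qed

text \<open>
The vector \<open>g\<close> for which the residual of a data point \<open>z\<close> is \<open>g \<bullet> z - s\<close>.
\<close>

definition residual_direction :: "real^'d \<Rightarrow> (real^'d) \<times> real" where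
  "residual_direction \<beta> = (- \<beta>, 1)"

definition regression_loss :: "real \<Rightarrow> (real^'d) \<times> real \<Rightarrow> (real^'d) \<times> real \<Rightarrow> real" where
  "regression_loss \<alpha> \<theta> z = check_loss \<alpha> (residual_direction (fst \<theta>) \<bullet> z - snd \<theta>)"

lemma risk_eq: "risk \<alpha> F \<beta> s = (\<integral>\<^sup>+z. ennreal (regression_loss \<alpha> (\<beta>, s) z) \<partial>F)"
  unfolding risk_def regression_loss_def residual_direction_def
  by (intro nn_integral_cong) (auto simp: inner_prod_def algebra_simps)

lemma borel_measurable_regression_loss [measurable]:
  "regression_loss \<alpha> \<theta> \<in> borel_measurable borel"
  unfolding regression_loss_def[abs_def] by measurable

lemma regression_loss_Lipschitz_data:
  fixes nrm :: "(real^'d) \<times> real \<Rightarrow> real"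
  assumes n: "is_norm nrm" and \<alpha>: "0 < \<alpha>" "\<alpha> < 1"
  shows "regression_loss \<alpha> \<theta> y \<le> regression_loss \<alpha> \<theta> z
    + max \<alpha> (1 - \<alpha>) * dual_norm nrm (residual_direction (fst \<theta>)) * nrm (y - z)"
proof -
  let ?g = "residual_direction (fst \<theta>)"
  have "\<bar>regression_loss \<alpha> \<theta> y - regression_loss \<alpha> \<theta> z\<bar> \<le> max \<alpha> (1 - \<alpha>) * \<bar>?g \<bullet> (y - z)\<bar>"
    unfolding regression_loss_def using check_loss_diff_le[OF \<alpha>, of "?g \<bullet> y - snd \<theta>" "?g \<bullet> z - snd \<theta>"]
    by (simp add: inner_diff_right)
  also have "\<dots> \<le> max \<alpha> (1 - \<alpha>) * (dual_norm nrm ?g * nrm (y - z))"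
    using \<alpha> by (intro mult_left_mono abs_inner_le_dual_norm[OF n]) auto
  finally show ?thesis by (simp add: mult.assoc)
qed

lemma regression_loss_Lipschitz_parameter:
  assumes \<alpha>: "0 < \<alpha>" "\<alpha> < 1"
  shows "regression_loss \<alpha> \<theta> z \<le> regression_loss \<alpha> \<theta>' z + (norm z + 1) * dist \<theta> \<theta>'"
proof -
  let ?u = "residual_direction (fst \<theta>) \<bullet> z - snd \<theta>" and ?v = "residual_direction (fst \<theta>') \<bullet> z - snd \<theta>'"
  have "\<bar>?u - ?v\<bar> \<le> \<bar>(fst \<theta> - fst \<theta>') \<bullet> fst z\<bar> + \<bar>snd \<theta> - snd \<theta>'\<bar>"
    by (simp add: residual_direction_def inner_prod_def inner_diff_left)
  also have "\<dots> \<le> norm (fst \<theta> - fst \<theta>') * norm (fst z) + \<bar>snd \<theta> - snd \<theta>'\<bar>"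
    by (intro add_right_mono Cauchy_Schwarz_ineq2)
  also have "\<dots> \<le> dist \<theta> \<theta>' * norm z + dist \<theta> \<theta>'"
    using norm_fst_le[of "fst (\<theta> - \<theta>')" "snd (\<theta> - \<theta>')"] norm_snd_le[of "snd (\<theta> - \<theta>')" "fst (\<theta> - \<theta>')"]
      norm_fst_le[of "fst z" "snd z"]
      prod_eq_iff[of "(fst \<theta> - fst \<theta>', snd \<theta> - snd \<theta>')" "\<theta> - \<theta>'"]
    by (intro add_mono mult_mono) (simp_all add: dist_norm)
  finally have "\<bar>?u - ?v\<bar> \<le> (norm z + 1) * dist \<theta> \<theta>'" by (simp add: algebra_simps)
  moreover have "max \<alpha> (1 - \<alpha>) * \<bar>?u - ?v\<bar> \<le> 1 * \<bar>?u - ?v\<bar>" using \<alpha> by (intro mult_right_mono) auto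
  ultimately have "max \<alpha> (1 - \<alpha>) * \<bar>?u - ?v\<bar> \<le> (norm z + 1) * dist \<theta> \<theta>'" by simp
  from order_trans[OF check_loss_diff_le[OF \<alpha>, of ?u ?v] this]
  have "check_loss \<alpha> ?u - check_loss \<alpha> ?v \<le> (norm z + 1) * dist \<theta> \<theta>'" by (rule abs_le_D1)
  then show ?thesis unfolding regression_loss_def by (simp only: diff_le_eq add.commute)
qed

lemma risk_Lipschitz_parameter:
  fixes nrm :: "(real^'d) \<times> real \<Rightarrow> real"
  assumes n: "is_norm nrm" and \<alpha>: "0 < \<alpha>" "\<alpha> < 1" and F: "F \<in> distributions"
    and C: "0 < C" "\<And>x. norm x \<le> C * nrm x" and m: "(\<integral>\<^sup>+z. ennreal (nrm z) \<partial>F) \<le> ennreal m" "0 \<le> m"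
  shows "risk \<alpha> F \<beta> s \<le> risk \<alpha> F \<beta>' s' + ennreal ((C * m + 1) * dist (\<beta>, s) (\<beta>', s'))"
proof -
  let ?d = "dist (\<beta>, s) (\<beta>', s')"
  interpret F: prob_space F using F by (simp add: distributions_def)
  have mF: "g \<in> borel_measurable F \<longleftrightarrow> g \<in> borel_measurable borel" for g :: "(real^'d) \<times> real \<Rightarrow> ennreal"
    using F measurable_cong_sets[of F borel "borel :: ennreal measure"] by (simp add: distributions_def)
  have l0: "0 \<le> regression_loss \<alpha> \<theta> z" for \<theta> z :: "(real^'d) \<times> real"
    unfolding regression_loss_def by (rule check_loss_nonneg[OF \<alpha>])
  have "risk \<alpha> F \<beta> s \<le> (\<integral>\<^sup>+z. ennreal (regression_loss \<alpha> (\<beta>', s') z) + (ennreal (C * ?d) * ennreal (nrm z) + ennreal ?d) \<partial>F)"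
    unfolding risk_eq
  proof (rule nn_integral_mono)
    fix z
    have "regression_loss \<alpha> (\<beta>, s) z \<le> regression_loss \<alpha> (\<beta>', s') z + (norm z + 1) * ?d"
      by (rule regression_loss_Lipschitz_parameter[OF \<alpha>])
    also have "\<dots> \<le> regression_loss \<alpha> (\<beta>', s') z + (C * nrm z + 1) * ?d"
      using C(2)[of z] by (intro add_left_mono mult_right_mono) auto
    finally have "ennreal (regression_loss \<alpha> (\<beta>, s) z) \<le> ennreal (regression_loss \<alpha> (\<beta>', s') z + (C * ?d * nrm z + ?d))"
      by (intro ennreal_leI) (simp add: algebra_simps)
    also have "\<dots> = ennreal (regression_loss \<alpha> (\<beta>', s') z) + (ennreal (C * ?d) * ennreal (nrm z) + ennreal ?d)"
      using l0 C(1) is_norm_nonneg[OF n] by (simp add: ennreal_mult[symmetric])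
    finally show "ennreal (regression_loss \<alpha> (\<beta>, s) z)
      \<le> ennreal (regression_loss \<alpha> (\<beta>', s') z) + (ennreal (C * ?d) * ennreal (nrm z) + ennreal ?d)" .
  qed
  also have "\<dots> = risk \<alpha> F \<beta>' s' + (ennreal (C * ?d) * (\<integral>\<^sup>+z. ennreal (nrm z) \<partial>F) + ennreal ?d)"
  proof -
    have 1: "(\<lambda>z. ennreal (regression_loss \<alpha> (\<beta>', s') z)) \<in> borel_measurable F" unfolding mF by measurable
    have 2: "(\<lambda>z. ennreal (nrm z)) \<in> borel_measurable F"
      unfolding mF using borel_measurable_is_norm[OF n] by measurable
    show ?thesis unfolding risk_eq using 1 2 by (simp add: nn_integral_add nn_integral_cmult F.emeasure_space_1)
  qed
  also have "\<dots> \<le> risk \<alpha> F \<beta>' s' + (ennreal (C * ?d) * ennreal m + ennreal ?d)"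
    using m by (intro add_left_mono add_right_mono mult_left_mono) auto
  also have "ennreal (C * ?d) * ennreal m + ennreal ?d = ennreal ((C * m + 1) * ?d)"
    using C m by (simp add: ennreal_mult[symmetric] ennreal_plus[symmetric] algebra_simps del: ennreal_plus)
  finally show ?thesis .
qed

text \<open>
Every sample point is moved by \<open>\<epsilon>\<close> along a vector \<open>v\<close> at which the dual norm is attained, with the
sign of its residual, so that each residual grows in absolute value by \<open>\<epsilon>\<close> times the dual norm.
\<close>

lemma worst_case_risk_ge_empirical:
  fixes nrm :: "(real^'d) \<times> real \<Rightarrow> real"
  assumes n: "is_norm nrm" and \<alpha>: "0 < \<alpha>" "\<alpha> < 1" and p: "1 \<le> p" and N: "1 \<le> N" and \<epsilon>: "0 \<le> \<epsilon>"
  shows "ennreal ((\<Sum>i<N. regression_loss \<alpha> (\<beta>, s) (\<omega> i)) / N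
      + min \<alpha> (1 - \<alpha>) * (\<epsilon> * dual_norm nrm (residual_direction \<beta>)))
    \<le> worst_case_risk nrm p \<epsilon> \<alpha> (empirical N \<omega>) \<beta> s"
proof -
  let ?g = "residual_direction \<beta>" let ?l = "regression_loss \<alpha> (\<beta>, s)"
  define \<gamma> where "\<gamma> = dual_norm nrm ?g"
  have \<gamma>: "0 \<le> \<gamma>" unfolding \<gamma>_def by (rule is_norm_nonneg[OF is_norm_dual_norm[OF n]])
  obtain v where v: "nrm v \<le> 1" "?g \<bullet> v = \<gamma>" using dual_norm_attained[OF n, of ?g] unfolding \<gamma>_def by metis
  define u where "u i = ?g \<bullet> \<omega> i - s" for i
  \<comment> \<open>the residual is pushed away from zero\<close>
  define k where "k i = (if 0 \<le> u i then \<epsilon> else - \<epsilon>)" for i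
  have "empirical N (\<lambda>i. \<omega> i + k i *\<^sub>R v) \<in> wasserstein_ball nrm p (empirical N \<omega>) \<epsilon>"
  proof (rule shifted_empirical_in_ball[OF n p N \<epsilon>])
    fix i
    have "nrm (k i *\<^sub>R v) = \<epsilon> * nrm v" using \<epsilon> by (simp add: is_norm_scaleR[OF n] k_def)
    then show "nrm (k i *\<^sub>R v) \<le> \<epsilon>" using v(1) \<epsilon> mult_left_mono[of "nrm v" 1 \<epsilon>] by simp
  qed
  then have upper: "risk \<alpha> (empirical N (\<lambda>i. \<omega> i + k i *\<^sub>R v)) \<beta> s \<le> worst_case_risk nrm p \<epsilon> \<alpha> (empirical N \<omega>) \<beta> s"
    unfolding worst_case_risk_def by (rule SUP_upper)
  have "risk \<alpha> (empirical N (\<lambda>i. \<omega> i + k i *\<^sub>R v)) \<beta> s = (\<Sum>i<N. ennreal (1 / N) * ennreal (?l (\<omega> i + k i *\<^sub>R v)))"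
    unfolding risk_eq by (rule nn_integral_empirical) measurable
  also have "\<dots> = ennreal (\<Sum>i<N. 1 / N * ?l (\<omega> i + k i *\<^sub>R v))"
    using check_loss_nonneg[OF \<alpha>] by (simp add: ennreal_mult[symmetric] sum_ennreal regression_loss_def)
  finally have risk_shift: "risk \<alpha> (empirical N (\<lambda>i. \<omega> i + k i *\<^sub>R v)) \<beta> s = ennreal (\<Sum>i<N. 1 / N * ?l (\<omega> i + k i *\<^sub>R v))" .
  have "(\<Sum>i<N. ?l (\<omega> i)) / N + min \<alpha> (1 - \<alpha>) * (\<epsilon> * \<gamma>) \<le> (\<Sum>i<N. 1 / N * ?l (\<omega> i + k i *\<^sub>R v))"
  proof -
    have a: "0 \<le> \<epsilon> * \<gamma>" using \<epsilon> \<gamma> by simp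
    have l: "?l z = check_loss \<alpha> (?g \<bullet> z - s)" for z by (simp add: regression_loss_def)
    have lu: "?l (\<omega> i) = check_loss \<alpha> (u i)" for i by (simp add: l u_def)
    have "?l (\<omega> i) + min \<alpha> (1 - \<alpha>) * (\<epsilon> * \<gamma>) \<le> ?l (\<omega> i + k i *\<^sub>R v)" for i
    proof (cases "0 \<le> u i")
      case True
      then have "?g \<bullet> (\<omega> i + k i *\<^sub>R v) - s = u i + \<epsilon> * \<gamma>" by (simp add: u_def k_def inner_add_right v)
      then have "?l (\<omega> i + k i *\<^sub>R v) = check_loss \<alpha> (u i + \<epsilon> * \<gamma>)" by (simp only: l)
      then show ?thesis using check_loss_push(1)[OF \<alpha> a True] by (simp only: lu)
    next
      case False
      then have "?g \<bullet> (\<omega> i + k i *\<^sub>R v) - s = u i - \<epsilon> * \<gamma>" by (simp add: u_def k_def inner_add_right v inner_diff_right)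
      then have "?l (\<omega> i + k i *\<^sub>R v) = check_loss \<alpha> (u i - \<epsilon> * \<gamma>)" by (simp only: l)
      then show ?thesis using check_loss_push(2)[OF \<alpha> a, of "u i"] False by (simp only: lu not_le)
    qed
    then have "(\<Sum>i<N. ?l (\<omega> i) + min \<alpha> (1 - \<alpha>) * (\<epsilon> * \<gamma>)) \<le> (\<Sum>i<N. ?l (\<omega> i + k i *\<^sub>R v))" by (rule sum_mono)
    then have "(\<Sum>i<N. ?l (\<omega> i)) + N * (min \<alpha> (1 - \<alpha>) * (\<epsilon> * \<gamma>)) \<le> (\<Sum>i<N. ?l (\<omega> i + k i *\<^sub>R v))"
      by (simp add: sum.distrib)
    then have "((\<Sum>i<N. ?l (\<omega> i)) + N * (min \<alpha> (1 - \<alpha>) * (\<epsilon> * \<gamma>))) / N \<le> (\<Sum>i<N. ?l (\<omega> i + k i *\<^sub>R v)) / N"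
      by (rule divide_right_mono) simp
    then show ?thesis using N by (simp add: add_divide_distrib sum_divide_distrib)
  qed
  from order_trans[OF ennreal_leI[OF this] upper[unfolded risk_shift]] show ?thesis
    unfolding \<gamma>_def .
qed

lemma worst_case_risk_Lipschitz_parameter:
  fixes nrm :: "(real^'d) \<times> real \<Rightarrow> real"
  assumes n: "is_norm nrm" and \<alpha>: "0 < \<alpha>" "\<alpha> < 1" and p: "1 \<le> p" and N: "1 \<le> N" and \<epsilon>: "0 \<le> \<epsilon>"
    and C: "0 < C" "\<And>x. norm x \<le> C * nrm x"
  shows "worst_case_risk nrm p \<epsilon> \<alpha> (empirical N \<omega>) \<beta> s \<le> worst_case_risk nrm p \<epsilon> \<alpha> (empirical N \<omega>) \<beta>' s'
    + ennreal ((C * (moment_bound p (\<epsilon> + 1) + (\<Sum>i<N. nrm (\<omega> i))) + 1) * dist (\<beta>, s) (\<beta>', s'))"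
  unfolding worst_case_risk_def[of _ _ _ _ _ \<beta> s]
proof (rule SUP_least)
  fix F assume F: "F \<in> wasserstein_ball nrm p (empirical N \<omega>) \<epsilon>"
  let ?m = "moment_bound p (\<epsilon> + 1) + (\<Sum>i<N. nrm (\<omega> i))"
  have m: "0 \<le> ?m" using \<epsilon> by (auto simp: moment_bound_def intro!: add_nonneg_nonneg sum_nonneg is_norm_nonneg[OF n])
  have "risk \<alpha> F \<beta> s \<le> risk \<alpha> F \<beta>' s' + ennreal ((C * ?m + 1) * dist (\<beta>, s) (\<beta>', s'))"
    using F by (intro risk_Lipschitz_parameter[OF n \<alpha> _ C first_moment_in_ball[OF n p N \<epsilon> F] m])
      (simp add: wasserstein_ball_def)
  also have "risk \<alpha> F \<beta>' s' \<le> worst_case_risk nrm p \<epsilon> \<alpha> (empirical N \<omega>) \<beta>' s'"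
    unfolding worst_case_risk_def by (rule SUP_upper[OF F])
  finally show "risk \<alpha> F \<beta> s \<le> worst_case_risk nrm p \<epsilon> \<alpha> (empirical N \<omega>) \<beta>' s'
    + ennreal ((C * ?m + 1) * dist (\<beta>, s) (\<beta>', s'))" by (simp add: add_right_mono)
qed

lemma borel_measurable_worst_case_risk:
  fixes nrm :: "(real^'d) \<times> real \<Rightarrow> real"
  assumes n: "is_norm nrm" and \<alpha>: "0 < \<alpha>" "\<alpha> < 1" and p: "1 \<le> p" and N: "1 \<le> N" and \<epsilon>: "0 < \<epsilon>"
    and sets: "sets P = sets borel"
  shows "(\<lambda>\<omega>. worst_case_risk nrm p \<epsilon> \<alpha> (empirical N \<omega>) \<beta> s) \<in> borel_measurable (sample_measure N P)"
proof (rule borel_measurable_sample_Lipschitz[OF n sets])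
  let ?K = "max \<alpha> (1 - \<alpha>) * dual_norm nrm (residual_direction \<beta>)"
  show K: "0 \<le> ?K" using \<alpha> is_norm_nonneg[OF is_norm_dual_norm[OF n]] by simp
  show "worst_case_risk nrm p \<epsilon> \<alpha> (empirical N \<omega>) \<beta> s
    \<le> worst_case_risk nrm p \<epsilon> \<alpha> (empirical N \<omega>') \<beta> s + ennreal (?K * (\<Sum>i<N. nrm (\<omega> i - \<omega>' i)))" for \<omega> \<omega>'
    unfolding worst_case_risk_def risk_eq
    using regression_loss_Lipschitz_data[OF n \<alpha>, of "(\<beta>, s)"] check_loss_nonneg[OF \<alpha>]
    by (intro ball_sup_Lipschitz_in_sample[OF n p N \<epsilon> _ _ K]) (auto simp: regression_loss_def)
qed

section \<open>The out-of-sample guarantee\<close>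

lemma dual_norm_residual_direction_pos:
  fixes nrm :: "(real^'d) \<times> real \<Rightarrow> real"
  assumes "is_norm nrm"
  shows "0 < dual_norm nrm (residual_direction \<beta>)"
  using is_norm_nonneg[OF is_norm_dual_norm[OF assms], of "residual_direction \<beta>"]
    is_norm_eq_0[OF is_norm_dual_norm[OF assms], of "residual_direction \<beta>"]
  by (auto simp: residual_direction_def prod_eq_iff less_le)

text \<open>
By positive homogeneity of the check loss, the loss is \<open>\<gamma>\<close> times the normalized function \<open>f\<close> plus
a constant, and the constant contributes equally to the true and the empirical risk.
\<close>

lemma risk_le_of_deviation:
  fixes nrm :: "(real^'d) \<times> real \<Rightarrow> real" and x :: "nat \<Rightarrow> (real^'d) \<times> real"
    and \<beta> :: "real^'d" and s :: real
  assumes n: "is_norm nrm" and P: "P \<in> distributions" and \<alpha>: "0 < \<alpha>" "\<alpha> < 1" and N: "1 \<le> N"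
    and i: "integrable P nrm"
  defines "\<gamma> \<equiv> dual_norm nrm (residual_direction \<beta>)"
  defines "f \<equiv> \<lambda>z. check_loss \<alpha> ((1 / \<gamma>) *\<^sub>R residual_direction \<beta> \<bullet> z - s / \<gamma>) - check_loss \<alpha> (- (s / \<gamma>))"
  assumes dev: "(\<Sum>i<N. integral\<^sup>L P f - f (x i)) \<le> B"
  shows "risk \<alpha> P \<beta> s \<le> ennreal ((\<Sum>i<N. regression_loss \<alpha> (\<beta>, s) (x i)) / N + \<gamma> * (B / N))"
proof -
  let ?l = "regression_loss \<alpha> (\<beta>, s)" let ?g = "residual_direction \<beta>"
  interpret P: prob_space P using P by (simp add: distributions_def)
  have mP: "h \<in> borel_measurable P \<longleftrightarrow> h \<in> borel_measurable borel" for h :: "(real^'d) \<times> real \<Rightarrow> real"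
    using P measurable_cong_sets[of P borel "borel :: real measure"] by (simp add: distributions_def)
  have \<gamma>: "0 < \<gamma>" unfolding \<gamma>_def by (rule dual_norm_residual_direction_pos[OF n])
  have l: "?l z = \<gamma> * f z + check_loss \<alpha> (- s)" for z
  proof -
    have "\<gamma> * check_loss \<alpha> ((1 / \<gamma>) *\<^sub>R ?g \<bullet> z - s / \<gamma>) = ?l z"
      using \<gamma> by (simp add: check_loss_scale[OF \<gamma>, symmetric] regression_loss_def right_diff_distrib)
    moreover have "\<gamma> * check_loss \<alpha> (- (s / \<gamma>)) = check_loss \<alpha> (- s)"
      using \<gamma> by (simp add: check_loss_scale[OF \<gamma>, symmetric])
    ultimately show ?thesis by (simp add: f_def right_diff_distrib)
  qed
  have fi: "integrable P f"
  proof (rule Bochner_Integration.integrable_bound)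
    show "integrable P (\<lambda>z. max \<alpha> (1 - \<alpha>) * nrm z)" using i by simp
    show "f \<in> borel_measurable P" unfolding mP f_def by measurable
    show "AE z in P. norm (f z) \<le> norm (max \<alpha> (1 - \<alpha>) * nrm z)"
    proof (rule AE_I2)
      fix z
      have "\<bar>f z\<bar> \<le> max \<alpha> (1 - \<alpha>) * \<bar>(1 / \<gamma>) *\<^sub>R ?g \<bullet> z\<bar>"
        unfolding f_def using check_loss_diff_le[OF \<alpha>, of "(1 / \<gamma>) *\<^sub>R ?g \<bullet> z - s / \<gamma>" "- (s / \<gamma>)"] by simp
      also have "\<bar>(1 / \<gamma>) *\<^sub>R ?g \<bullet> z\<bar> \<le> nrm z"
        using abs_inner_le_dual_norm[OF n, of ?g z] \<gamma> by (simp add: \<gamma>_def[symmetric] field_simps)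
      finally show "norm (f z) \<le> norm (max \<alpha> (1 - \<alpha>) * nrm z)"
        using \<alpha> is_norm_nonneg[OF n, of z] by (simp add: mult_left_mono)
    qed
  qed
  have "N * integral\<^sup>L P f \<le> (\<Sum>i<N. f (x i)) + B" using dev by (simp add: sum_subtractf)
  then have "integral\<^sup>L P f \<le> ((\<Sum>i<N. f (x i)) + B) / N" using N by (simp add: field_simps)
  then have "\<gamma> * integral\<^sup>L P f \<le> \<gamma> * (((\<Sum>i<N. f (x i)) + B) / N)" using \<gamma> by (intro mult_left_mono) auto
  moreover have "(\<Sum>i<N. ?l (x i)) / N = \<gamma> * ((\<Sum>i<N. f (x i)) / N) + check_loss \<alpha> (- s)"
    using N by (simp add: l sum.distrib sum_distrib_left[symmetric] add_divide_distrib)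
  ultimately have le: "\<gamma> * integral\<^sup>L P f + check_loss \<alpha> (- s) \<le> (\<Sum>i<N. ?l (x i)) / N + \<gamma> * (B / N)"
    by (simp add: add_divide_distrib distrib_left)
  have "risk \<alpha> P \<beta> s = ennreal (integral\<^sup>L P ?l)"
    unfolding risk_eq
  proof (rule nn_integral_eq_integral)
    show "integrable P ?l" unfolding l[abs_def] using fi by simp
    show "AE z in P. 0 \<le> ?l z" using check_loss_nonneg[OF \<alpha>] by (simp add: regression_loss_def)
  qed
  also have "integral\<^sup>L P ?l = \<gamma> * integral\<^sup>L P f + check_loss \<alpha> (- s)"
    unfolding l[abs_def] using fi by (simp add: P.prob_space)
  finally show ?thesis using le by (simp add: ennreal_leI)
qed

text \<open>
The ratio of slopes in the radius turns the Lipschitz constant \<open>max \<alpha> (1 - \<alpha>)\<close> of the statistical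
side into the gain \<open>min \<alpha> (1 - \<alpha>)\<close> of the robust side; and \<open>ln (2 N + 1) \<ge> 1\<close> as \<open>N \<ge> 1\<close>.
\<close>

lemma radius_ge:
  assumes \<alpha>: "0 < \<alpha>" "\<alpha> < 1" and r: "2 < r" and \<Gamma>: "0 \<le> \<Gamma>" and N: "1 \<le> N" and \<eta>: "0 < \<eta>" "\<eta> < 1"
  shows "0 < radius d \<alpha> r \<Gamma> N \<eta>"
    and "max \<alpha> (1 - \<alpha>) * sqrt N * (360 * sqrt (real d + 2) + 2 * sqrt (2 * ln (3 / \<eta>))
        + sqrt (3 * \<Gamma> / \<eta>) * (32 / (r - 2)) * sqrt (ln (24 / \<eta>) + 2 * (real d + 2))) / N
      \<le> min \<alpha> (1 - \<alpha>) * radius d \<alpha> r \<Gamma> N \<eta>"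
proof -
  define C where "C = 360 * sqrt (real d + 2) + 2 * sqrt (2 * ln (3 / \<eta>))
      + sqrt (3 * \<Gamma> / \<eta>) * (32 / (r - 2)) * sqrt (ln (24 / \<eta>) + 2 * (real d + 2))"
  define \<Lambda> where "\<Lambda> = ln (2 * real N + 1) powr (1 / r)"
  let ?L = "max \<alpha> (1 - \<alpha>)" let ?m = "min \<alpha> (1 - \<alpha>)"
  have "0 \<le> ln (3 / \<eta>)" "0 \<le> ln (24 / \<eta>)" using \<eta> by (auto intro!: ln_ge_zero simp: field_simps)
  then have C: "0 < C" unfolding C_def using r \<Gamma> \<eta> by (intro add_pos_nonneg mult_nonneg_nonneg) auto
  have L: "0 < ?L" "0 < ?m" using \<alpha> by auto
  have "exp 1 \<le> (3 :: real)" by (rule exp_le)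
  also have "\<dots> \<le> 2 * real N + 1" using N by simp
  finally have "1 \<le> ln (2 * real N + 1)" by (subst ln_ge_iff) auto
  then have \<Lambda>: "1 \<le> \<Lambda>" unfolding \<Lambda>_def using r by (intro ge_one_powr_ge_zero) auto
  have sN: "0 < sqrt N" using N by simp
  have radius: "radius d \<alpha> r \<Gamma> N \<eta> = ?L / ?m * C * \<Lambda> / sqrt N"
    by (simp add: radius_def c_const_def C_def \<Lambda>_def)
  show "0 < radius d \<alpha> r \<Gamma> N \<eta>" unfolding radius using L C \<Lambda> sN by simp
  have "?L * sqrt N * C / N = ?L * C / sqrt N"
    using N by (simp add: real_div_sqrt field_simps)
  also have "\<dots> \<le> ?L * C * \<Lambda> / sqrt N"
    using L C \<Lambda> mult_left_mono[of 1 \<Lambda> "?L * C"] by (intro divide_right_mono) auto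
  also have "\<dots> = ?m * (?L / ?m * C * \<Lambda> / sqrt N)"
  proof -
    have "l * a * b / c = m * (l / m * a * b / c)" if "m \<noteq> 0" for l m a b c :: real using that by simp
    from this[OF less_imp_neq[OF L(2), symmetric]] show ?thesis .
  qed
  finally show "?L * sqrt N * (360 * sqrt (real d + 2) + 2 * sqrt (2 * ln (3 / \<eta>))
        + sqrt (3 * \<Gamma> / \<eta>) * (32 / (r - 2)) * sqrt (ln (24 / \<eta>) + 2 * (real d + 2))) / N
      \<le> ?m * radius d \<alpha> r \<Gamma> N \<eta>" by (simp only: radius C_def)
qed

theorem theorem3:
  fixes nrm :: "(real^'d) \<times> real \<Rightarrow> real"
    and Fstar :: "((real^'d) \<times> real) measure"
    and p :: ereal
    and \<alpha> r \<Gamma> \<eta> \<epsilon> :: real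
    and N :: nat
  assumes "is_norm nrm"
    and "0 < \<alpha>" and "\<alpha> < 1"
    and "1 \<le> p"
    and "Fstar \<in> distributions"
    and "2 < r"
    and "integrable Fstar (\<lambda>z. nrm z powr r)"
    and "\<Gamma> = (\<integral>z. nrm z powr r \<partial>Fstar)"
    and "1 \<le> N"
    and "0 < \<eta>" and "\<eta> < 1"
    and "\<epsilon> = radius CARD('d) \<alpha> r \<Gamma> N \<eta>"
  shows "measure (sample_measure N Fstar)
           {\<omega> \<in> space (sample_measure N Fstar). \<forall>\<beta> s.
              risk \<alpha> Fstar \<beta> s \<le> worst_case_risk nrm p \<epsilon> \<alpha> (empirical N \<omega>) \<beta> s} \<ge> 1 - \<eta>
    \<and> (\<forall>\<beta>hat shat.
         (\<forall>\<omega> \<in> space (sample_measure N Fstar).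
            dro_optimal nrm p \<epsilon> \<alpha> (empirical N \<omega>) (\<beta>hat \<omega>) (shat \<omega>)) \<longrightarrow>
         (\<exists>A \<in> sets (sample_measure N Fstar).
            (\<forall>\<omega> \<in> A. risk \<alpha> Fstar (\<beta>hat \<omega>) (shat \<omega>) \<le> dro_value nrm p \<epsilon> \<alpha> (empirical N \<omega>)) \<and>
            measure (sample_measure N Fstar) A \<ge> 1 - \<eta>) \<and>
         (\<beta>hat \<in> borel_measurable (sample_measure N Fstar) \<and>
          shat \<in> borel_measurable (sample_measure N Fstar) \<longrightarrow>
            measure (sample_measure N Fstar)
              {\<omega> \<in> space (sample_measure N Fstar).
                 risk \<alpha> Fstar (\<beta>hat \<omega>) (shat \<omega>) \<le> dro_value nrm p \<epsilon> \<alpha> (empirical N \<omega>)}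
              \<ge> 1 - \<eta>))"
proof -
  note n = assms(1) and \<alpha> = assms(2,3) and p = assms(4) and r = assms(6) and N = assms(9) and \<eta> = assms(10,11)
  let ?S = "sample_measure N Fstar"
  have P: "prob_space Fstar" and sets: "sets Fstar = sets borel" using assms(5) by (auto simp: distributions_def)
  interpret F: prob_space Fstar by (rule P)
  interpret S: prob_space ?S using P by (rule prob_space_sample_measure)
  have \<Gamma>: "0 \<le> \<Gamma>" using assms(8) by simp
  note \<epsilon> = radius_ge[OF \<alpha> r \<Gamma> N \<eta>, of "CARD('d)", folded assms(12)]
  have inrm: "integrable Fstar nrm" by (rule truncated_moments(1)[OF n P sets r assms(7)])
  define W where "W \<omega> \<theta> = worst_case_risk nrm p \<epsilon> \<alpha> (empirical N \<omega>) (fst \<theta>) (snd \<theta>)" for \<omega> \<theta>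
  define R where "R \<theta> = risk \<alpha> Fstar (fst \<theta>) (snd \<theta>)" for \<theta>
  obtain C where C: "C > 0" "\<And>x. norm x \<le> C * nrm x" using norm_le_is_norm[OF n] by metis
  define m where "m = integral\<^sup>L Fstar nrm"
  have m0: "0 \<le> m" unfolding m_def by (intro integral_nonneg_AE AE_I2 is_norm_nonneg[OF n])
  have Em: "(\<integral>\<^sup>+z. ennreal (nrm z) \<partial>Fstar) \<le> ennreal m"
    unfolding m_def using inrm by (subst nn_integral_eq_integral) (auto simp: is_norm_nonneg[OF n])
  \<comment> \<open>a common Lipschitz constant in the parameters for the true and the worst-case risk\<close>
  define k where "k \<omega> = C * (moment_bound p (\<epsilon> + 1) + (\<Sum>i<N. nrm (\<omega> i))) + 1 + C * m" for \<omega>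
  have mb: "0 \<le> moment_bound p (\<epsilon> + 1) + (\<Sum>i<N. nrm (\<omega> i))" for \<omega>
    using \<epsilon>(1) by (auto simp: moment_bound_def intro!: add_nonneg_nonneg sum_nonneg is_norm_nonneg[OF n])
  have k0: "0 \<le> k \<omega>" for \<omega> unfolding k_def using C(1) m0 mb[of \<omega>] by simp
  have RL: "R a \<le> R b + ennreal (k \<omega> * dist a b)" for a b \<omega>
  proof -
    have "R a \<le> R b + ennreal ((C * m + 1) * dist a b)"
      using risk_Lipschitz_parameter[OF n \<alpha> assms(5) C Em m0, of "fst a" "snd a" "fst b" "snd b"] by (simp add: R_def)
    also have "\<dots> \<le> R b + ennreal (k \<omega> * dist a b)"
      using C(1) mb[of \<omega>] by (intro add_left_mono ennreal_leI mult_right_mono) (auto simp: k_def)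
    finally show ?thesis .
  qed
  have WL: "W \<omega> a \<le> W \<omega> b + ennreal (k \<omega> * dist a b)" for a b \<omega>
  proof -
    have "W \<omega> a \<le> W \<omega> b + ennreal ((C * (moment_bound p (\<epsilon> + 1) + (\<Sum>i<N. nrm (\<omega> i))) + 1) * dist a b)"
      using worst_case_risk_Lipschitz_parameter[OF n \<alpha> p N less_imp_le[OF \<epsilon>(1)] C, of \<omega> "fst a" "snd a" "fst b" "snd b"]
      by (simp add: W_def)
    also have "\<dots> \<le> W \<omega> b + ennreal (k \<omega> * dist a b)"
      using C(1) m0 by (intro add_left_mono ennreal_leI mult_right_mono) (auto simp: k_def)
    finally show ?thesis .
  qed
  obtain D :: "((real^'d) \<times> real) set" where D: "countable D" "\<And>U. open U \<Longrightarrow> U \<noteq> {} \<Longrightarrow> \<exists>d\<in>D. d \<in> U"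
    using countable_dense_setE by blast
  have D0: "D \<noteq> {}" using D(2)[of UNIV] by auto
  have Wm: "(\<lambda>\<omega>. W \<omega> \<theta>) \<in> borel_measurable ?S" for \<theta>
    unfolding W_def by (rule borel_measurable_worst_case_risk[OF n \<alpha> p N \<epsilon>(1) sets])
  define E where "E = {\<omega> \<in> space ?S. \<forall>\<theta>\<in>D. R \<theta> \<le> W \<omega> \<theta>}"
  have E_iff: "(\<forall>\<theta>\<in>D. R \<theta> \<le> W \<omega> \<theta>) \<longleftrightarrow> (\<forall>\<theta>. R \<theta> \<le> W \<omega> \<theta>)" for \<omega>
    using ennreal_le_from_dense[OF k0 RL WL D(2)] by blast
  have Em_sets: "E \<in> sets ?S"
  proof -
    have "E = space ?S \<inter> (\<Inter>\<theta>\<in>D. {\<omega> \<in> space ?S. R \<theta> \<le> W \<omega> \<theta>})" using D0 by (auto simp: E_def)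
    also have "\<dots> \<in> sets ?S"
      using Wm by (intro sets.Int sets.countable_INT'[OF D(1) D0]) auto
    finally show ?thesis .
  qed
  have prob_E: "1 - \<eta> \<le> measure ?S E"
  proof -
    define \<gamma> where "\<gamma> \<theta> = dual_norm nrm (residual_direction (fst \<theta>))" for \<theta> :: "(real^'d) \<times> real"
    have \<gamma>: "0 < \<gamma> \<theta>" for \<theta> unfolding \<gamma>_def by (rule dual_norm_residual_direction_pos[OF n])
    define w where "w \<theta> = (1 / \<gamma> \<theta>) *\<^sub>R residual_direction (fst \<theta>)" for \<theta> :: "(real^'d) \<times> real"
    have w: "dual_norm nrm (w \<theta>) \<le> 1" for \<theta>
      using \<gamma>[of \<theta>] by (simp add: w_def is_norm_scaleR[OF is_norm_dual_norm[OF n]] \<gamma>_def[symmetric])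
    define f where "f \<theta> z = check_loss \<alpha> (w \<theta> \<bullet> z - snd \<theta> / \<gamma> \<theta>) - check_loss \<alpha> (- (snd \<theta> / \<gamma> \<theta>))" for \<theta> z
    define B where "B = max \<alpha> (1 - \<alpha>) * sqrt N * (360 * sqrt (real CARD('d) + 2) + 2 * sqrt (2 * ln (3 / \<eta>))
        + sqrt (3 * \<Gamma> / \<eta>) * (32 / (r - 2)) * sqrt (ln (24 / \<eta>) + 2 * (real CARD('d) + 2)))"
    have dim: "DIM((real^'d) \<times> real) + 1 = CARD('d) + 2" by simp
    have dim2: "real (CARD('d) + 2) = real CARD('d) + 2" "real (2 * (CARD('d) + 2)) = 2 * (real CARD('d) + 2)" by simp_all
    note dev = uniform_deviation_countable[OF n P sets \<alpha> r assms(7) N \<eta> D(1) D0 w, of "\<lambda>\<theta>. \<theta>" "\<lambda>\<theta>. snd \<theta> / \<gamma> \<theta>",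
        folded assms(8) f_def, unfolded dim dim2, folded B_def]
    have "1 - \<eta> \<le> measure ?S {x \<in> space ?S. \<forall>\<theta>\<in>D. (\<Sum>i<N. integral\<^sup>L Fstar (f \<theta>) - f \<theta> (x i)) \<le> B}"
      using dev(2) by (simp add: f_def[abs_def])
    also have "\<dots> \<le> measure ?S E"
    proof (rule S.finite_measure_mono[OF _ Em_sets], safe)
      fix x assume x: "x \<in> space ?S" and le: "\<forall>\<theta>\<in>D. (\<Sum>i<N. integral\<^sup>L Fstar (f \<theta>) - f \<theta> (x i)) \<le> B"
      have "R \<theta> \<le> W x \<theta>" if \<theta>: "\<theta> \<in> D" for \<theta>
      proof -
        let ?e = "(\<Sum>i<N. regression_loss \<alpha> (fst \<theta>, snd \<theta>) (x i)) / N"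
        have "(\<Sum>i<N. integral\<^sup>L Fstar (f \<theta>) - f \<theta> (x i)) \<le> B" using le \<theta> by blast
        then have "R \<theta> \<le> ennreal (?e + \<gamma> \<theta> * (B / N))"
          unfolding R_def \<gamma>_def
          by (intro risk_le_of_deviation[OF n assms(5) \<alpha> N inrm]) (simp add: f_def[abs_def] w_def \<gamma>_def)
        also have "\<dots> \<le> ennreal (?e + min \<alpha> (1 - \<alpha>) * (\<epsilon> * \<gamma> \<theta>))"
        proof -
          have "\<gamma> \<theta> * (B / N) \<le> \<gamma> \<theta> * (min \<alpha> (1 - \<alpha>) * \<epsilon>)"
            using \<epsilon>(2) \<gamma>[of \<theta>] by (intro mult_left_mono) (auto simp: B_def)
          then show ?thesis by (intro ennreal_leI) (simp add: mult_ac)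
        qed
        also have "\<dots> \<le> W x \<theta>"
          unfolding W_def \<gamma>_def by (rule worst_case_risk_ge_empirical[OF n \<alpha> p N less_imp_le[OF \<epsilon>(1)]])
        finally show ?thesis .
      qed
      then show "x \<in> E" using x by (simp add: E_def)
    qed
    finally show ?thesis .
  qed
  have E_eq: "E = {\<omega> \<in> space ?S. \<forall>\<beta> s. risk \<alpha> Fstar \<beta> s \<le> worst_case_risk nrm p \<epsilon> \<alpha> (empirical N \<omega>) \<beta> s}"
    unfolding E_def E_iff by (simp add: R_def W_def split_paired_All)
  have dro: "dro_value nrm p \<epsilon> \<alpha> (empirical N \<omega>) = (INF \<theta>\<in>D. W \<omega> \<theta>)" for \<omega>
  proof -
    have "(INF \<theta>\<in>D. W \<omega> \<theta>) \<le> W \<omega> \<theta>" for \<theta>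
      by (rule ennreal_le_from_dense[OF k0[of \<omega>] _ WL D(2), of "\<lambda>_. INF \<theta>\<in>D. W \<omega> \<theta>"]) (auto intro: INF_lower)
    then have "(INF \<theta>\<in>D. W \<omega> \<theta>) = (INF \<theta>. W \<omega> \<theta>)"
      by (intro antisym INF_superset_mono INF_greatest) auto
    then show ?thesis by (simp add: dro_value_def W_def case_prod_beta')
  qed
  have dro_m: "(\<lambda>\<omega>. dro_value nrm p \<epsilon> \<alpha> (empirical N \<omega>)) \<in> borel_measurable ?S"
    unfolding dro by (intro borel_measurable_INF[OF D(1)] Wm)
  have R_fin: "R \<theta> \<noteq> \<infinity>" for \<theta>
  proof -
    have l: "regression_loss \<alpha> \<theta> z \<le> regression_loss \<alpha> \<theta> 0 + max \<alpha> (1 - \<alpha>) * dual_norm nrm (residual_direction (fst \<theta>)) * nrm z" for z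
      using regression_loss_Lipschitz_data[OF n \<alpha>, of \<theta> z 0] by simp
    have nn: "0 \<le> regression_loss \<alpha> \<theta> z" for z unfolding regression_loss_def by (rule check_loss_nonneg[OF \<alpha>])
    have mm: "regression_loss \<alpha> \<theta> \<in> borel_measurable Fstar"
      using measurable_cong_sets[OF sets refl, of "borel :: real measure"] by simp
    have "integrable Fstar (regression_loss \<alpha> \<theta>)"
    proof (rule Bochner_Integration.integrable_bound[OF _ mm])
      show "integrable Fstar (\<lambda>z. regression_loss \<alpha> \<theta> 0 + max \<alpha> (1 - \<alpha>) * dual_norm nrm (residual_direction (fst \<theta>)) * nrm z)"
        using inrm by simp
    qed (use l nn in \<open>auto intro!: AE_I2 intro: order_trans[OF _ abs_ge_self]\<close>)
    then show ?thesis unfolding R_def risk_eq using nn by (subst nn_integral_eq_integral) auto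
  qed
  have R_m: "R \<in> borel_measurable borel"
  proof -
    have "\<bar>enn2real (R a) - enn2real (R b)\<bar> \<le> k (\<lambda>_. 0) * dist a b" for a b
    proof -
      have one: "enn2real (R a) \<le> enn2real (R b) + k (\<lambda>_. 0) * dist a b" for a b
      proof (rule enn2real_leI)
        have "R b = ennreal (enn2real (R b))" using R_fin[of b] by (simp add: less_top)
        then show "R a \<le> ennreal (enn2real (R b) + k (\<lambda>_. 0) * dist a b)"
          using RL[of a b "\<lambda>_. 0"] k0[of "\<lambda>_. 0"] by simp
      qed (use k0[of "\<lambda>_. 0"] in simp)
      show ?thesis using one[of a b] one[of b a] by (simp add: dist_commute abs_le_iff)
    qed
    then have "(k (\<lambda>_. 0))-lipschitz_on UNIV (\<lambda>\<theta>. enn2real (R \<theta>))"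
      using k0 by (intro lipschitz_onI) (auto simp: dist_real_def)
    then have "continuous_on UNIV (\<lambda>\<theta>. enn2real (R \<theta>))" by (rule lipschitz_on_continuous_on)
    then have [measurable]: "(\<lambda>\<theta>. enn2real (R \<theta>)) \<in> borel_measurable borel" by (rule borel_measurable_continuous_onI)
    have "(\<lambda>\<theta>. ennreal (enn2real (R \<theta>))) \<in> borel_measurable borel" by measurable
    moreover have "(\<lambda>\<theta>. ennreal (enn2real (R \<theta>))) = R" using R_fin by (simp add: less_top fun_eq_iff)
    ultimately show ?thesis by simp
  qed
  show ?thesis
  proof (intro conjI allI impI)
    show "1 - \<eta> \<le> measure ?S {\<omega> \<in> space ?S. \<forall>\<beta> s.
        risk \<alpha> Fstar \<beta> s \<le> worst_case_risk nrm p \<epsilon> \<alpha> (empirical N \<omega>) \<beta> s}"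
      using prob_E unfolding E_eq .
  next
    fix \<beta>hat shat
    assume opt: "\<forall>\<omega> \<in> space ?S. dro_optimal nrm p \<epsilon> \<alpha> (empirical N \<omega>) (\<beta>hat \<omega>) (shat \<omega>)"
    have good: "risk \<alpha> Fstar (\<beta>hat \<omega>) (shat \<omega>) \<le> dro_value nrm p \<epsilon> \<alpha> (empirical N \<omega>)" if "\<omega> \<in> E" for \<omega>
    proof -
      have "worst_case_risk nrm p \<epsilon> \<alpha> (empirical N \<omega>) (\<beta>hat \<omega>) (shat \<omega>) = dro_value nrm p \<epsilon> \<alpha> (empirical N \<omega>)"
        using that opt by (auto simp: E_def dro_optimal_def)
      moreover have "risk \<alpha> Fstar (\<beta>hat \<omega>) (shat \<omega>) \<le> worst_case_risk nrm p \<epsilon> \<alpha> (empirical N \<omega>) (\<beta>hat \<omega>) (shat \<omega>)"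
        using that unfolding E_eq by blast
      ultimately show ?thesis by (rule subst)
    qed
    show "\<exists>A \<in> sets ?S. (\<forall>\<omega> \<in> A. risk \<alpha> Fstar (\<beta>hat \<omega>) (shat \<omega>) \<le> dro_value nrm p \<epsilon> \<alpha> (empirical N \<omega>)) \<and>
        1 - \<eta> \<le> measure ?S A"
      using Em_sets good prob_E by blast
    assume "\<beta>hat \<in> borel_measurable ?S \<and> shat \<in> borel_measurable ?S"
    then have [measurable]: "\<beta>hat \<in> borel_measurable ?S" "shat \<in> borel_measurable ?S" by auto
    have "(\<lambda>\<omega>. R (\<beta>hat \<omega>, shat \<omega>)) \<in> borel_measurable ?S"
      by (rule measurable_compose[OF _ R_m]) measurable
    then have "{\<omega> \<in> space ?S. R (\<beta>hat \<omega>, shat \<omega>) \<le> dro_value nrm p \<epsilon> \<alpha> (empirical N \<omega>)} \<in> sets ?S"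
      using dro_m by measurable
    then have "measure ?S E \<le> measure ?S {\<omega> \<in> space ?S. R (\<beta>hat \<omega>, shat \<omega>) \<le> dro_value nrm p \<epsilon> \<alpha> (empirical N \<omega>)}"
      using good by (intro S.finite_measure_mono) (auto simp: R_def E_def)
    then show "1 - \<eta> \<le> measure ?S {\<omega> \<in> space ?S. risk \<alpha> Fstar (\<beta>hat \<omega>) (shat \<omega>) \<le> dro_value nrm p \<epsilon> \<alpha> (empirical N \<omega>)}"
      using prob_E by (simp add: R_def)
  qed
qed

end
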